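(* Let $(M,\omega)$ be a connected symplectic manifold with a Hamiltonian circle action. Let $K$ be a connected Lie group, with locally closed coadjoint orbits, which acts properly and in a Hamiltonian fashion on $M$. Assume also that the $K$-action commutes with the circle action. If $M$ is a $K$ multiplicity-free space, then the $K$-action induced on any symplectic cut $M^\lambda$, $\lambda\in\mathbb R$, is multiplicity-free as well.
   Context: Hamiltonian: an action of a Lie group $K$ preserving $\omega$ with moment map $\mu:M\to\mathfrak k^*$ such that $d\mu^X=i_{X^\#}\omega$ for $X\in\mathfrak k$ and $\mu(kp)=Ad^*(k)\mu(p)$. $M$ is a $K$ multiplicity-free space if $C^\infty(M)^K$ is commutative for the Poisson bracket $\{f,g\}=\omega(X_f,X_g)$, $df=i_{X_f}\omega$. Symplectic cut: let $\phi:M\to\mathbb R$ be the moment map of the circle group $T^1$. On $M\times\mathbb C$ with symplectic form $\omega-\frac{i}{2}dz\wedge d\bar z$, $T^1$ acts by the product action (multiplication on $\mathbb C$), with moment map $\psi(p,z)=\phi(p)+\frac12|z|^2$. For $\lambda\in\mathbb R$ the symplectic cut is the reduced space $M^\lambda=\psi^{-1}(\lambda)/T^1$. Its smooth functions are $C^\infty(M^\lambda)=C^\infty(M\times\mathbb C)^{T^1}|_{\psi^{-1}(\lambda)}$, regarded as functions on the quotient, with the Poisson bracket induced from $C^\infty(M\times\mathbb C)^{T^1}$ (when $T^1$ acts freely on $\psi^{-1}(\lambda)$ this is the usual reduced symplectic manifold). The action $k(m,z)=(km,z)$ of $K$ on $M\times\mathbb C$ commutes with $T^1$ and induces a Hamiltonian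 $K$-action on $M^\lambda$ with moment map $[m,z]\mapsto\mu(m)$. The $K$-action on $M^\lambda$ is multiplicity-free if the $K$-invariant functions in $C^\infty(M^\lambda)$ commute under the Poisson bracket. *)

theory Defs
  imports "HOL-Analysis.Analysis" "HOL-Algebra.Group_Action"
begin

section \<open>Smooth manifolds\<close>

text \<open>Manifolds live on whole types of sort \<open>{t2_space, second_countable_topology}\<close>.  The model
  spaces have sort \<open>{real_inner, heine_borel}\<close>: these are the finite-dimensional inner product
  spaces, including the zero space, which \<open>euclidean_space\<close> would exclude.\<close>

type_synonym ('m, 'e) chart = "'m set \<times> ('m \<Rightarrow> 'e)"

text \<open>The following two notions are only used on open sets; by finite-dimensionality it does not
  matter that the derivative is required to be \<open>C\<^sup>k\<close> one direction at a time.\<close>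

primrec Ck_on :: "nat \<Rightarrow> 'e::real_normed_vector set \<Rightarrow> ('e \<Rightarrow> 'f::real_normed_vector) \<Rightarrow> bool" where
  "Ck_on 0 U f \<longleftrightarrow> continuous_on U f"
| "Ck_on (Suc k) U f \<longleftrightarrow>
     (\<forall>x\<in>U. f differentiable (at x)) \<and> (\<forall>v. Ck_on k U (\<lambda>x. frechet_derivative f (at x) v))"

definition smooth_on :: "'e::real_normed_vector set \<Rightarrow> ('e \<Rightarrow> 'f::real_normed_vector) \<Rightarrow> bool" where
  "smooth_on U f \<longleftrightarrow> (\<forall>k. Ck_on k U f)"

text \<open>An atlas need not be maximal.\<close>

definition smooth_atlas ::
  "('m::topological_space, 'e::{real_inner,heine_borel}) chart set \<Rightarrow> bool" where
  "smooth_atlas A \<longleftrightarrow>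
     (\<forall>(U, x)\<in>A. open U \<and> open (x ` U) \<and> homeomorphism U (x ` U) x (inv_into U x)) \<and>
     (\<Union>(U, x)\<in>A. U) = UNIV \<and>
     (\<forall>(U, x)\<in>A. \<forall>(V, y)\<in>A. smooth_on (x ` (U \<inter> V)) (y \<circ> inv_into U x))"

definition smooth_fun ::
  "('m::topological_space, 'e::{real_inner,heine_borel}) chart set \<Rightarrow> ('m \<Rightarrow> real) \<Rightarrow> bool" where
  "smooth_fun A f \<longleftrightarrow> (\<forall>(U, x)\<in>A. smooth_on (x ` U) (f \<circ> inv_into U x))"

definition smooth_map ::
  "('m::topological_space, 'e::{real_inner,heine_borel}) chart set \<Rightarrow>
   ('n::topological_space, 'f::{real_inner,heine_borel}) chart set \<Rightarrow> ('m \<Rightarrow> 'n) \<Rightarrow> bool" where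
  "smooth_map A B F \<longleftrightarrow> continuous_on UNIV F \<and>
     (\<forall>(U, x)\<in>A. \<forall>(V, y)\<in>B. smooth_on (x ` (U \<inter> F -` V)) (y \<circ> F \<circ> inv_into U x))"

definition std_atlas :: "('e, 'e) chart set" where
  "std_atlas = {(UNIV, id)}"

definition prod_atlas ::
  "('m, 'e) chart set \<Rightarrow> ('n, 'f) chart set \<Rightarrow> ('m \<times> 'n, 'e \<times> 'f) chart set" where
  "prod_atlas A B = {(U \<times> V, map_prod x y) | U x V y. (U, x) \<in> A \<and> (V, y) \<in> B}"


section \<open>Tangent vectors and vector fields\<close>

text \<open>Tangent vectors are derivations of the algebra of smooth functions at a point, made unique as
  HOL functions by letting them vanish on functions that are not smooth.\<close>

type_synonym 'm tvec = "('m \<Rightarrow> real) \<Rightarrow> real"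

definition tangent ::
  "('m::topological_space, 'e::{real_inner,heine_borel}) chart set \<Rightarrow> 'm \<Rightarrow> 'm tvec set" where
  "tangent A p = {v.
     (\<forall>f g a b. smooth_fun A f \<longrightarrow> smooth_fun A g \<longrightarrow>
        v (\<lambda>x. a * f x + b * g x) = a * v f + b * v g) \<and>
     (\<forall>f g. smooth_fun A f \<longrightarrow> smooth_fun A g \<longrightarrow>
        v (\<lambda>x. f x * g x) = f p * v g + g p * v f) \<and>
     (\<forall>f. \<not> smooth_fun A f \<longrightarrow> v f = 0)}"

text \<open>The differential of a map \<open>F\<close> with codomain atlas \<open>B\<close>.\<close>

definition push ::
  "('n::topological_space, 'f::{real_inner,heine_borel}) chart set \<Rightarrow> ('m \<Rightarrow> 'n) \<Rightarrow>
   'm tvec \<Rightarrow> 'n tvec" where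
  "push B F v = (\<lambda>h. if smooth_fun B h then v (h \<circ> F) else 0)"

definition vector_field ::
  "('m::topological_space, 'e::{real_inner,heine_borel}) chart set \<Rightarrow> ('m \<Rightarrow> 'm tvec) \<Rightarrow> bool" where
  "vector_field A X \<longleftrightarrow> (\<forall>p. X p \<in> tangent A p) \<and>
     (\<forall>f. smooth_fun A f \<longrightarrow> smooth_fun A (\<lambda>p. X p f))"

definition lie_bracket :: "('m \<Rightarrow> 'm tvec) \<Rightarrow> ('m \<Rightarrow> 'm tvec) \<Rightarrow> 'm \<Rightarrow> 'm tvec" where
  "lie_bracket X Y = (\<lambda>p f. X p (\<lambda>q. Y q f) - Y p (\<lambda>q. X q f))"


section \<open>Symplectic forms and Poisson brackets\<close>

type_synonym 'm form2 = "'m \<Rightarrow> 'm tvec \<Rightarrow> 'm tvec \<Rightarrow> real"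

definition two_form ::
  "('m::topological_space, 'e::{real_inner,heine_borel}) chart set \<Rightarrow> 'm form2 \<Rightarrow> bool" where
  "two_form A \<omega> \<longleftrightarrow>
     (\<forall>p. \<forall>u\<in>tangent A p. \<forall>v\<in>tangent A p. \<forall>w\<in>tangent A p. \<forall>a b.
        \<omega> p (\<lambda>f. a * u f + b * v f) w = a * \<omega> p u w + b * \<omega> p v w) \<and>
     (\<forall>p. \<forall>u\<in>tangent A p. \<forall>v\<in>tangent A p. \<omega> p u v = - \<omega> p v u) \<and>
     (\<forall>X Y. vector_field A X \<longrightarrow> vector_field A Y \<longrightarrow> smooth_fun A (\<lambda>p. \<omega> p (X p) (Y p)))"

definition ext_deriv ::
  "'m form2 \<Rightarrow> ('m \<Rightarrow> 'm tvec) \<Rightarrow> ('m \<Rightarrow> 'm tvec) \<Rightarrow> ('m \<Rightarrow> 'm tvec) \<Rightarrow> 'm \<Rightarrow> real" where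
  "ext_deriv \<omega> X Y Z p =
     X p (\<lambda>q. \<omega> q (Y q) (Z q)) - Y p (\<lambda>q. \<omega> q (X q) (Z q)) + Z p (\<lambda>q. \<omega> q (X q) (Y q))
     - \<omega> p (lie_bracket X Y p) (Z p) + \<omega> p (lie_bracket X Z p) (Y p)
     - \<omega> p (lie_bracket Y Z p) (X p)"

definition symplectic_manifold ::
  "('m::topological_space, 'e::{real_inner,heine_borel}) chart set \<Rightarrow> 'm form2 \<Rightarrow> bool" where
  "symplectic_manifold A \<omega> \<longleftrightarrow> smooth_atlas A \<and> two_form A \<omega> \<and>
     (\<forall>X Y Z p. vector_field A X \<longrightarrow> vector_field A Y \<longrightarrow> vector_field A Z \<longrightarrow>
        ext_deriv \<omega> X Y Z p = 0) \<and>
     (\<forall>p. \<forall>u\<in>tangent A p. (\<forall>v\<in>tangent A p. \<omega> p u v = 0) \<longrightarrow> u = (\<lambda>f. 0))"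

text \<open>\<open>i\<^sub>\<xi> \<omega> = df\<close> at the point \<open>p\<close>.\<close>

definition contracts_to ::
  "('m::topological_space, 'e::{real_inner,heine_borel}) chart set \<Rightarrow> 'm form2 \<Rightarrow>
   'm \<Rightarrow> 'm tvec \<Rightarrow> ('m \<Rightarrow> real) \<Rightarrow> bool" where
  "contracts_to A \<omega> p \<xi> f \<longleftrightarrow> (\<forall>v\<in>tangent A p. v f = \<omega> p \<xi> v)"

definition ham_vf ::
  "('m::topological_space, 'e::{real_inner,heine_borel}) chart set \<Rightarrow> 'm form2 \<Rightarrow>
   ('m \<Rightarrow> real) \<Rightarrow> 'm \<Rightarrow> 'm tvec" where
  "ham_vf A \<omega> f p = (THE \<xi>. \<xi> \<in> tangent A p \<and> contracts_to A \<omega> p \<xi> f)"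

definition poisson ::
  "('m::topological_space, 'e::{real_inner,heine_borel}) chart set \<Rightarrow> 'm form2 \<Rightarrow>
   ('m \<Rightarrow> real) \<Rightarrow> ('m \<Rightarrow> real) \<Rightarrow> 'm \<Rightarrow> real" where
  "poisson A \<omega> f g p = \<omega> p (ham_vf A \<omega> f p) (ham_vf A \<omega> g p)"

definition preserves_form ::
  "('m::topological_space, 'e::{real_inner,heine_borel}) chart set \<Rightarrow> 'm form2 \<Rightarrow>
   ('m \<Rightarrow> 'm) \<Rightarrow> bool" where
  "preserves_form A \<omega> F \<longleftrightarrow>
     (\<forall>p. \<forall>u\<in>tangent A p. \<forall>v\<in>tangent A p. \<omega> (F p) (push A F u) (push A F v) = \<omega> p u v)"


section \<open>Lie groups and the coadjoint representation\<close>

definition lie_group ::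
  "'k monoid \<Rightarrow> ('k::topological_space, 'f::{real_inner,heine_borel}) chart set \<Rightarrow> bool" where
  "lie_group K B \<longleftrightarrow> group K \<and> carrier K = UNIV \<and> smooth_atlas B \<and>
     smooth_map (prod_atlas B B) B (\<lambda>(g, h). g \<otimes>\<^bsub>K\<^esub> h) \<and>
     smooth_map B B (\<lambda>g. inv\<^bsub>K\<^esub> g)"

definition lie_algebra ::
  "'k monoid \<Rightarrow> ('k::topological_space, 'f::{real_inner,heine_borel}) chart set \<Rightarrow> 'k tvec set" where
  "lie_algebra K B = tangent B \<one>\<^bsub>K\<^esub>"

text \<open>The dual of the Lie algebra; its elements are made unique as HOL functions by letting them
  vanish outside the Lie algebra.  As a subset of a function type it carries the topology of
  pointwise convergence, i.e. its canonical topology as a finite-dimensional vector space.\<close>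

definition lie_dual ::
  "'k monoid \<Rightarrow> ('k::topological_space, 'f::{real_inner,heine_borel}) chart set \<Rightarrow>
   ('k tvec \<Rightarrow> real) set" where
  "lie_dual K B = {\<alpha>.
     (\<forall>X\<in>lie_algebra K B. \<forall>Y\<in>lie_algebra K B. \<forall>a b.
        \<alpha> (\<lambda>f. a * X f + b * Y f) = a * \<alpha> X + b * \<alpha> Y) \<and>
     (\<forall>X. X \<notin> lie_algebra K B \<longrightarrow> \<alpha> X = 0)}"

definition Ad ::
  "'k monoid \<Rightarrow> ('k::topological_space, 'f::{real_inner,heine_borel}) chart set \<Rightarrow>
   'k \<Rightarrow> 'k tvec \<Rightarrow> 'k tvec" where
  "Ad K B k = push B (\<lambda>h. k \<otimes>\<^bsub>K\<^esub> h \<otimes>\<^bsub>K\<^esub> inv\<^bsub>K\<^esub> k)"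

definition Ad_dual ::
  "'k monoid \<Rightarrow> ('k::topological_space, 'f::{real_inner,heine_borel}) chart set \<Rightarrow>
   'k \<Rightarrow> ('k tvec \<Rightarrow> real) \<Rightarrow> 'k tvec \<Rightarrow> real" where
  "Ad_dual K B k \<alpha> = (\<lambda>X. if X \<in> lie_algebra K B then \<alpha> (Ad K B (inv\<^bsub>K\<^esub> k) X) else 0)"

definition coadjoint_orbit ::
  "'k monoid \<Rightarrow> ('k::topological_space, 'f::{real_inner,heine_borel}) chart set \<Rightarrow>
   ('k tvec \<Rightarrow> real) \<Rightarrow> ('k tvec \<Rightarrow> real) set" where
  "coadjoint_orbit K B \<alpha> = {Ad_dual K B k \<alpha> | k. k \<in> carrier K}"

definition locally_closed_in :: "'a topology \<Rightarrow> 'a set \<Rightarrow> bool" where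
  "locally_closed_in X S \<longleftrightarrow> (\<exists>U C. openin X U \<and> closedin X C \<and> S = U \<inter> C)"


section \<open>Hamiltonian actions\<close>

definition smooth_action ::
  "'k monoid \<Rightarrow> ('k::topological_space, 'f::{real_inner,heine_borel}) chart set \<Rightarrow>
   ('m::topological_space, 'e::{real_inner,heine_borel}) chart set \<Rightarrow> ('k \<Rightarrow> 'm \<Rightarrow> 'm) \<Rightarrow> bool" where
  "smooth_action K B A act \<longleftrightarrow> group_action K UNIV act \<and>
     smooth_map (prod_atlas B A) A (\<lambda>(k, p). act k p)"

definition proper_action ::
  "('k::topological_space \<Rightarrow> 'm::topological_space \<Rightarrow> 'm) \<Rightarrow> bool" where
  "proper_action act \<longleftrightarrow> proper_map euclidean euclidean (\<lambda>(k, p). (act k p, p))"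

text \<open>The fundamental vector field \<open>X\<^sup>#\<close> at \<open>p\<close>, i.e. the derivative of \<open>exp (t X) p\<close> at \<open>t = 0\<close>, is
  the image of \<open>X\<close> under the differential of the orbit map at the unit.\<close>

definition fundamental_vf ::
  "('m::topological_space, 'e::{real_inner,heine_borel}) chart set \<Rightarrow> ('k \<Rightarrow> 'm \<Rightarrow> 'm) \<Rightarrow>
   'k tvec \<Rightarrow> 'm \<Rightarrow> 'm tvec" where
  "fundamental_vf A act X p = push A (\<lambda>k. act k p) X"

definition hamiltonian_action ::
  "'k monoid \<Rightarrow> ('k::topological_space, 'f::{real_inner,heine_borel}) chart set \<Rightarrow>
   ('m::topological_space, 'e::{real_inner,heine_borel}) chart set \<Rightarrow> 'm form2 \<Rightarrow>
   ('k \<Rightarrow> 'm \<Rightarrow> 'm) \<Rightarrow> ('m \<Rightarrow> 'k tvec \<Rightarrow> real) \<Rightarrow> bool" where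
  "hamiltonian_action K B A \<omega> act \<mu> \<longleftrightarrow> smooth_action K B A act \<and>
     (\<forall>k. preserves_form A \<omega> (act k)) \<and>
     (\<forall>p. \<mu> p \<in> lie_dual K B) \<and>
     (\<forall>X\<in>lie_algebra K B. smooth_fun A (\<lambda>p. \<mu> p X) \<and>
        (\<forall>p. contracts_to A \<omega> p (fundamental_vf A act X p) (\<lambda>q. \<mu> q X))) \<and>
     (\<forall>k p. \<mu> (act k p) = Ad_dual K B k (\<mu> p))"

definition circle_group :: "complex monoid" where
  "circle_group = \<lparr>carrier = sphere 0 1, mult = (*), one = 1\<rparr>"

definition circle_vf ::
  "('m::topological_space, 'e::{real_inner,heine_borel}) chart set \<Rightarrow> (complex \<Rightarrow> 'm \<Rightarrow> 'm) \<Rightarrow>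
   'm \<Rightarrow> 'm tvec" where
  "circle_vf A \<tau> p = (\<lambda>f. if smooth_fun A f then deriv (\<lambda>t::real. f (\<tau> (cis t) p)) 0 else 0)"

text \<open>Smoothness of a circle action is expressed through the covering \<open>cis\<close> of the circle, which is a
  local diffeomorphism; its Lie algebra is identified with the reals via the same map.\<close>

definition hamiltonian_circle_action ::
  "('m::topological_space, 'e::{real_inner,heine_borel}) chart set \<Rightarrow> 'm form2 \<Rightarrow>
   (complex \<Rightarrow> 'm \<Rightarrow> 'm) \<Rightarrow> ('m \<Rightarrow> real) \<Rightarrow> bool" where
  "hamiltonian_circle_action A \<omega> \<tau> \<phi> \<longleftrightarrow> group_action circle_group UNIV \<tau> \<and>
     smooth_map (prod_atlas std_atlas A) A (\<lambda>(t::real, p). \<tau> (cis t) p) \<and>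
     (\<forall>u\<in>carrier circle_group. preserves_form A \<omega> (\<tau> u)) \<and>
     smooth_fun A \<phi> \<and>
     (\<forall>p. contracts_to A \<omega> p (circle_vf A \<tau> p) \<phi>) \<and>
     (\<forall>u\<in>carrier circle_group. \<forall>p. \<phi> (\<tau> u p) = \<phi> p)"

definition multiplicity_free ::
  "('m::topological_space, 'e::{real_inner,heine_borel}) chart set \<Rightarrow> 'm form2 \<Rightarrow>
   ('k \<Rightarrow> 'm \<Rightarrow> 'm) \<Rightarrow> bool" where
  "multiplicity_free A \<omega> act \<longleftrightarrow>
     (\<forall>f g. smooth_fun A f \<longrightarrow> smooth_fun A g \<longrightarrow>
        (\<forall>k p. f (act k p) = f p) \<longrightarrow> (\<forall>k p. g (act k p) = g p) \<longrightarrow>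
        (\<forall>p. poisson A \<omega> f g p = 0))"


section \<open>Symplectic cuts\<close>

text \<open>The form \<open>-(\<i>/2) dz \<and> d(cnj z)\<close>, which is real and equals \<open>- dx \<and> dy\<close>.\<close>

definition dz :: "complex tvec \<Rightarrow> complex" where
  "dz u = Complex (u Re) (u Im)"

definition complex_form :: "complex form2" where
  "complex_form z u v = Re (- (\<i> / 2) * (dz u * cnj (dz v) - dz v * cnj (dz u)))"

definition ext_atlas ::
  "('m, 'e) chart set \<Rightarrow> ('m \<times> complex, 'e \<times> complex) chart set" where
  "ext_atlas A = prod_atlas A std_atlas"

definition ext_form ::
  "('m::topological_space, 'e::{real_inner,heine_borel}) chart set \<Rightarrow> 'm form2 \<Rightarrow>
   ('m \<times> complex) form2" where
  "ext_form A \<omega> = (\<lambda>(p, z) u v. \<omega> p (push A fst u) (push A fst v)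
     + complex_form z (push std_atlas snd u) (push std_atlas snd v))"

definition ext_circle :: "(complex \<Rightarrow> 'm \<Rightarrow> 'm) \<Rightarrow> complex \<Rightarrow> 'm \<times> complex \<Rightarrow> 'm \<times> complex" where
  "ext_circle \<tau> u = (\<lambda>(p, z). (\<tau> u p, u * z))"

definition ext_act :: "('k \<Rightarrow> 'm \<Rightarrow> 'm) \<Rightarrow> 'k \<Rightarrow> 'm \<times> complex \<Rightarrow> 'm \<times> complex" where
  "ext_act act k = (\<lambda>(p, z). (act k p, z))"

definition ext_moment :: "('m \<Rightarrow> real) \<Rightarrow> 'm \<times> complex \<Rightarrow> real" where
  "ext_moment \<phi> = (\<lambda>(p, z). \<phi> p + (cmod z)\<^sup>2 / 2)"

text \<open>Points of the cut are circle orbits in the level set.\<close>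

definition cut :: "(complex \<Rightarrow> 'm \<Rightarrow> 'm) \<Rightarrow> ('m \<Rightarrow> real) \<Rightarrow> real \<Rightarrow> ('m \<times> complex) set set" where
  "cut \<tau> \<phi> c = orbit circle_group (ext_circle \<tau>) ` (ext_moment \<phi> -` {c})"

text \<open>\<open>f\<close> is a smooth circle-invariant function inducing the function \<open>F\<close> on the cut.  The values of
  \<open>F\<close> outside the cut are irrelevant.\<close>

definition cut_represents ::
  "('m::topological_space, 'e::{real_inner,heine_borel}) chart set \<Rightarrow> (complex \<Rightarrow> 'm \<Rightarrow> 'm) \<Rightarrow>
   ('m \<Rightarrow> real) \<Rightarrow> real \<Rightarrow> ('m \<times> complex \<Rightarrow> real) \<Rightarrow> (('m \<times> complex) set \<Rightarrow> real) \<Rightarrow> bool" where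
  "cut_represents A \<tau> \<phi> c f F \<longleftrightarrow> smooth_fun (ext_atlas A) f \<and>
     (\<forall>u\<in>carrier circle_group. \<forall>x. f (ext_circle \<tau> u x) = f x) \<and>
     (\<forall>x. ext_moment \<phi> x = c \<longrightarrow> F (orbit circle_group (ext_circle \<tau>) x) = f x)"

definition cut_smooth_fun ::
  "('m::topological_space, 'e::{real_inner,heine_borel}) chart set \<Rightarrow> (complex \<Rightarrow> 'm \<Rightarrow> 'm) \<Rightarrow>
   ('m \<Rightarrow> real) \<Rightarrow> real \<Rightarrow> (('m \<times> complex) set \<Rightarrow> real) \<Rightarrow> bool" where
  "cut_smooth_fun A \<tau> \<phi> c F \<longleftrightarrow> (\<exists>f. cut_represents A \<tau> \<phi> c f F)"

text \<open>The induced bracket: the common value of the brackets of all representatives.\<close>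

definition cut_poisson ::
  "('m::topological_space, 'e::{real_inner,heine_borel}) chart set \<Rightarrow> 'm form2 \<Rightarrow>
   (complex \<Rightarrow> 'm \<Rightarrow> 'm) \<Rightarrow> ('m \<Rightarrow> real) \<Rightarrow> real \<Rightarrow> (('m \<times> complex) set \<Rightarrow> real) \<Rightarrow>
   (('m \<times> complex) set \<Rightarrow> real) \<Rightarrow> ('m \<times> complex) set \<Rightarrow> real" where
  "cut_poisson A \<omega> \<tau> \<phi> c F G S =
     (THE r. \<exists>f g. \<exists>x\<in>S. cut_represents A \<tau> \<phi> c f F \<and> cut_represents A \<tau> \<phi> c g G \<and>
        r = poisson (ext_atlas A) (ext_form A \<omega>) f g x)"

definition cut_invariant ::
  "(complex \<Rightarrow> 'm \<Rightarrow> 'm) \<Rightarrow> ('m \<Rightarrow> real) \<Rightarrow> real \<Rightarrow> ('k \<Rightarrow> 'm \<Rightarrow> 'm) \<Rightarrow>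
   (('m \<times> complex) set \<Rightarrow> real) \<Rightarrow> bool" where
  "cut_invariant \<tau> \<phi> c act F \<longleftrightarrow> (\<forall>S\<in>cut \<tau> \<phi> c. \<forall>k. F (ext_act act k ` S) = F S)"

definition cut_multiplicity_free ::
  "('m::topological_space, 'e::{real_inner,heine_borel}) chart set \<Rightarrow> 'm form2 \<Rightarrow>
   (complex \<Rightarrow> 'm \<Rightarrow> 'm) \<Rightarrow> ('m \<Rightarrow> real) \<Rightarrow> real \<Rightarrow> ('k \<Rightarrow> 'm \<Rightarrow> 'm) \<Rightarrow> bool" where
  "cut_multiplicity_free A \<omega> \<tau> \<phi> c act \<longleftrightarrow>
     (\<forall>F G. cut_smooth_fun A \<tau> \<phi> c F \<longrightarrow> cut_smooth_fun A \<tau> \<phi> c G \<longrightarrow>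
        cut_invariant \<tau> \<phi> c act F \<longrightarrow> cut_invariant \<tau> \<phi> c act G \<longrightarrow>
        (\<forall>S\<in>cut \<tau> \<phi> c. cut_poisson A \<omega> \<tau> \<phi> c F G S = 0))"

end

theory Submission
  imports Defs
begin

text \<open>
Why the cut inherits the property. Two \<open>K\<close>-invariant functions on the cut are represented by
circle-invariant functions \<open>f\<close>, \<open>g\<close> on \<open>M \<times> \<complex>\<close>, and these are \<open>K\<close>-invariant on the level set
\<open>\<phi> p + |z|\<^sup>2 / 2 = c\<close>; this makes sense because \<open>\<phi>\<close> is itself \<open>K\<close>-invariant (lemma \<open>\<phi>_act\<close>: along a
circle orbit a component of \<open>\<mu>\<close> is periodic, while its derivative is a constant that measures the
change of \<open>\<phi>\<close> under \<open>K\<close>). The bracket of \<open>f\<close> and \<open>g\<close> has to vanish at every point \<open>(p, z)\<close> of the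
level set. There are three kinds of points.

If \<open>z \<noteq> 0\<close>, the part of the level set with the phase \<open>\<epsilon>\<close> of \<open>z\<close> is the graph of
\<open>q \<mapsto> \<surd>(2 (c - \<phi> q)) \<epsilon>\<close> over \<open>\<phi> < c\<close>. Restricting \<open>f\<close> and \<open>g\<close> to it and multiplying by a cut-off
function of \<open>\<phi>\<close> gives smooth \<open>K\<close>-invariant functions on \<open>M\<close>, whose bracket vanishes by hypothesis.
Circle invariance identifies that bracket at \<open>p\<close> with the one of \<open>f\<close> and \<open>g\<close> at \<open>(p, z)\<close>
(\<open>ext_poisson_zero_off_fixed\<close>).

If \<open>z = 0\<close> and \<open>d\<phi> \<noteq> 0\<close> at \<open>p\<close>, then \<open>(p, 0)\<close> is a limit of points of the first kind and the bracket
is continuous (\<open>ext_poisson_tendsto\<close>).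

If \<open>z = 0\<close> and \<open>d\<phi> = 0\<close> at \<open>p\<close>, then \<open>p\<close> is a fixed point of the circle, the \<open>z\<close>-derivatives vanish
at \<open>(p, 0)\<close>, and the bracket is the one on \<open>M\<close> of \<open>f\<^sub>0 = f(\<cdot>, 0)\<close> and \<open>g\<^sub>0 = g(\<cdot>, 0)\<close>, which are
\<open>K\<close>-invariant only on \<open>\<phi> = c\<close>. If \<open>\<phi>\<close> has a local minimum at \<open>p\<close>, all nearby points of the level set
are of this kind, so a limit argument is impossible. Instead \<open>f\<^sub>0\<close>, multiplied by
a bump function, is averaged over \<open>K\<close>. Since the action is proper, the average is smooth, and on
\<open>\<phi> = c\<close> it equals \<open>f\<^sub>0 w\<close> for one \<open>K\<close>-invariant function \<open>w\<close> with \<open>w p > 0\<close>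
(\<open>ex_invariant_extension\<close>). The averages Poisson commute by hypothesis. Replacing an average by
\<open>f\<^sub>0 w\<close> does not change a bracket with a function \<open>v\<close> that commutes with \<open>\<phi>\<close>: the Hamiltonian vector
field of \<open>v\<close> is tangent to \<open>\<phi> = c\<close>, where the two functions agree (\<open>poisson_zero_on_level\<close>). Leibniz'
rule then removes the factors \<open>w\<close> (\<open>poisson_level_invariant\<close>).

Three foundations carry this. Tangent vectors, defined as derivations, are identified with coordinate
vectors by Hadamard's lemma; hence nondegeneracy gives existence, uniqueness and continuity of
Hamiltonian vector fields. Euler polygons show that the derivative of a function along a vector field
annihilating \<open>\<phi>\<close> depends only on its values on the level set of \<open>\<phi>\<close>. Invariant integration over \<open>K\<close> is obtained from covering numbers in
the way of Haar and Weil, and one lemma on differentiation under a bounded functional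
(\<open>Ck_on_functional\<close>) serves both the averages and Hadamard's lemma.
\<close>

section \<open>Orthonormal bases\<close>

text \<open>An infinite orthonormal set would have a limit point in the compact unit ball, but two of its members
  are at distance \<open>\<surd>2\<close>.\<close>

lemma finite_orthonormal:
  fixes S :: "'e::{real_inner,heine_borel} set"
  assumes "\<forall>a\<in>S. norm a = 1" and "\<forall>a\<in>S. \<forall>b\<in>S. a \<noteq> b \<longrightarrow> a \<bullet> b = 0"
  shows "finite S"
proof (rule ccontr)
  assume "infinite S"
  have "compact (cball (0::'e) 1)" by simp
  moreover have "S \<subseteq> cball 0 1" using assms(1) by auto
  ultimately obtain l where l: "l islimpt S"
    using \<open>infinite S\<close> by (meson compact_eq_Bolzano_Weierstrass)
  have "infinite (S \<inter> ball l (1/2))"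
    using l by (meson islimpt_eq_infinite_ball zero_less_divide_1_iff zero_less_numeral)
  then obtain a where a: "a \<in> S \<inter> ball l (1/2)" by (metis finite.emptyI ex_in_conv)
  with \<open>infinite (S \<inter> ball l (1/2))\<close> have "infinite (S \<inter> ball l (1/2) - {a})" by simp
  then obtain b where b: "b \<in> S \<inter> ball l (1/2)" "b \<noteq> a" by (metis finite.emptyI ex_in_conv Diff_iff singletonI)
  have "dist a b < 1" using a b dist_triangle_half_r[of l a 1 b] by auto
  then have "(norm (a - b))\<^sup>2 < 1" by (simp add: dist_norm power_less_one_iff)
  moreover have "(norm (a - b))\<^sup>2 = a \<bullet> a + b \<bullet> b - 2 * (a \<bullet> b)"
    by (simp add: power2_norm_eq_inner inner_diff inner_commute)
  moreover have "a \<bullet> a = 1" "b \<bullet> b = 1" using a b assms(1) by (auto simp: norm_eq_1)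
  moreover have "a \<bullet> b = 0" using a b assms(2) by auto
  ultimately show False by simp
qed

text \<open>A maximal orthonormal set exists by Zorn's lemma; if some \<open>x\<close> differed from its orthogonal
  projection, the normalised difference could be added to the set.\<close>

lemma ex_orthonormal_basis:
  "\<exists>S :: 'e::{real_inner,heine_borel} set. finite S \<and>
     (\<forall>a\<in>S. \<forall>b\<in>S. a \<bullet> b = (if a = b then 1 else 0)) \<and> (\<forall>x. (\<Sum>b\<in>S. (x \<bullet> b) *\<^sub>R b) = x)"
proof -
  define ON where "ON = {S :: 'e set. (\<forall>a\<in>S. norm a = 1) \<and> (\<forall>a\<in>S. \<forall>b\<in>S. a \<noteq> b \<longrightarrow> a \<bullet> b = 0)}"
  have "\<exists>S\<in>ON. \<forall>X\<in>ON. S \<subseteq> X \<longrightarrow> X = S"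
  proof (rule subset_Zorn)
    fix C assume C: "subset.chain ON C"
    then have CO: "C \<subseteq> ON" and Ct: "\<forall>X\<in>C. \<forall>Y\<in>C. X \<subseteq> Y \<or> Y \<subseteq> X"
      unfolding subset_chain_def by auto
    have "\<Union>C \<in> ON"
      unfolding ON_def
    proof (intro CollectI conjI ballI impI)
      fix a assume "a \<in> \<Union>C"
      then show "norm a = 1" using CO unfolding ON_def by blast
    next
      fix a b assume "a \<in> \<Union>C" "b \<in> \<Union>C" and ne: "a \<noteq> b"
      then obtain X Y where XY: "X \<in> C" "Y \<in> C" "a \<in> X" "b \<in> Y" by blast
      then have "X \<subseteq> Y \<or> Y \<subseteq> X" using Ct by simp
      then obtain Z where "Z \<in> C" "a \<in> Z" "b \<in> Z" using XY by (metis subsetD)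
      moreover have "Z \<in> ON" using CO \<open>Z \<in> C\<close> by (rule subsetD)
      ultimately show "a \<bullet> b = 0" using ne unfolding ON_def by blast
    qed
    then show "\<exists>U\<in>ON. \<forall>X\<in>C. X \<subseteq> U" by blast
  qed
  then obtain S where S: "S \<in> ON" and max: "\<And>X. X \<in> ON \<Longrightarrow> S \<subseteq> X \<Longrightarrow> X = S" by blast
  have fin: "finite S" using S finite_orthonormal unfolding ON_def by blast
  have ip: "\<forall>a\<in>S. \<forall>b\<in>S. a \<bullet> b = (if a = b then 1 else 0)"
    using S by (auto simp: ON_def norm_eq_1)
  have "(\<Sum>b\<in>S. (x \<bullet> b) *\<^sub>R b) = x" for x
  proof (rule ccontr)
    define y where "y = x - (\<Sum>b\<in>S. (x \<bullet> b) *\<^sub>R b)"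
    assume "(\<Sum>b\<in>S. (x \<bullet> b) *\<^sub>R b) \<noteq> x"
    then have y0: "y \<noteq> 0" by (simp add: y_def)
    have yb: "y \<bullet> b = 0" if "b \<in> S" for b
    proof -
      have "y \<bullet> b = x \<bullet> b - (\<Sum>a\<in>S. (x \<bullet> a) * (a \<bullet> b))"
        by (simp add: y_def inner_diff_left inner_sum_left)
      also have "(\<Sum>a\<in>S. (x \<bullet> a) * (a \<bullet> b)) = (\<Sum>a\<in>S. if a = b then x \<bullet> b else 0)"
        using ip that by (intro sum.cong) auto
      also have "\<dots> = x \<bullet> b" using fin that by simp
      finally show ?thesis by simp
    qed
    let ?y = "y /\<^sub>R norm y"
    have "insert ?y S \<in> ON"
      using S y0 yb by (auto simp: ON_def inner_commute)
    then have "?y \<in> S" using max by blast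
    then have "y \<bullet> ?y = 0" by (rule yb)
    then show False using y0 by simp
  qed
  with fin ip show ?thesis by blast
qed

text \<open>The model spaces need not be of class \<open>euclidean_space\<close>, so a basis has to be chosen.\<close>

definition onb :: "'e::{real_inner,heine_borel} set" where
  "onb = (SOME S. finite S \<and> (\<forall>a\<in>S. \<forall>b\<in>S. a \<bullet> b = (if a = b then 1 else 0)) \<and>
     (\<forall>x. (\<Sum>b\<in>S. (x \<bullet> b) *\<^sub>R b) = x))"

lemma
  shows finite_onb [simp]: "finite (onb :: 'e::{real_inner,heine_borel} set)"
    and inner_onb: "\<And>a b. a \<in> (onb :: 'e set) \<Longrightarrow> b \<in> onb \<Longrightarrow> a \<bullet> b = (if a = b then 1 else 0)"
    and onb_expand: "\<And>x::'e. (\<Sum>b\<in>onb. (x \<bullet> b) *\<^sub>R b) = x"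
  using someI_ex[OF ex_orthonormal_basis[where 'e = 'e]] unfolding onb_def[symmetric] by auto

lemma linear_onb_expand:
  fixes x :: "'e::{real_inner,heine_borel}"
  assumes "linear f"
  shows "f x = (\<Sum>b\<in>onb. (x \<bullet> b) *\<^sub>R f b)"
proof -
  have "f x = f (\<Sum>b\<in>onb. (x \<bullet> b) *\<^sub>R b)" by (simp add: onb_expand)
  also have "\<dots> = (\<Sum>b\<in>onb. (x \<bullet> b) *\<^sub>R f b)"
    using assms by (simp add: linear_sum linear_scale)
  finally show ?thesis .
qed

lemma norm_onb: "b \<in> (onb :: 'e::{real_inner,heine_borel} set) \<Longrightarrow> norm b = 1"
  using inner_onb[of b b] by (simp add: norm_eq_1)

lemma norm_linear_le_onb:
  fixes x :: "'e::{real_inner,heine_borel}" and f :: "'e \<Rightarrow> 'f::real_normed_vector"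
  assumes "linear f"
  shows "norm (f x) \<le> norm x * (\<Sum>b\<in>onb. norm (f b))"
proof -
  have "norm (f x) \<le> (\<Sum>b\<in>onb. norm ((x \<bullet> b) *\<^sub>R f b))"
    unfolding linear_onb_expand[OF assms, of x] by (rule norm_sum)
  also have "\<dots> \<le> (\<Sum>b\<in>onb. norm x * norm (f b))"
  proof (rule sum_mono)
    fix b :: 'e assume "b \<in> onb"
    then have "\<bar>x \<bullet> b\<bar> \<le> norm x" using Cauchy_Schwarz_ineq2[of x b] norm_onb[of b] by simp
    then show "norm ((x \<bullet> b) *\<^sub>R f b) \<le> norm x * norm (f b)" by (simp add: mult_right_mono)
  qed
  finally show ?thesis by (simp add: sum_distrib_left)
qed

lemma linear_imp_bounded_linear:
  fixes f :: "'e::{real_inner,heine_borel} \<Rightarrow> 'f::real_normed_vector"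
  assumes "linear f" shows "bounded_linear f"
  using assms norm_linear_le_onb[OF assms]
  by (auto simp: linear_iff intro!: bounded_linear_intro)

lemma linear_inj_imp_surj:
  fixes f :: "'e::{real_inner,heine_borel} \<Rightarrow> 'e"
  assumes "linear f" "inj f" shows "surj f"
proof -
  have ind: "independent (onb :: 'e set)"
  proof (rule real_vector.independent_if_scalars_zero)
    fix g :: "'e \<Rightarrow> real" and x :: 'e assume s: "(\<Sum>b\<in>onb. g b *\<^sub>R b) = 0" and x: "x \<in> onb"
    have "0 = (\<Sum>b\<in>onb. g b *\<^sub>R b) \<bullet> x" using s by simp
    also have "\<dots> = (\<Sum>b\<in>onb. if b = x then g x else 0)"
      unfolding inner_sum_left using x by (intro sum.cong) (auto simp: inner_onb)
    also have "\<dots> = g x" using x by simp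
    finally show "g x = 0" by simp
  qed simp
  have span: "span (onb :: 'e set) = UNIV"
  proof -
    have "x \<in> span onb" for x :: 'e
    proof -
      have "(\<Sum>b\<in>onb. (x \<bullet> b) *\<^sub>R b) \<in> span onb"
        by (intro span_sum span_scale span_base)
      then show ?thesis by (simp add: onb_expand)
    qed
    then show ?thesis by blast
  qed
  interpret fd: finite_dimensional_vector_space "scaleR" "onb :: 'e set"
    using ind span by unfold_locales (auto simp: dependent_raw_def span_raw_def)
  show ?thesis
    using fd.linear_inj_imp_surj assms by (simp add: linear_def)
qed

section \<open>Calculus of \<open>C\<^sup>k\<close> functions\<close>

abbreviation D :: "('e::real_normed_vector \<Rightarrow> 'f::real_normed_vector) \<Rightarrow> 'e \<Rightarrow> 'e \<Rightarrow> 'f" where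
  "D f x \<equiv> frechet_derivative f (at x)"

lemma D_eq: "(f has_derivative f') (at x) \<Longrightarrow> D f x = f'"
  by (rule frechet_derivative_at[symmetric])

lemma D_cong:
  assumes "open U" "x \<in> U" "\<And>y. y \<in> U \<Longrightarrow> f y = g y"
  shows "D f x = D g x" and "f differentiable at x \<longleftrightarrow> g differentiable at x"
proof -
  have *: "(f has_derivative d) (at x) \<longleftrightarrow> (g has_derivative d) (at x)" for d
    using has_derivative_transform_within_open[of f d x UNIV U g]
      has_derivative_transform_within_open[of g d x UNIV U f] assms by metis
  then show "D f x = D g x" "f differentiable at x \<longleftrightarrow> g differentiable at x"
    by (simp_all add: frechet_derivative_def differentiable_def)
qed

lemma Ck_on_cong:
  assumes "open U" "\<And>x. x \<in> U \<Longrightarrow> f x = g x"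
  shows "Ck_on k U f \<longleftrightarrow> Ck_on k U g"
  using assms(2)
proof (induction k arbitrary: f g)
  case 0
  then show ?case by (simp cong: continuous_on_cong)
next
  case (Suc k)
  have "D f x = D g x" "f differentiable at x \<longleftrightarrow> g differentiable at x" if "x \<in> U" for x
    using D_cong[OF assms(1) that Suc.prems] by auto
  then show ?case using Suc.IH[of "\<lambda>x. D f x _" "\<lambda>x. D g x _"] by simp
qed

lemma Ck_on_SucI:
  assumes "open U" "\<And>x. x \<in> U \<Longrightarrow> (f has_derivative f' x) (at x)" "\<And>v. Ck_on k U (\<lambda>x. f' x v)"
  shows "Ck_on (Suc k) U f"
proof -
  have "Ck_on k U (\<lambda>x. D f x v) \<longleftrightarrow> Ck_on k U (\<lambda>x. f' x v)" for v
    by (intro Ck_on_cong[OF assms(1)]) (simp add: D_eq[OF assms(2)])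
  then show ?thesis using assms by (auto simp: differentiable_def)
qed

lemma Ck_on_SucD:
  assumes "Ck_on (Suc k) U f" "x \<in> U"
  shows "(f has_derivative D f x) (at x)"
  using assms by (simp add: frechet_derivative_works)

lemma Ck_on_Suc_imp: "Ck_on (Suc k) U f \<Longrightarrow> Ck_on k U f"
proof (induction k arbitrary: f)
  case 0
  then show ?case
    by (auto intro!: continuous_at_imp_continuous_on differentiable_imp_continuous_within)
next
  case (Suc k)
  then show ?case by (metis Ck_on.simps(2))
qed

lemma Ck_on_subset: "Ck_on k U f \<Longrightarrow> V \<subseteq> U \<Longrightarrow> Ck_on k V f"
  by (induction k arbitrary: f) (auto intro: continuous_on_subset)

lemma Ck_on_imp_continuous_on: "Ck_on k U f \<Longrightarrow> continuous_on U f"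
  by (induction k) (auto dest: Ck_on_Suc_imp simp del: Ck_on.simps(2))

lemma Ck_on_local:
  assumes "\<And>x. x \<in> U \<Longrightarrow> \<exists>V. open V \<and> x \<in> V \<and> Ck_on k V f"
  shows "Ck_on k U f"
  using assms
proof (induction k arbitrary: f)
  case 0
  then have "continuous (at x) f" if "x \<in> U" for x
    using that continuous_on_eq_continuous_at by fastforce
  then show ?case by (simp add: continuous_at_imp_continuous_on)
next
  case (Suc k)
  then have "Ck_on k U (\<lambda>x. D f x v)" for v by (metis Ck_on.simps(2))
  moreover have "f differentiable at x" if "x \<in> U" for x using Suc.prems that by auto
  ultimately show ?case by simp
qed

lemma Ck_on_const: "Ck_on k U (\<lambda>x. c)"
  by (induction k arbitrary: c) auto

lemma Ck_on_bounded_linear_comp: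
  assumes "bounded_linear h" "open U" "Ck_on k U f"
  shows "Ck_on k U (\<lambda>x. h (f x))"
  using assms(3)
proof (induction k arbitrary: f)
  case 0
  then show ?case by (simp add: bounded_linear.continuous_on[OF assms(1)])
next
  case (Suc k)
  show ?case
  proof (rule Ck_on_SucI[OF assms(2)])
    fix x assume "x \<in> U"
    then show "((\<lambda>x. h (f x)) has_derivative (\<lambda>v. h (D f x v))) (at x)"
      by (intro bounded_linear.has_derivative[OF assms(1)] Ck_on_SucD[OF Suc.prems])
  next
    fix v show "Ck_on k U (\<lambda>x. h (D f x v))" using Suc.prems by (intro Suc.IH) simp
  qed
qed

lemma Ck_on_id: "open U \<Longrightarrow> Ck_on k U (\<lambda>x. x)"
proof (induction k)
  case (Suc k)
  show ?case by (rule Ck_on_SucI[where f' = "\<lambda>x v. v"]) (auto intro: Suc Ck_on_const)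
qed simp

lemma Ck_on_bounded_linear:
  assumes "bounded_linear h" "open U" shows "Ck_on k U h"
  by (rule Ck_on_bounded_linear_comp[OF assms Ck_on_id[OF assms(2)]])

lemma Ck_on_add:
  assumes "open U" "Ck_on k U f" "Ck_on k U g"
  shows "Ck_on k U (\<lambda>x. f x + g x)"
  using assms(2,3)
proof (induction k arbitrary: f g)
  case 0
  then show ?case by (simp add: continuous_on_add)
next
  case (Suc k)
  show ?case
  proof (rule Ck_on_SucI[OF assms(1)])
    fix x assume "x \<in> U"
    then show "((\<lambda>x. f x + g x) has_derivative (\<lambda>v. D f x v + D g x v)) (at x)"
      by (intro has_derivative_add Ck_on_SucD[OF Suc.prems(1)] Ck_on_SucD[OF Suc.prems(2)])
  next
    fix v show "Ck_on k U (\<lambda>x. D f x v + D g x v)" using Suc.prems by (intro Suc.IH) simp_all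
  qed
qed

lemma Ck_on_sum:
  assumes "open U" "\<And>i. i \<in> I \<Longrightarrow> Ck_on k U (f i)"
  shows "Ck_on k U (\<lambda>x. \<Sum>i\<in>I. f i x)"
  using assms(2)
  by (induction I rule: infinite_finite_induct) (auto intro!: Ck_on_const Ck_on_add assms(1))

lemma Ck_on_bilinear:
  assumes "bounded_bilinear pr" "open U" "Ck_on k U f" "Ck_on k U g"
  shows "Ck_on k U (\<lambda>x. pr (f x) (g x))"
  using assms(3,4)
proof (induction k arbitrary: f g)
  case 0
  then show ?case by (simp add: bounded_bilinear.continuous_on[OF assms(1)])
next
  case (Suc k)
  show ?case
  proof (rule Ck_on_SucI[OF assms(2)])
    fix x assume "x \<in> U"
    then show "((\<lambda>x. pr (f x) (g x)) has_derivative (\<lambda>v. pr (f x) (D g x v) + pr (D f x v) (g x))) (at x)"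
      by (intro bounded_bilinear.FDERIV[OF assms(1)] Ck_on_SucD[OF Suc.prems(1)]
          Ck_on_SucD[OF Suc.prems(2)])
  next
    fix v show "Ck_on k U (\<lambda>x. pr (f x) (D g x v) + pr (D f x v) (g x))"
      using Suc.prems Ck_on_Suc_imp[OF Suc.prems(1)] Ck_on_Suc_imp[OF Suc.prems(2)]
      by (intro Ck_on_add assms(2) Suc.IH) simp_all
  qed
qed

lemmas Ck_on_mult = Ck_on_bilinear[OF bounded_bilinear_mult]
lemmas Ck_on_scaleR = Ck_on_bilinear[OF bounded_bilinear_scaleR]
lemmas Ck_on_inner = Ck_on_bilinear[OF bounded_bilinear_inner]

text \<open>The derivative of \<open>g \<circ> f\<close> contains the derivative of \<open>g\<close> in a direction that varies with the point.
  Expanding this direction in \<open>onb\<close> leaves derivatives in fixed directions, to which the induction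
  hypothesis applies.\<close>

lemma Ck_on_compose:
  fixes f :: "'d::real_normed_vector \<Rightarrow> 'e::{real_inner,heine_borel}"
    and g :: "'e \<Rightarrow> 'g::real_normed_vector"
  assumes "open U" "open V" "\<And>x. x \<in> U \<Longrightarrow> f x \<in> V" "Ck_on k U f" "Ck_on k V g"
  shows "Ck_on k U (\<lambda>x. g (f x))"
  using assms(4,5)
proof (induction k arbitrary: g)
  case 0
  then show ?case using assms(3) by (auto intro: continuous_on_compose2)
next
  case (Suc k)
  have g': "(g has_derivative D g (f x)) (at (f x))" if "x \<in> U" for x
    using Ck_on_SucD[OF Suc.prems(2)] assms(3) that by blast
  show ?case
  proof (rule Ck_on_SucI[OF assms(1)])
    fix x assume "x \<in> U"
    then show "((\<lambda>x. g (f x)) has_derivative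
        (\<lambda>v. \<Sum>b\<in>onb. (D f x v \<bullet> b) *\<^sub>R D g (f x) b)) (at x)"
      using has_derivative_compose[OF Ck_on_SucD[OF Suc.prems(1)] g']
        linear_onb_expand[OF has_derivative_linear[OF g']] by simp
  next
    fix v
    have "Ck_on k U f" using Ck_on_Suc_imp Suc.prems(1) by blast
    then have "Ck_on k U (\<lambda>x. D g (f x) b)" for b
      using Suc.prems(2) by (intro Suc.IH[where g = "\<lambda>y. D g y b"]) auto
    then show "Ck_on k U (\<lambda>x. \<Sum>b\<in>onb. (D f x v \<bullet> b) *\<^sub>R D g (f x) b)"
      using Suc.prems(1)
      by (intro Ck_on_sum Ck_on_scaleR Ck_on_inner Ck_on_const assms(1)) simp_all
  qed
qed

lemma Ck_on_Pair:
  assumes "open U" "Ck_on k U f" "Ck_on k U g"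
  shows "Ck_on k U (\<lambda>x. (f x, g x))"
proof -
  have "bounded_linear (\<lambda>x. (x, 0))" "bounded_linear (\<lambda>y. (0, y))"
    by (auto intro!: bounded_linear_Pair bounded_linear_ident bounded_linear_zero)
  then have "Ck_on k U (\<lambda>x. (f x, 0) + (0, g x))"
    using assms
    by (intro Ck_on_add Ck_on_bounded_linear_comp[where h = "\<lambda>x. (x, 0)"]
        Ck_on_bounded_linear_comp[where h = "\<lambda>y. (0, y)"])
  then show ?thesis by simp
qed
lemma smooth_on_cong: "open U \<Longrightarrow> (\<And>x. x \<in> U \<Longrightarrow> f x = g x) \<Longrightarrow> smooth_on U f \<longleftrightarrow> smooth_on U g"
  unfolding smooth_on_def using Ck_on_cong by blast

lemma smooth_on_subset: "smooth_on U f \<Longrightarrow> V \<subseteq> U \<Longrightarrow> smooth_on V f"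
  unfolding smooth_on_def using Ck_on_subset by blast

lemma smooth_on_local:
  "(\<And>x. x \<in> U \<Longrightarrow> \<exists>V. open V \<and> x \<in> V \<and> smooth_on V f) \<Longrightarrow> smooth_on U f"
  unfolding smooth_on_def using Ck_on_local by metis

lemma smooth_on_const: "smooth_on U (\<lambda>x. c)"
  by (simp add: smooth_on_def Ck_on_const)

lemma smooth_on_id: "open U \<Longrightarrow> smooth_on U (\<lambda>x. x)"
  by (simp add: smooth_on_def Ck_on_id)

lemma smooth_on_bounded_linear: "bounded_linear h \<Longrightarrow> open U \<Longrightarrow> smooth_on U h"
  by (simp add: smooth_on_def Ck_on_bounded_linear)

lemma smooth_on_add:
  "open U \<Longrightarrow> smooth_on U f \<Longrightarrow> smooth_on U g \<Longrightarrow> smooth_on U (\<lambda>x. f x + g x)"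
  by (simp add: smooth_on_def Ck_on_add)

lemma smooth_on_mult:
  fixes f g :: "_ \<Rightarrow> real"
  shows "open U \<Longrightarrow> smooth_on U f \<Longrightarrow> smooth_on U g \<Longrightarrow> smooth_on U (\<lambda>x. f x * g x)"
  by (simp add: smooth_on_def Ck_on_mult)

lemma smooth_on_scaleR:
  "open U \<Longrightarrow> smooth_on U f \<Longrightarrow> smooth_on U g \<Longrightarrow> smooth_on U (\<lambda>x. f x *\<^sub>R g x)"
  by (simp add: smooth_on_def Ck_on_scaleR)

lemma smooth_on_inner:
  "open U \<Longrightarrow> smooth_on U f \<Longrightarrow> smooth_on U g \<Longrightarrow> smooth_on U (\<lambda>x. f x \<bullet> g x)"
  by (simp add: smooth_on_def Ck_on_inner)

lemma smooth_on_diff: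
  fixes f g :: "_ \<Rightarrow> real"
  assumes "open U" "smooth_on U f" "smooth_on U g"
  shows "smooth_on U (\<lambda>x. f x - g x)"
  using smooth_on_add[OF assms(1,2) smooth_on_mult[OF assms(1) smooth_on_const[where c = "-1"] assms(3)]]
  by simp

lemma smooth_on_compose:
  fixes f :: "'d::real_normed_vector \<Rightarrow> 'e::{real_inner,heine_borel}"
    and g :: "'e \<Rightarrow> 'g::real_normed_vector"
  assumes "open U" "open V" "\<And>x. x \<in> U \<Longrightarrow> f x \<in> V" "smooth_on U f" "smooth_on V g"
  shows "smooth_on U (\<lambda>x. g (f x))"
  using assms Ck_on_compose[of U V f] unfolding smooth_on_def by blast

lemma smooth_on_Pair:
  "open U \<Longrightarrow> smooth_on U f \<Longrightarrow> smooth_on U g \<Longrightarrow> smooth_on U (\<lambda>x. (f x, g x))"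
  by (simp add: smooth_on_def Ck_on_Pair)

lemma smooth_on_D: "smooth_on U f \<Longrightarrow> smooth_on U (\<lambda>x. D f x v)"
  unfolding smooth_on_def by (metis Ck_on.simps(2))

lemma smooth_on_has_derivative: "smooth_on U f \<Longrightarrow> x \<in> U \<Longrightarrow> (f has_derivative D f x) (at x)"
  unfolding smooth_on_def using Ck_on_SucD by blast

lemma smooth_on_continuous: "smooth_on U f \<Longrightarrow> continuous_on U f"
  unfolding smooth_on_def using Ck_on_imp_continuous_on by blast

section \<open>Smooth functions of a real variable and bump functions\<close>

lemma Ck_on_SucI_real:
  fixes f :: "real \<Rightarrow> real"
  assumes "open U" "\<And>x. x \<in> U \<Longrightarrow> (f has_real_derivative f' x) (at x)" "Ck_on k U f'"
  shows "Ck_on (Suc k) U f"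
proof (rule Ck_on_SucI[OF assms(1)])
  show "(f has_derivative (\<lambda>v. f' x * v)) (at x)" if "x \<in> U" for x
    using assms(2)[OF that] by (simp add: has_field_derivative_def)
  show "Ck_on k U (\<lambda>x. f' x * v)" for v
    by (intro Ck_on_mult assms(1,3) Ck_on_const)
qed

lemma smooth_on_powr: "smooth_on {0<..} (\<lambda>x::real. x powr a)"
proof -
  have "Ck_on k {0<..} (\<lambda>x::real. x powr a)" for k a
  proof (induction k arbitrary: a)
    case 0
    show ?case by (auto intro!: continuous_intros)
  next
    case (Suc k)
    show ?case
      by (rule Ck_on_SucI_real[where f' = "\<lambda>x. a * x powr (a - 1)"])
        (auto intro!: Ck_on_mult Ck_on_const Suc has_real_derivative_powr)
  qed
  then show ?thesis by (simp add: smooth_on_def)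
qed

text \<open>The classical flat function \<open>exp (-1/x)\<close>; dividing by powers of \<open>x\<close> makes the family closed
  under differentiation.\<close>

definition flat :: "nat \<Rightarrow> real \<Rightarrow> real" where
  "flat n x = (if x > 0 then inverse x ^ n / exp (inverse x) else 0)"

lemma flat_tendsto_0: "(flat n \<longlongrightarrow> 0) (at_right 0)"
proof -
  have "((\<lambda>x::real. inverse x ^ n / exp (inverse x)) \<longlongrightarrow> 0) (at_right 0)"
    using filterlim_compose[OF tendsto_power_div_exp_0 filterlim_inverse_at_top_right] .
  then show ?thesis
    by (rule Lim_transform_eventually)
      (rule eventually_mono[OF eventually_at_right_less[of 0]], simp add: flat_def)
qed

text \<open>The only delicate point is 0, where the difference quotient of \<open>flat n\<close> is \<open>flat (Suc n)\<close> to the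
  right and vanishes to the left.\<close>

lemma flat_has_derivative:
  "(flat n has_real_derivative (flat (n + 2) x - real n * flat (n + 1) x)) (at x)"
proof -
  consider "x > 0" | "x = 0" | "x < 0" by linarith
  then show ?thesis
  proof cases
    case 1
    have i: "(inverse has_real_derivative - (inverse x ^ Suc (Suc 0))) (at x)"
      using 1 by (intro DERIV_inverse) simp
    have p: "((\<lambda>x. inverse x ^ n) has_real_derivative - real n * inverse x ^ (n + 1)) (at x)"
      using DERIV_power[OF i, of n] by (rule DERIV_cong) (cases n; simp add: algebra_simps)
    have e: "((\<lambda>x. exp (- inverse x)) has_real_derivative exp (- inverse x) * inverse x ^ 2) (at x)"
      using DERIV_chain2[OF DERIV_exp DERIV_minus[OF i]] by (simp add: numeral_2_eq_2)
    have "((\<lambda>x. inverse x ^ n * exp (- inverse x)) has_real_derivative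
        (flat (n + 2) x - real n * flat (n + 1) x)) (at x)"
      using DERIV_mult[OF p e] by (rule DERIV_cong)
        (use 1 in \<open>simp add: flat_def exp_minus divide_inverse algebra_simps power2_eq_square\<close>)
    then show ?thesis
      by (rule has_field_derivative_transform_within_open[where S = "{0<..}"])
        (use 1 in \<open>auto simp: flat_def exp_minus divide_inverse\<close>)
  next
    case 2
    have "((\<lambda>h. flat n h / h) \<longlongrightarrow> 0) (at_right 0)"
      by (rule Lim_transform_eventually[OF flat_tendsto_0[of "Suc n"]])
        (rule eventually_mono[OF eventually_at_right_less[of 0]], simp add: flat_def divide_inverse mult_ac)
    moreover have "((\<lambda>h. flat n h / h) \<longlongrightarrow> 0) (at_left 0)"
      by (rule Lim_transform_eventually[OF tendsto_const])
        (auto simp: flat_def eventually_at_filter)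
    ultimately have "((\<lambda>h. flat n h / h) \<longlongrightarrow> 0) (at 0)"
      by (simp add: filterlim_at_split)
    then show ?thesis using 2 by (simp add: DERIV_def flat_def)
  next
    case 3
    then have "((\<lambda>x. 0) has_real_derivative (flat (n + 2) x - real n * flat (n + 1) x)) (at x)"
      by (simp add: flat_def)
    then show ?thesis
      by (rule has_field_derivative_transform_within_open[where S = "{..<0}"])
        (use 3 in \<open>auto simp: flat_def\<close>)
  qed
qed

lemma smooth_on_flat: "smooth_on UNIV (flat n)"
proof -
  have "Ck_on k UNIV (flat n)" for k
  proof (induction k arbitrary: n)
    case 0
    show ?case
      using flat_has_derivative
      by (auto intro!: continuous_at_imp_continuous_on DERIV_isCont)
  next
    case (Suc k)
    have "Ck_on k UNIV (\<lambda>x. flat (n + 2) x + (- real n) * flat (n + 1) x)"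
      by (intro Ck_on_add Ck_on_mult Ck_on_const Suc open_UNIV)
    then have "Ck_on k UNIV (\<lambda>x. flat (n + 2) x - real n * flat (n + 1) x)" by simp
    then show ?case using Ck_on_SucI_real[OF open_UNIV flat_has_derivative] by blast
  qed
  then show ?thesis by (simp add: smooth_on_def)
qed

text \<open>A smooth transition from 1 on \<open>t \<le> 1\<close> to 0 on \<open>t \<ge> 2\<close>; the power \<open>powr (-1)\<close> is the reciprocal, in
  the form whose smoothness is given by \<open>smooth_on_powr\<close>.\<close>

definition plateau :: "real \<Rightarrow> real" where
  "plateau t = flat 0 (2 - t) * (flat 0 (2 - t) + flat 0 (t - 1)) powr (-1)"

lemma flat_pos: "x > 0 \<Longrightarrow> flat n x > 0"
  by (simp add: flat_def)

lemma flat_eq_0: "x \<le> 0 \<Longrightarrow> flat n x = 0"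
  by (simp add: flat_def)

lemma flat_nonneg: "flat n x \<ge> 0"
  using flat_pos[of x n] flat_eq_0[of x n] by linarith

lemma plateau_denom_pos: "flat 0 (2 - t) + flat 0 (t - 1) > 0"
  using flat_pos[of "2 - t" 0] flat_pos[of "t - 1" 0] flat_nonneg[of 0 "2 - t"]
    flat_nonneg[of 0 "t - 1"] by linarith

lemma plateau_1: "t \<le> 1 \<Longrightarrow> plateau t = 1"
  using flat_pos[of "2 - t" 0] by (simp add: plateau_def flat_eq_0[of "t - 1"] powr_minus)

lemma plateau_0: "t \<ge> 2 \<Longrightarrow> plateau t = 0"
  by (simp add: plateau_def flat_eq_0)

lemma plateau_ge0: "plateau t \<ge> 0"
  by (simp add: plateau_def flat_nonneg)

lemma smooth_on_plateau: "smooth_on UNIV plateau"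
proof -
  have a: "smooth_on UNIV (\<lambda>t. flat 0 (2 - t))" "smooth_on UNIV (\<lambda>t. flat 0 (t - 1))"
    by (rule smooth_on_compose[OF open_UNIV open_UNIV UNIV_I _ smooth_on_flat];
        intro smooth_on_diff smooth_on_id smooth_on_const open_UNIV)+
  have "smooth_on UNIV (\<lambda>t. (flat 0 (2 - t) + flat 0 (t - 1)) powr (-1))"
    by (rule smooth_on_compose[OF open_UNIV open_greaterThan _ _ smooth_on_powr])
      (use plateau_denom_pos a in \<open>auto intro!: smooth_on_add\<close>)
  then show ?thesis unfolding plateau_def using a by (intro smooth_on_mult) auto
qed

lemma smooth_bump_ball:
  fixes a :: "'e::{real_inner,heine_borel}"
  assumes "r > 0"
  obtains b :: "'e \<Rightarrow> real" where "smooth_on UNIV b" "\<And>y. b y \<ge> 0"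
    "\<And>y. dist a y \<le> r / 2 \<Longrightarrow> b y = 1" "\<And>y. dist a y \<ge> r \<Longrightarrow> b y = 0"
proof
  define b where "b y = plateau ((2 / r\<^sup>2) * ((y + - a) \<bullet> (y + - a)))" for y
  show "smooth_on UNIV b"
    unfolding b_def
    by (rule smooth_on_compose[OF open_UNIV open_UNIV UNIV_I _ smooth_on_plateau])
      (intro smooth_on_mult smooth_on_inner smooth_on_add smooth_on_id smooth_on_const open_UNIV)
  show "b y \<ge> 0" for y by (simp add: b_def plateau_ge0)
  have eq: "(y + - a) \<bullet> (y + - a) = (dist a y)\<^sup>2" for y
    by (subst dist_commute) (simp add: dist_norm power2_norm_eq_inner)
  show "b y = 1" if "dist a y \<le> r / 2" for y
  proof -
    have "(dist a y)\<^sup>2 \<le> (r / 2)\<^sup>2" using that by (intro power_mono) auto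
    also have "\<dots> \<le> r\<^sup>2 / 2" by (simp add: power2_eq_square)
    finally show ?thesis unfolding b_def eq by (intro plateau_1) (use assms in \<open>simp add: field_simps\<close>)
  qed
  show "b y = 0" if "dist a y \<ge> r" for y
  proof -
    have "r\<^sup>2 \<le> (dist a y)\<^sup>2" using that assms by (intro power_mono) auto
    then show ?thesis unfolding b_def eq by (intro plateau_0) (use assms in \<open>simp add: field_simps\<close>)
  qed
qed

section \<open>Vector fields tangent to a level set\<close>

text \<open>An Euler polygon for \<open>X\<close> with many steps leaves the level set of \<open>p\<close> only by an arbitrarily small
  amount: within a step \<open>\<phi>\<close> changes at the rate \<open>D \<phi> y (X (e j))\<close>, which is small because
  \<open>D \<phi> y (X y) = 0\<close> and \<open>X\<close> is uniformly continuous. All end points at time \<open>t\<close> lie in a compact set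
  near \<open>p + t X p\<close>, so \<open>|\<phi> - \<phi> p|\<close> attains its infimum there, which is 0.\<close>

lemma level_point_along_field:
  fixes X :: "'e::{real_inner,heine_borel} \<Rightarrow> 'e" and \<phi> :: "'e \<Rightarrow> real"
  assumes U: "open U" "p \<in> U" and X: "continuous_on U X" and \<phi>: "Ck_on (Suc 0) U \<phi>"
    and tang: "\<And>x. x \<in> U \<Longrightarrow> D \<phi> x (X x) = 0" and "\<eta> > 0"
  shows "\<exists>t0>0. \<forall>t. 0 < t \<and> t < t0 \<longrightarrow> (\<exists>x\<in>U. \<phi> x = \<phi> p \<and> norm (x - p - t *\<^sub>R X p) \<le> t * \<eta>)"
proof -
  obtain r1 where r1: "r1 > 0" "cball p r1 \<subseteq> U" using U open_contains_cball by blast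
  have "continuous (at p) X" using X U continuous_on_eq_continuous_at by blast
  then obtain r2 where r2: "r2 > 0" "\<And>y. dist y p < r2 \<Longrightarrow> dist (X y) (X p) < \<eta>"
    using \<open>\<eta> > 0\<close> unfolding continuous_at_eps_delta by blast
  define r where "r = min r1 (r2 / 2)"
  have r: "r > 0" "cball p r \<subseteq> U" "\<And>y. y \<in> cball p r \<Longrightarrow> norm (X y - X p) \<le> \<eta>"
    using r1 r2 by (auto simp: r_def dist_norm[symmetric] dist_commute intro: less_imp_le)
  define M where "M = norm (X p) + \<eta>"
  have M: "M > 0" "\<And>y. y \<in> cball p r \<Longrightarrow> norm (X y) \<le> M"
  proof -
    show "M > 0" using \<open>\<eta> > 0\<close> by (simp add: M_def add_nonneg_pos)
    fix y assume "y \<in> cball p r"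
    then show "norm (X y) \<le> M" using r(3)[of y] norm_triangle_sub[of "X y" "X p"] by (simp add: M_def)
  qed
  have d\<phi>: "(\<phi> has_derivative D \<phi> y) (at y)" if "y \<in> cball p r" for y
    using Ck_on_SucD[OF \<phi>] r that by blast
  have "continuous_on (cball p r) (\<lambda>y. \<Sum>b\<in>onb. norm (D \<phi> y b))"
    using \<phi> by (intro continuous_on_sum continuous_on_norm continuous_on_subset[OF _ r(2)]) auto
  then have "bounded ((\<lambda>y. \<Sum>b\<in>onb. norm (D \<phi> y b)) ` cball p r)"
    by (intro compact_imp_bounded compact_continuous_image) auto
  then obtain C where C: "C > 0" "\<And>y. y \<in> cball p r \<Longrightarrow> (\<Sum>b\<in>onb. norm (D \<phi> y b)) \<le> C"
    unfolding bounded_pos by (force simp: abs_le_iff)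
  have D\<phi>: "\<bar>D \<phi> y v\<bar> \<le> norm v * C" if "y \<in> cball p r" for y v
    using norm_linear_le_onb[OF has_derivative_linear[OF d\<phi>[OF that]], of v]
      mult_left_mono[OF C(2)[OF that] norm_ge_zero[of v]] by simp
  have Xc: "continuous_on (cball p r) X" using X r(2) continuous_on_subset by blast
  show ?thesis
  proof (intro exI[of _ "r / M"] conjI allI impI)
    show "r / M > 0" using r M by simp
  next
    fix t assume t: "0 < t \<and> t < r / M"
    then have tM: "t * M \<le> r" using M by (simp add: field_simps)
    let ?Q = "cball p r \<inter> cball (p + t *\<^sub>R X p) (t * \<eta>)"
    have approx: "\<exists>x\<in>?Q. \<bar>\<phi> x - \<phi> p\<bar> \<le> t * (C * \<epsilon>)" if "\<epsilon> > 0" for \<epsilon>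
    proof -
      obtain \<delta> where \<delta>: "\<delta> > 0" "\<And>y z. y \<in> cball p r \<Longrightarrow> z \<in> cball p r \<Longrightarrow> dist z y < \<delta> \<Longrightarrow> dist (X z) (X y) < \<epsilon>"
        using compact_uniformly_continuous[OF Xc compact_cball] \<open>\<epsilon> > 0\<close>
        unfolding uniformly_continuous_on_def by blast
      obtain n :: nat where n: "n > 0" "t * M / n < \<delta>"
      proof -
        obtain m :: nat where "t * M / \<delta> < m" using reals_Archimedean2 by blast
        then have "t * M < real m * \<delta>" using \<delta>(1) by (simp add: field_simps)
        also have "\<dots> \<le> real (Suc m) * \<delta>" using \<delta>(1) by (intro mult_right_mono) auto
        finally have "t * M / Suc m < \<delta>" by (simp add: field_simps)
        then show ?thesis using that[of "Suc m"] by simp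
      qed
      define s where "s = t / n"
      have s: "s > 0" "s * M < \<delta>" "real n * s = t" using n t by (auto simp: s_def)
      define e where "e j = ((\<lambda>x. x + s *\<^sub>R X x) ^^ j) p" for j
      have e0: "e 0 = p" and eS: "e (Suc j) = e j + s *\<^sub>R X (e j)" for j by (auto simp: e_def)
      have "j \<le> n \<longrightarrow> norm (e j - p) \<le> real j * s * M \<and> norm (e j - p - (real j * s) *\<^sub>R X p) \<le> real j * s * \<eta> \<and>
          \<bar>\<phi> (e j) - \<phi> p\<bar> \<le> real j * s * (C * \<epsilon>)" for j
      proof (induction j)
        case 0
        then show ?case by (simp add: e0)
      next
        case (Suc j)
        show ?case
        proof
          assume jn: "Suc j \<le> n"
          with Suc have IH: "norm (e j - p) \<le> real j * s * M"
            "norm (e j - p - (real j * s) *\<^sub>R X p) \<le> real j * s * \<eta>"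
            "\<bar>\<phi> (e j) - \<phi> p\<bar> \<le> real j * s * (C * \<epsilon>)" by auto
          have js: "real i * s * M \<le> r" if "i \<le> n" for i
          proof -
            have "real i * s * M \<le> real n * s * M" using that s M by (intro mult_right_mono) auto
            then show ?thesis using tM s by simp
          qed
          have ej: "e j \<in> cball p r"
            using IH(1) js[of j] jn by (simp add: dist_norm norm_minus_commute)
          have n1: "norm (e (Suc j) - p) \<le> real (Suc j) * s * M"
          proof -
            have "norm (e (Suc j) - p) \<le> norm (e j - p) + norm (s *\<^sub>R X (e j))"
              unfolding eS using norm_triangle_ineq[of "e j - p" "s *\<^sub>R X (e j)"] by (simp add: algebra_simps)
            also have "\<dots> \<le> real j * s * M + s * M"
              using IH(1) M(2)[OF ej] s by (intro add_mono) auto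
            finally show ?thesis by (simp add: algebra_simps)
          qed
          have eSj: "e (Suc j) \<in> cball p r"
            using n1 js[OF jn] by (simp add: dist_norm norm_minus_commute)
          have n2: "norm (e (Suc j) - p - (real (Suc j) * s) *\<^sub>R X p) \<le> real (Suc j) * s * \<eta>"
          proof -
            have "e (Suc j) - p - (real (Suc j) * s) *\<^sub>R X p =
                (e j - p - (real j * s) *\<^sub>R X p) + s *\<^sub>R (X (e j) - X p)"
              unfolding eS by (simp add: algebra_simps)
            also have "norm \<dots> \<le> real j * s * \<eta> + s * \<eta>"
              using IH(2) r(3)[OF ej] s by (intro norm_triangle_le add_mono) auto
            finally show ?thesis by (simp add: algebra_simps)
          qed
          define y where "y \<sigma> = e j + \<sigma> *\<^sub>R X (e j)" for \<sigma>
          have yb: "y \<sigma> \<in> cball p r" if "0 \<le> \<sigma>" "\<sigma> \<le> s" for \<sigma>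
          proof -
            have "y \<sigma> = (1 - \<sigma> / s) *\<^sub>R e j + (\<sigma> / s) *\<^sub>R e (Suc j)"
              unfolding y_def eS using s by (simp add: algebra_simps)
            then show ?thesis
              using convexD[OF convex_cball[of p r] ej eSj, of "1 - \<sigma> / s" "\<sigma> / s"] that s by simp
          qed
          have "DERIV (\<lambda>\<sigma>. \<phi> (y \<sigma>)) \<sigma> :> D \<phi> (y \<sigma>) (X (e j))" if "0 \<le> \<sigma>" "\<sigma> \<le> s" for \<sigma>
          proof -
            have "(y has_derivative (\<lambda>h. h *\<^sub>R X (e j))) (at \<sigma>)"
              unfolding y_def by (auto intro!: derivative_eq_intros)
            from has_derivative_compose[OF this d\<phi>[OF yb[OF that]]]
            show ?thesis
              using has_derivative_linear[OF d\<phi>[OF yb[OF that]]]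
              by (auto simp: has_field_derivative_def linear_scale mult.commute
                  elim!: has_derivative_eq_rhs)
          qed
          from MVT2[OF s(1) this] obtain \<sigma> where \<sigma>: "0 < \<sigma>" "\<sigma> < s"
            and mv: "\<phi> (y s) - \<phi> (y 0) = s * D \<phi> (y \<sigma>) (X (e j))" by auto
          have y\<sigma>: "y \<sigma> \<in> cball p r" using \<sigma> by (intro yb) auto
          have lin: "linear (D \<phi> (y \<sigma>))" using has_derivative_linear[OF d\<phi>[OF y\<sigma>]] .
          have "dist (e j) (y \<sigma>) = \<sigma> * norm (X (e j))"
            using \<sigma> by (simp add: dist_norm y_def)
          also have "\<dots> \<le> s * M" using \<sigma> M(2)[OF ej] by (intro mult_mono) auto
          finally have "dist (X (e j)) (X (y \<sigma>)) < \<epsilon>" using s(2) by (intro \<delta>(2) ej y\<sigma>) auto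
          then have small: "norm (X (e j) - X (y \<sigma>)) \<le> \<epsilon>" by (simp add: dist_norm)
          have "D \<phi> (y \<sigma>) (X (e j)) = D \<phi> (y \<sigma>) (X (e j) - X (y \<sigma>))"
            using tang[of "y \<sigma>"] y\<sigma> r(2) by (auto simp: linear_diff[OF lin])
          then have "\<bar>D \<phi> (y \<sigma>) (X (e j))\<bar> \<le> C * \<epsilon>"
            using order_trans[OF D\<phi>[OF y\<sigma>] mult_right_mono[OF small, of C]] C(1)
            by (simp add: mult.commute)
          then have "\<bar>\<phi> (e (Suc j)) - \<phi> (e j)\<bar> \<le> s * (C * \<epsilon>)"
            using mv s(1) by (simp add: y_def eS abs_mult)
          with IH(3) have "\<bar>\<phi> (e (Suc j)) - \<phi> p\<bar> \<le> real (Suc j) * s * (C * \<epsilon>)"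
            by (simp add: algebra_simps)
          with n1 n2 show "norm (e (Suc j) - p) \<le> real (Suc j) * s * M \<and>
              norm (e (Suc j) - p - (real (Suc j) * s) *\<^sub>R X p) \<le> real (Suc j) * s * \<eta> \<and>
              \<bar>\<phi> (e (Suc j)) - \<phi> p\<bar> \<le> real (Suc j) * s * (C * \<epsilon>)" by blast
        qed
      qed
      from this[of n] s(3) tM show ?thesis
        by (intro bexI[of _ "e n"]) (auto simp: dist_norm norm_minus_commute algebra_simps)
    qed
    have Qne: "?Q \<noteq> {}" using approx[of 1] by auto
    have "continuous_on ?Q (\<lambda>x. \<bar>\<phi> x - \<phi> p\<bar>)"
      using Ck_on_imp_continuous_on[OF \<phi>] r(2)
      by (intro continuous_intros) (auto intro: continuous_on_subset)
    moreover have "compact ?Q" by (simp add: compact_Int)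
    ultimately obtain x where x: "x \<in> ?Q" "\<And>z. z \<in> ?Q \<Longrightarrow> \<bar>\<phi> x - \<phi> p\<bar> \<le> \<bar>\<phi> z - \<phi> p\<bar>"
      using continuous_attains_inf[of ?Q] Qne by blast
    have "\<phi> x = \<phi> p"
    proof (rule ccontr)
      assume "\<phi> x \<noteq> \<phi> p"
      \<comment> \<open>For this \<open>\<epsilon>\<close> some end point has at most half of the minimal difference.\<close>
      define \<epsilon> where "\<epsilon> = \<bar>\<phi> x - \<phi> p\<bar> / (2 * t * C)"
      have "\<epsilon> > 0" using \<open>\<phi> x \<noteq> \<phi> p\<close> t C by (simp add: \<epsilon>_def)
      then obtain z where z: "z \<in> ?Q" "\<bar>\<phi> z - \<phi> p\<bar> \<le> t * (C * \<epsilon>)" using approx by blast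
      moreover have "t * (C * \<epsilon>) = \<bar>\<phi> x - \<phi> p\<bar> / 2" using t C by (simp add: \<epsilon>_def)
      moreover have "\<bar>\<phi> x - \<phi> p\<bar> > 0" using \<open>\<phi> x \<noteq> \<phi> p\<close> by simp
      ultimately show False using order_trans[OF x(2)[OF z(1)] z(2)] by simp
    qed
    moreover have "norm (x - p - t *\<^sub>R X p) \<le> t * \<eta>"
      using x(1) by (simp add: dist_norm norm_minus_commute algebra_simps)
    ultimately show "\<exists>x\<in>U. \<phi> x = \<phi> p \<and> norm (x - p - t *\<^sub>R X p) \<le> t * \<eta>"
      using x(1) r(2) by blast
  qed
qed

text \<open>The level set contains points \<open>p + t X p + o(t)\<close>, and \<open>u\<close> has the value \<open>u p\<close> there.\<close>

lemma derivative_zero_along_level_set: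
  fixes X :: "'e::{real_inner,heine_borel} \<Rightarrow> 'e" and \<phi> u :: "'e \<Rightarrow> real"
  assumes U: "open U" "p \<in> U" and X: "continuous_on U X" and \<phi>: "Ck_on (Suc 0) U \<phi>"
    and tang: "\<And>x. x \<in> U \<Longrightarrow> D \<phi> x (X x) = 0" and u: "u differentiable (at p)"
    and level: "\<And>x. x \<in> U \<Longrightarrow> \<phi> x = \<phi> p \<Longrightarrow> u x = u p"
  shows "D u p (X p) = 0"
proof -
  have du: "(u has_derivative D u p) (at p)" using u by (simp add: frechet_derivative_works)
  have bl: "bounded_linear (D u p)" using has_derivative_bounded_linear[OF du] .
  then obtain B where B: "B > 0" "\<And>v. norm (D u p v) \<le> norm v * B"
    using bounded_linear.pos_bounded by blast
  have lin: "linear (D u p)" using bl bounded_linear.linear by blast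
  have "\<bar>D u p (X p)\<bar> \<le> \<epsilon> * (B + norm (X p) + 1)" if "0 < \<epsilon>" "\<epsilon> < 1" for \<epsilon>
  proof -
    obtain d where d: "d > 0" "\<And>y. norm (y - p) < d \<Longrightarrow> norm (u y - u p - D u p (y - p)) \<le> \<epsilon> * norm (y - p)"
      using du \<open>\<epsilon> > 0\<close> unfolding has_derivative_at_alt by blast
    obtain t0 where t0: "t0 > 0" "\<And>t. 0 < t \<Longrightarrow> t < t0 \<Longrightarrow> \<exists>x\<in>U. \<phi> x = \<phi> p \<and> norm (x - p - t *\<^sub>R X p) \<le> t * \<epsilon>"
      using level_point_along_field[OF U X \<phi> tang \<open>\<epsilon> > 0\<close>] by blast
    define N where "N = norm (X p) + 1"
    define t where "t = min (t0 / 2) (d / (2 * N))"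
    have N: "N > 0" by (simp add: N_def add_nonneg_pos)
    have t: "0 < t" "t < t0" "t * N < d"
    proof -
      show "0 < t" "t < t0" using t0(1) d(1) N by (auto simp: t_def)
      have "t * N \<le> d / (2 * N) * N" using N by (intro mult_right_mono) (auto simp: t_def)
      also have "\<dots> < d" using N d(1) by simp
      finally show "t * N < d" .
    qed
    then obtain x where x: "x \<in> U" "\<phi> x = \<phi> p" "norm (x - p - t *\<^sub>R X p) \<le> t * \<epsilon>" using t0(2) by blast
    have xp: "norm (x - p) \<le> t * N"
    proof -
      have "norm (x - p) \<le> norm (x - p - t *\<^sub>R X p) + norm (t *\<^sub>R X p)"
        using norm_triangle_sub[of "x - p" "t *\<^sub>R X p"] by simp
      also have "\<dots> \<le> t * 1 + t * norm (X p)"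
        using x(3) t(1) that mult_left_mono[of \<epsilon> 1 t]
        by (intro add_mono order_trans[OF x(3)]) auto
      finally show ?thesis by (simp add: N_def algebra_simps)
    qed
    have "norm (D u p (x - p)) \<le> \<epsilon> * (t * N)"
      using d(2)[of x] xp t(3) level[OF x(1,2)] that(1)
      by (auto intro: order_trans[OF _ mult_left_mono])
    moreover have "norm (D u p (x - p - t *\<^sub>R X p)) \<le> (t * \<epsilon>) * B"
      using B(2)[of "x - p - t *\<^sub>R X p"] x(3) B(1) by (meson mult_right_mono less_imp_le order_trans)
    moreover have "D u p (x - p - t *\<^sub>R X p) = D u p (x - p) - t * D u p (X p)"
      by (simp only: linear_diff[OF lin] linear_scale[OF lin] real_scaleR_def)
    ultimately have "\<bar>t * D u p (X p)\<bar> \<le> \<epsilon> * (t * N) + (t * \<epsilon>) * B" by simp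
    then have "t * \<bar>D u p (X p)\<bar> \<le> t * (\<epsilon> * (B + norm (X p) + 1))"
      using t(1) by (simp add: abs_mult N_def algebra_simps)
    then show ?thesis using t(1) by simp
  qed
  note small = this
  show ?thesis
  proof (rule ccontr)
    assume nz: "D u p (X p) \<noteq> 0"
    define R where "R = B + norm (X p) + 1"
    have R: "R > 0" using B(1) by (simp add: R_def add_pos_nonneg)
    define \<epsilon> where "\<epsilon> = min (1/2) (\<bar>D u p (X p)\<bar> / (2 * R))"
    have "0 < \<epsilon>" "\<epsilon> < 1" using nz R by (auto simp: \<epsilon>_def)
    from small[OF this] have "\<bar>D u p (X p)\<bar> \<le> \<epsilon> * R" by (simp add: R_def)
    also have "\<dots> \<le> \<bar>D u p (X p)\<bar> / (2 * R) * R" using R by (intro mult_right_mono) (auto simp: \<epsilon>_def)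
    also have "\<dots> = \<bar>D u p (X p)\<bar> / 2" using R by simp
    finally show False using nz by simp
  qed
qed

section \<open>Differentiation under a positive functional\<close>

text \<open>Functions of a parameter \<open>s\<close> and a vector \<open>e\<close> whose iterated derivatives in \<open>e\<close> up to order \<open>n\<close> are
  jointly continuous. Joint continuity is demanded again at each order, since differentiability in
  \<open>e\<close> alone says nothing about \<open>s\<close>.\<close>

primrec par_Ck :: "nat \<Rightarrow> 's::t2_space set \<Rightarrow> 'e::real_normed_vector set \<Rightarrow>
    ('s \<Rightarrow> 'e \<Rightarrow> real) \<Rightarrow> bool" where
  "par_Ck 0 S U F \<longleftrightarrow> continuous_on (S \<times> U) (\<lambda>(s, e). F s e)"
| "par_Ck (Suc n) S U F \<longleftrightarrow> continuous_on (S \<times> U) (\<lambda>(s, e). F s e) \<and>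
     (\<forall>s\<in>S. \<forall>e\<in>U. F s differentiable (at e)) \<and> (\<forall>v. par_Ck n S U (\<lambda>s e. D (F s) e v))"

lemma par_Ck_continuous_on: "par_Ck n S U F \<Longrightarrow> continuous_on (S \<times> U) (\<lambda>(s, e). F s e)"
  by (cases n) auto

lemma par_Ck_continuous_slice:
  assumes "par_Ck n UNIV U F" "e \<in> U" shows "continuous_on UNIV (\<lambda>s. F s e)"
proof -
  have "continuous_on UNIV (\<lambda>s. (\<lambda>(s, e). F s e) (s, e))"
    by (rule continuous_on_compose2[OF par_Ck_continuous_on[OF assms(1)]])
      (use assms(2) in \<open>auto intro!: continuous_intros\<close>)
  then show ?thesis by simp
qed

lemma par_Ck_cong:
  assumes "open U" "\<And>s e. s \<in> S \<Longrightarrow> e \<in> U \<Longrightarrow> F s e = G s e"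
  shows "par_Ck n S U F \<longleftrightarrow> par_Ck n S U G"
  using assms(2)
proof (induction n arbitrary: F G)
  case 0
  then show ?case by (auto intro!: continuous_on_cong)
next
  case (Suc n)
  have "continuous_on (S \<times> U) (\<lambda>(s, e). F s e) \<longleftrightarrow> continuous_on (S \<times> U) (\<lambda>(s, e). G s e)"
    using Suc.prems by (auto intro!: continuous_on_cong)
  moreover have "D (F s) e = D (G s) e" "F s differentiable at e \<longleftrightarrow> G s differentiable at e"
    if "s \<in> S" "e \<in> U" for s e
    using D_cong[OF assms(1) that(2) Suc.prems[OF that(1)]] by auto
  ultimately show ?case using Suc.IH[of "\<lambda>s e. D (F s) e _" "\<lambda>s e. D (G s) e _"] by simp
qed

lemma par_Ck_subset: "par_Ck n S U F \<Longrightarrow> V \<subseteq> U \<Longrightarrow> par_Ck n S V F"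
proof (induction n arbitrary: F)
  case 0
  then show ?case by (auto intro: continuous_on_subset)
next
  case (Suc n)
  then show ?case by (auto intro: continuous_on_subset[of "S \<times> U"])
qed

lemma par_Ck_of_joint:
  fixes f :: "'d::real_normed_vector \<times> 'e::real_normed_vector \<Rightarrow> real"
  assumes "open V" "open U" "continuous_on S y" "y ` S \<subseteq> V" "smooth_on (V \<times> U) f"
  shows "par_Ck n S U (\<lambda>s e. f (y s, e))"
proof -
  have c: "continuous_on (S \<times> U) (\<lambda>(s, e). f (y s, e))" if "smooth_on (V \<times> U) f" for f :: "'d \<times> 'e \<Rightarrow> real"
  proof -
    have "continuous_on (S \<times> U) (\<lambda>p. y (fst p))"
      by (rule continuous_on_compose2[OF assms(3) continuous_on_fst[OF continuous_on_id]]) auto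
    then have "continuous_on (S \<times> U) (\<lambda>p. (y (fst p), snd p))"
      by (intro continuous_on_Pair continuous_on_snd continuous_on_id)
    then have "continuous_on (S \<times> U) (\<lambda>p. f (y (fst p), snd p))"
      by (rule continuous_on_compose2[OF smooth_on_continuous[OF that]]) (use assms(4) in auto)
    then show ?thesis by (simp add: case_prod_unfold)
  qed
  show ?thesis using assms(5)
proof (induction n arbitrary: f)
  case 0
  then show ?case using c by simp
next
  case (Suc n)
  have d: "((\<lambda>e. f (y s, e)) has_derivative (\<lambda>v. D f (y s, e) (0, v))) (at e)" if "s \<in> S" "e \<in> U" for s e
  proof -
    have f: "(f has_derivative D f (y s, e)) (at (y s, e))"
      using that assms(4) by (intro smooth_on_has_derivative[OF Suc.prems]) auto
    have "((\<lambda>e. (y s, e)) has_derivative (\<lambda>v. (0, v))) (at e)"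
      by (intro has_derivative_Pair has_derivative_const has_derivative_ident)
    from has_derivative_compose[OF this f] show ?thesis .
  qed
  have "par_Ck n S U (\<lambda>s e. D (\<lambda>e. f (y s, e)) e v) \<longleftrightarrow> par_Ck n S U (\<lambda>s e. D f (y s, e) (0, v))" for v
    by (rule par_Ck_cong[OF assms(2)]) (simp add: D_eq[OF d])
  then have "par_Ck n S U (\<lambda>s e. D (\<lambda>e. f (y s, e)) e v)" for v
    using Suc.IH[OF smooth_on_D[OF Suc.prems]] by blast
  then show ?case using c[OF Suc.prems] d by (auto simp: differentiable_def)
qed
qed

lemma par_Ck_local:
  fixes F :: "'s::t2_space \<Rightarrow> 'e::real_normed_vector \<Rightarrow> real"
  assumes "\<And>s. \<exists>S. open S \<and> s \<in> S \<and> par_Ck n S U F" "open U"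
  shows "par_Ck n UNIV U F"
proof -
  have c: "continuous_on (UNIV \<times> U) (\<lambda>(s, e). F s e)" if H: "\<And>s. \<exists>S. open S \<and> s \<in> S \<and> par_Ck n S U F"
    for F :: "'s \<Rightarrow> 'e \<Rightarrow> real" and n
  proof (rule continuous_at_imp_continuous_on, safe)
    fix s e assume "e \<in> U"
    obtain S where S: "open S" "s \<in> S" "par_Ck n S U F" using H by blast
    have "\<forall>p\<in>S \<times> U. isCont (\<lambda>(s, e). F s e) p"
      using par_Ck_continuous_on[OF S(3)] continuous_on_eq_continuous_at[OF open_Times[OF S(1) assms(2)]]
      by blast
    then show "isCont (\<lambda>(s, e). F s e) (s, e)" using S(2) \<open>e \<in> U\<close> by blast
  qed
  show ?thesis using assms(1)
proof (induction n arbitrary: F)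
  case 0
  then show ?case using c[of 0 F] by simp
next
  case (Suc n)
  have "par_Ck n UNIV U (\<lambda>s e. D (F s) e v)" for v
    by (rule Suc.IH) (metis Suc.prems par_Ck.simps(2))
  moreover have "F s differentiable at e" if "e \<in> U" for s e
    using Suc.prems[of s] that by auto
  ultimately show ?case using c[of "Suc n" F, OF Suc.prems] by simp
qed
qed

lemma par_Ck_reparam:
  fixes F :: "'s::t2_space \<Rightarrow> 'e::real_normed_vector \<Rightarrow> real" and j :: "'r::t2_space \<Rightarrow> 's"
  assumes "par_Ck n UNIV U F" "continuous_on UNIV j"
  shows "par_Ck n UNIV U (\<lambda>s. F (j s))"
proof -
  have c: "continuous_on (UNIV \<times> U) (\<lambda>(s, e). F (j s) e)" if "continuous_on (UNIV \<times> U) (\<lambda>(s, e). F s e)"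
    for F :: "'s \<Rightarrow> 'e \<Rightarrow> real"
  proof -
    have "continuous_on (UNIV \<times> U) (\<lambda>p. j (fst p))"
      by (rule continuous_on_compose2[OF assms(2) continuous_on_fst[OF continuous_on_id]]) auto
    then have "continuous_on (UNIV \<times> U) (\<lambda>p. (j (fst p), snd p))"
      by (intro continuous_on_Pair continuous_on_snd continuous_on_id)
    then have "continuous_on (UNIV \<times> U) (\<lambda>p. (\<lambda>(s, e). F s e) (j (fst p), snd p))"
      by (rule continuous_on_compose2[OF that]) auto
    then show ?thesis by (simp add: case_prod_unfold)
  qed
  show ?thesis using assms(1)
proof (induction n arbitrary: F)
  case 0 then show ?case using c by simp
next
  case (Suc n)
  then show ?case using c[of F] Suc.IH[of "\<lambda>s e. D (F s) e _"] by simp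
qed
qed

text \<open>The set where the inequality holds is open and contains \<open>L \<times> {e0}\<close>, hence a tube around it.\<close>

lemma uniform_on_compact_parameter:
  fixes F :: "'s::t2_space \<Rightarrow> 'e::real_normed_vector \<Rightarrow> real"
  assumes c: "continuous_on (UNIV \<times> U) (\<lambda>(s, e). F s e)" and U: "open U" "e0 \<in> U"
    and L: "compact L" and "\<epsilon> > 0"
  shows "\<exists>\<delta>>0. ball e0 \<delta> \<subseteq> U \<and> (\<forall>e\<in>ball e0 \<delta>. \<forall>s\<in>L. \<bar>F s e - F s e0\<bar> < \<epsilon>)"
proof -
  define W where "W = {p \<in> UNIV \<times> U. \<bar>F (fst p) (snd p) - F (fst p) e0\<bar> < \<epsilon>}"
  have c1: "continuous_on (UNIV \<times> U) (\<lambda>p. F (fst p) (snd p))"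
    using c by (simp add: case_prod_unfold)
  have c2: "continuous_on (UNIV \<times> U) (\<lambda>p. F (fst p) e0)"
  proof -
    have "continuous_on (UNIV \<times> U) (\<lambda>p. (\<lambda>p. F (fst p) (snd p)) (fst p, e0))"
      by (rule continuous_on_compose2[OF c1]) (use U in \<open>auto intro!: continuous_intros\<close>)
    then show ?thesis by simp
  qed
  have "open W"
  proof -
    have "continuous_on (UNIV \<times> U) (\<lambda>p. \<bar>F (fst p) (snd p) - F (fst p) e0\<bar>)"
      by (intro continuous_intros c1 c2)
    then have "open ((UNIV \<times> U) \<inter> (\<lambda>p. \<bar>F (fst p) (snd p) - F (fst p) e0\<bar>) -` {..<\<epsilon>})"
      by (rule continuous_open_preimage) (auto intro: open_Times U(1))
    moreover have "W = (UNIV \<times> U) \<inter> (\<lambda>p. \<bar>F (fst p) (snd p) - F (fst p) e0\<bar>) -` {..<\<epsilon>}"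
      unfolding W_def by auto
    ultimately show ?thesis by simp
  qed
  have "\<exists>A B. open A \<and> open B \<and> s \<in> A \<and> e0 \<in> B \<and> A \<times> B \<subseteq> W" for s
  proof -
    have "(s, e0) \<in> W" using U \<open>\<epsilon> > 0\<close> by (simp add: W_def)
    then show ?thesis using open_prod_elim[OF \<open>open W\<close>] by (metis mem_Sigma_iff)
  qed
  then obtain A B where AB: "\<And>s. open (A s)" "\<And>s. open (B s)" "\<And>s. s \<in> A s" "\<And>s. e0 \<in> B s"
    "\<And>s. A s \<times> B s \<subseteq> W" by metis
  have "L \<subseteq> (\<Union>s\<in>L. A s)" using AB(3) by blast
  then obtain L' where L': "L' \<subseteq> L" "finite L'" "L \<subseteq> (\<Union>s\<in>L'. A s)"
    using compactE_image[OF L, of L A] AB(1) by metis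
  define N where "N = U \<inter> (\<Inter>s\<in>L'. B s)"
  have "open N" "e0 \<in> N" using L'(2) U AB(2,4) by (auto simp: N_def)
  then obtain \<delta> where \<delta>: "\<delta> > 0" "ball e0 \<delta> \<subseteq> N" using open_contains_ball by blast
  have "\<bar>F s e - F s e0\<bar> < \<epsilon>" if es: "e \<in> ball e0 \<delta>" "s \<in> L" for s e
  proof -
    obtain s' where "s' \<in> L'" "s \<in> A s'" using L'(3) es(2) by blast
    moreover have "e \<in> B s'" using es(1) \<delta>(2) \<open>s' \<in> L'\<close> by (auto simp: N_def)
    ultimately have "(s, e) \<in> W" using AB(5) by blast
    then show ?thesis by (simp add: W_def)
  qed
  with \<delta> show ?thesis by (auto simp: N_def)
qed

text \<open>The common features of integration over \<open>[0, 1]\<close>, where \<open>T\<close> is the whole line and \<open>L\<close> the interval,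
  and of invariant integration over a group for functions supported in a compact set \<open>T = L\<close>.\<close>

locale bounded_functional =
  fixes I :: "('s::t2_space \<Rightarrow> real) \<Rightarrow> real" and T L :: "'s set" and C :: real
  assumes linI: "\<And>f g a b. continuous_on UNIV f \<Longrightarrow> continuous_on UNIV g \<Longrightarrow>
      (\<And>s. s \<notin> T \<Longrightarrow> f s = 0) \<Longrightarrow> (\<And>s. s \<notin> T \<Longrightarrow> g s = 0) \<Longrightarrow>
      I (\<lambda>s. a * f s + b * g s) = a * I f + b * I g"
    and bndI: "\<And>f \<epsilon>. continuous_on UNIV f \<Longrightarrow> (\<And>s. s \<notin> T \<Longrightarrow> f s = 0) \<Longrightarrow>
      (\<And>s. s \<in> L \<Longrightarrow> \<bar>f s\<bar> \<le> \<epsilon>) \<Longrightarrow> \<bar>I f\<bar> \<le> C * \<epsilon>"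
    and compact_L: "compact L" and C_nonneg: "C \<ge> 0"
begin

lemma I_diff:
  assumes "continuous_on UNIV f" "continuous_on UNIV g" "\<And>s. s \<notin> T \<Longrightarrow> f s = 0" "\<And>s. s \<notin> T \<Longrightarrow> g s = 0"
  shows "I (\<lambda>s. f s - g s) = I f - I g"
  using linI[OF assms, of 1 "-1"] by simp

text \<open>By the mean value theorem the remainder of the first-order expansion of \<open>F s\<close> at \<open>e0\<close> is bounded by
  the oscillation of the partial derivatives, uniformly for \<open>s\<close> in the compact set \<open>L\<close>; the functional
  preserves this bound up to the factor \<open>C\<close>.\<close>

theorem Ck_on_functional:
  fixes F :: "'s \<Rightarrow> 'e::{real_inner,heine_borel} \<Rightarrow> real"
  assumes U: "open U" and F: "par_Ck n UNIV U F" and T: "\<And>s e. e \<in> U \<Longrightarrow> s \<notin> T \<Longrightarrow> F s e = 0"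
  shows "Ck_on n U (\<lambda>e. I (\<lambda>s. F s e))"
  using F T
proof (induction n arbitrary: F)
  case 0
  have "isCont (\<lambda>e. I (\<lambda>s. F s e)) e0" if e0: "e0 \<in> U" for e0
    unfolding continuous_at_eps_delta
  proof (intro allI impI)
    fix \<epsilon> :: real assume "\<epsilon> > 0"
    define \<epsilon>' where "\<epsilon>' = \<epsilon> / (C + 1)"
    have e': "\<epsilon>' > 0" "C * \<epsilon>' < \<epsilon>" using C_nonneg \<open>\<epsilon> > 0\<close> by (auto simp: \<epsilon>'_def field_simps)
    obtain \<delta> where \<delta>: "\<delta> > 0" "ball e0 \<delta> \<subseteq> U" "\<And>e s. e \<in> ball e0 \<delta> \<Longrightarrow> s \<in> L \<Longrightarrow> \<bar>F s e - F s e0\<bar> < \<epsilon>'"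
      using uniform_on_compact_parameter[OF par_Ck_continuous_on[OF 0(1)] U e0 compact_L e'(1)] by blast
    have "dist (I (\<lambda>s. F s e)) (I (\<lambda>s. F s e0)) < \<epsilon>" if "dist e e0 < \<delta>" for e
    proof -
      have eb: "e \<in> ball e0 \<delta>" using that by (simp add: dist_commute)
      then have eU: "e \<in> U" using \<delta>(2) by blast
      note c = par_Ck_continuous_slice[OF 0(1) eU] par_Ck_continuous_slice[OF 0(1) e0]
      have "\<bar>I (\<lambda>s. F s e - F s e0)\<bar> \<le> C * \<epsilon>'"
        using \<delta>(3)[OF eb] by (intro bndI continuous_on_diff c) (auto simp: 0(2)[OF eU] 0(2)[OF e0] less_imp_le)
      moreover have "I (\<lambda>s. F s e - F s e0) = I (\<lambda>s. F s e) - I (\<lambda>s. F s e0)"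
        by (intro I_diff c 0(2) eU e0)
      ultimately show ?thesis using e'(2) by (simp add: dist_real_def)
    qed
    then show "\<exists>\<delta>>0. \<forall>e. dist e e0 < \<delta> \<longrightarrow> dist (I (\<lambda>s. F s e)) (I (\<lambda>s. F s e0)) < \<epsilon>"
      using \<delta>(1) by blast
  qed
  then show ?case by (simp add: continuous_at_imp_continuous_on)
next
  case (Suc n)
  have dF: "(F s has_derivative D (F s) e) (at e)" if "e \<in> U" for s e
    using Suc.prems(1) that by (simp add: frechet_derivative_works)
  have lin: "linear (D (F s) e)" if "e \<in> U" for s e
    using has_derivative_linear[OF dF[OF that]] .
  have p: "par_Ck n UNIV U (\<lambda>s e. D (F s) e v)" for v using Suc.prems(1) by simp
  have DT: "D (F s) e v = 0" if "e \<in> U" "s \<notin> T" for s e v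
  proof -
    have "D (F s) e = D (\<lambda>e. 0) e"
      by (rule D_cong(1)[OF U that(1)]) (use Suc.prems(2) that(2) in auto)
    then show ?thesis by simp
  qed
  note cD = par_Ck_continuous_slice[OF p]
  note cF = par_Ck_continuous_slice[OF Suc.prems(1)]
  show ?case
  proof (rule Ck_on_SucI[OF U])
    show "Ck_on n U (\<lambda>e. I (\<lambda>s. D (F s) e v))" for v
      by (rule Suc.IH[OF p]) (use DT in auto)
  next
    fix e0 assume e0: "e0 \<in> U"
    have "linear (\<lambda>v. I (\<lambda>s. D (F s) e0 v))"
    proof (rule linearI)
      fix v w :: 'e
      have "(\<lambda>s. D (F s) e0 (v + w)) = (\<lambda>s. 1 * D (F s) e0 v + 1 * D (F s) e0 w)"
        using linear_add[OF lin[OF e0]] by simp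
      then show "I (\<lambda>s. D (F s) e0 (v + w)) = I (\<lambda>s. D (F s) e0 v) + I (\<lambda>s. D (F s) e0 w)"
        using linI[OF cD[OF e0, of v] cD[OF e0, of w] DT[OF e0] DT[OF e0], of 1 1] by simp
    next
      fix r and v :: 'e
      have "(\<lambda>s. D (F s) e0 (r *\<^sub>R v)) = (\<lambda>s. r * D (F s) e0 v + 0 * D (F s) e0 v)"
        using linear_scale[OF lin[OF e0]] by simp
      then show "I (\<lambda>s. D (F s) e0 (r *\<^sub>R v)) = r *\<^sub>R I (\<lambda>s. D (F s) e0 v)"
        using linI[OF cD[OF e0, of v] cD[OF e0, of v] DT[OF e0] DT[OF e0], of r 0] by simp
    qed
    then have bl: "bounded_linear (\<lambda>v. I (\<lambda>s. D (F s) e0 v))" by (rule linear_imp_bounded_linear)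
    show "((\<lambda>e. I (\<lambda>s. F s e)) has_derivative (\<lambda>v. I (\<lambda>s. D (F s) e0 v))) (at e0)"
      unfolding has_derivative_at_alt
    proof (intro conjI bl allI impI)
      fix \<epsilon> :: real assume "\<epsilon> > 0"
      define m where "m = C * (real (card (onb :: 'e set)) + 1) + 1"
      have m: "m > 0" using C_nonneg by (simp add: m_def add_nonneg_pos)
      define \<epsilon>' where "\<epsilon>' = \<epsilon> / m"
      have e': "\<epsilon>' > 0" using \<open>\<epsilon> > 0\<close> m by (simp add: \<epsilon>'_def)
      have "\<exists>\<delta>>0. ball e0 \<delta> \<subseteq> U \<and> (\<forall>e\<in>ball e0 \<delta>. \<forall>s\<in>L. \<bar>D (F s) e b - D (F s) e0 b\<bar> < \<epsilon>')" for b
        using uniform_on_compact_parameter[OF par_Ck_continuous_on[OF p] U e0 compact_L e'] .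
      then obtain d where d: "\<And>b. d b > 0" "\<And>b. ball e0 (d b) \<subseteq> U"
        "\<And>b e s. e \<in> ball e0 (d b) \<Longrightarrow> s \<in> L \<Longrightarrow> \<bar>D (F s) e b - D (F s) e0 b\<bar> < \<epsilon>'" by metis
      define \<delta> where "\<delta> = Min (insert (d 0) (d ` onb))"
      have \<delta>: "\<delta> > 0" "\<delta> \<le> d 0" "\<And>b. b \<in> onb \<Longrightarrow> \<delta> \<le> d b"
        unfolding \<delta>_def using d(1) by auto
      have \<delta>U: "ball e0 \<delta> \<subseteq> U" using d(2)[of 0] \<delta>(2) by (meson order_trans subset_ball)
      show "\<exists>d>0. \<forall>y. norm (y - e0) < d \<longrightarrow>
          norm (I (\<lambda>s. F s y) - I (\<lambda>s. F s e0) - I (\<lambda>s. D (F s) e0 (y - e0))) \<le> \<epsilon> * norm (y - e0)"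
      proof (intro exI[of _ \<delta>] conjI \<delta>(1) allI impI)
        fix y assume y: "norm (y - e0) < \<delta>"
        then have yb: "y \<in> ball e0 \<delta>" by (simp add: dist_norm norm_minus_commute)
        then have yU: "y \<in> U" using \<delta>U by blast
        let ?w = "y - e0"
        let ?K = "norm ?w * (real (card (onb :: 'e set)) * \<epsilon>')"
        have R: "\<bar>F s y - F s e0 - D (F s) e0 ?w\<bar> \<le> ?K" if s: "s \<in> L" for s
        proof -
          have seg: "e0 + \<sigma> *\<^sub>R ?w \<in> ball e0 \<delta>" if "0 \<le> \<sigma>" "\<sigma> \<le> 1" for \<sigma>
          proof -
            have "norm (\<sigma> *\<^sub>R ?w) \<le> norm ?w" using that by (simp add: mult_left_le_one_le)
            then show ?thesis using y by (simp add: dist_norm)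
          qed
          have "DERIV (\<lambda>\<sigma>. F s (e0 + \<sigma> *\<^sub>R ?w)) \<sigma> :> D (F s) (e0 + \<sigma> *\<^sub>R ?w) ?w" if "0 \<le> \<sigma>" "\<sigma> \<le> 1" for \<sigma>
          proof -
            have eU: "e0 + \<sigma> *\<^sub>R ?w \<in> U" using seg[OF that] \<delta>U by blast
            have "((\<lambda>\<sigma>. e0 + \<sigma> *\<^sub>R ?w) has_derivative (\<lambda>h. h *\<^sub>R ?w)) (at \<sigma>)"
              by (auto intro!: derivative_eq_intros)
            from has_derivative_compose[OF this dF[OF eU, of s]] show ?thesis
              using lin[OF eU, of s] by (auto simp: has_field_derivative_def linear_scale mult.commute
                  elim!: has_derivative_eq_rhs)
          qed
          from MVT2[of 0 1, OF zero_less_one this] obtain \<sigma> where \<sigma>: "0 < \<sigma>" "\<sigma> < 1"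
            and mv: "F s (e0 + 1 *\<^sub>R ?w) - F s (e0 + 0 *\<^sub>R ?w) = (1 - 0) * D (F s) (e0 + \<sigma> *\<^sub>R ?w) ?w"
            by blast
          let ?\<xi> = "e0 + \<sigma> *\<^sub>R ?w"
          have \<xi>: "?\<xi> \<in> ball e0 \<delta>" using \<sigma> by (intro seg) auto
          then have \<xi>U: "?\<xi> \<in> U" using \<delta>U by blast
          have l2: "linear (\<lambda>v. D (F s) ?\<xi> v - D (F s) e0 v)"
            by (intro linear_compose_sub lin \<xi>U e0)
          have "F s y - F s e0 - D (F s) e0 ?w = D (F s) ?\<xi> ?w - D (F s) e0 ?w" using mv by simp
          also have "\<bar>\<dots>\<bar> \<le> norm ?w * (\<Sum>b\<in>onb. norm (D (F s) ?\<xi> b - D (F s) e0 b))"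
            using norm_linear_le_onb[OF l2, of ?w] by simp
          also have "\<dots> \<le> norm ?w * (\<Sum>b\<in>(onb :: 'e set). \<epsilon>')"
          proof (intro mult_left_mono sum_mono)
            fix b :: 'e assume "b \<in> onb"
            then have "?\<xi> \<in> ball e0 (d b)" using \<xi> \<delta>(3)[of b] by (meson subset_ball subsetD)
            then show "norm (D (F s) ?\<xi> b - D (F s) e0 b) \<le> \<epsilon>'" using d(3)[of ?\<xi> b s] s by simp
          qed simp
          finally show ?thesis by simp
        qed
        have c1: "continuous_on UNIV (\<lambda>s. F s y - F s e0)" by (intro continuous_on_diff cF yU e0)
        have "\<bar>I (\<lambda>s. F s y - F s e0 - D (F s) e0 ?w)\<bar> \<le> C * ?K"
          using R by (intro bndI continuous_on_diff cF cD yU e0)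
            (auto simp: Suc.prems(2)[OF yU] Suc.prems(2)[OF e0] DT[OF e0])
        moreover have "I (\<lambda>s. F s y - F s e0 - D (F s) e0 ?w) = I (\<lambda>s. F s y) - I (\<lambda>s. F s e0) - I (\<lambda>s. D (F s) e0 ?w)"
          using I_diff[OF c1 cD[OF e0], of ?w] I_diff[OF cF[OF yU] cF[OF e0]]
            Suc.prems(2)[OF yU] Suc.prems(2)[OF e0] DT[OF e0] by auto
        moreover have "C * ?K \<le> \<epsilon> * norm ?w"
        proof -
          have "C * real (card (onb :: 'e set)) * \<epsilon>' \<le> m * \<epsilon>'"
            using C_nonneg e' by (intro mult_right_mono) (auto simp: m_def algebra_simps)
          also have "\<dots> = \<epsilon>" using m by (simp add: \<epsilon>'_def)
          finally have "C * real (card (onb :: 'e set)) * \<epsilon>' * norm ?w \<le> \<epsilon> * norm ?w"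
            by (intro mult_right_mono) auto
          then show ?thesis by (simp add: mult_ac)
        qed
        ultimately show "norm (I (\<lambda>s. F s y) - I (\<lambda>s. F s e0) - I (\<lambda>s. D (F s) e0 ?w)) \<le> \<epsilon> * norm ?w"
          by simp
      qed
    qed
  qed
qed

end

text \<open>The coefficient \<open>g b\<close> is the average over the segment from \<open>a\<close> to \<open>y\<close> of the partial derivative in
  direction \<open>b\<close>; it is smooth because integration over \<open>[0, 1]\<close> is a bounded functional.\<close>

lemma hadamard:
  fixes f :: "'e::{real_inner,heine_borel} \<Rightarrow> real"
  assumes f: "smooth_on UNIV f"
  obtains g where "\<And>b. smooth_on UNIV (g b)" "\<And>y. f y = f a + (\<Sum>b\<in>onb. ((y - a) \<bullet> b) * g b y)"
    "\<And>b. g b a = D f a b"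
proof
  define F where "F b t y = D f (a + t *\<^sub>R (y - a)) b" for b t y
  define g where "g b y = integral {0..1} (\<lambda>t. F b t y)" for b y
  interpret bounded_functional "\<lambda>f. integral {0..1} f" UNIV "{0..1::real}" 1
  proof
    fix f g :: "real \<Rightarrow> real" and c d
    assume "continuous_on UNIV f" "continuous_on UNIV g"
    then have "f integrable_on {0..1}" and "g integrable_on {0..1}"
      by (auto intro!: integrable_continuous_real intro: continuous_on_subset)
    then have "((\<lambda>s. c * f s + d * g s) has_integral (c * integral {0..1} f + d * integral {0..1} g)) {0..1}"
      by (intro has_integral_add has_integral_mult_right integrable_integral)
    then show "integral {0..1} (\<lambda>s. c * f s + d * g s) = c * integral {0..1} f + d * integral {0..1} g"
      by (rule integral_unique)
  next
    fix f :: "real \<Rightarrow> real" and \<epsilon>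
    assume "continuous_on UNIV f" and b: "\<And>s. s \<in> {0..1} \<Longrightarrow> \<bar>f s\<bar> \<le> \<epsilon>"
    then have "continuous_on {0..1} f" by (blast intro: continuous_on_subset)
    then show "\<bar>integral {0..1} f\<bar> \<le> 1 * \<epsilon>"
      using integral_bound[of 0 1 f \<epsilon>] b by simp
  qed auto
  show "smooth_on UNIV (g b)" for b
    unfolding smooth_on_def
  proof
    fix k
    have "smooth_on (UNIV \<times> UNIV) (\<lambda>p::real \<times> 'e. D f (a + fst p *\<^sub>R (snd p + - a)) b)"
    proof -
      have "smooth_on (UNIV \<times> UNIV) (\<lambda>p::real \<times> 'e. a + fst p *\<^sub>R (snd p + - a))"
        by (intro smooth_on_add smooth_on_scaleR smooth_on_const smooth_on_bounded_linear
            bounded_linear_fst bounded_linear_snd) (auto simp: open_Times)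
      then show ?thesis
        using smooth_on_compose[OF open_Times[OF open_UNIV open_UNIV] open_UNIV UNIV_I _ smooth_on_D[OF f]] by blast
    qed
    then have "par_Ck k UNIV UNIV (\<lambda>t y. (\<lambda>p::real \<times> 'e. D f (a + fst p *\<^sub>R (snd p + - a)) b) (t, y))"
      by (intro par_Ck_of_joint[where V = UNIV and y = "\<lambda>t. t"]) (auto simp: open_Times)
    then have "par_Ck k UNIV UNIV (F b)" by (simp add: F_def[abs_def])
    then show "Ck_on k UNIV (g b)" unfolding g_def by (intro Ck_on_functional) auto
  qed
  show "g b a = D f a b" for b by (simp add: g_def F_def)
  fix y
  have der: "((\<lambda>t. f (a + t *\<^sub>R (y - a))) has_vector_derivative D f (a + t *\<^sub>R (y - a)) (y - a)) (at t within {0..1})" for t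
  proof -
    have fd: "(f has_derivative D f (a + t *\<^sub>R (y - a))) (at (a + t *\<^sub>R (y - a)))"
      by (rule smooth_on_has_derivative[OF f]) simp
    have "((\<lambda>t. a + t *\<^sub>R (y - a)) has_derivative (\<lambda>h. h *\<^sub>R (y - a))) (at t)"
      by (auto intro!: derivative_eq_intros)
    from has_derivative_compose[OF this fd]
    have "((\<lambda>t. f (a + t *\<^sub>R (y - a))) has_vector_derivative D f (a + t *\<^sub>R (y - a)) (y - a)) (at t)"
      using has_derivative_linear[OF fd] by (simp add: has_vector_derivative_def linear_scale)
    then show ?thesis by (rule has_vector_derivative_at_within)
  qed
  have Fint: "(\<lambda>t. F b t y) integrable_on {0..1}" for b
  proof -
    have "continuous_on UNIV (\<lambda>t. D f (a + t *\<^sub>R (y - a)) b)"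
      by (rule continuous_on_compose2[OF smooth_on_continuous[OF smooth_on_D[OF f]]])
        (auto intro!: continuous_intros)
    then show ?thesis unfolding F_def by (intro integrable_continuous_real) (auto intro: continuous_on_subset)
  qed
  have "f y - f a = integral {0..1} (\<lambda>t. D f (a + t *\<^sub>R (y - a)) (y - a))"
    using fundamental_theorem_of_calculus[of 0 1 "\<lambda>t. f (a + t *\<^sub>R (y - a))", OF _ der]
    by (simp add: integral_unique)
  also have "(\<lambda>t. D f (a + t *\<^sub>R (y - a)) (y - a)) = (\<lambda>t. \<Sum>b\<in>onb. ((y - a) \<bullet> b) * F b t y)"
  proof
    fix t
    have "linear (D f (a + t *\<^sub>R (y - a)))"
      by (rule has_derivative_linear[OF smooth_on_has_derivative[OF f]]) simp
    from linear_onb_expand[OF this, of "y - a"]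
    show "D f (a + t *\<^sub>R (y - a)) (y - a) = (\<Sum>b\<in>onb. ((y - a) \<bullet> b) * F b t y)" by (simp add: F_def)
  qed
  also have "integral {0..1} \<dots> = (\<Sum>b\<in>onb. ((y - a) \<bullet> b) * g b y)"
    unfolding g_def by (subst integral_sum) (auto intro!: integrable_on_mult_right Fint)
  finally show "f y = f a + (\<Sum>b\<in>onb. ((y - a) \<bullet> b) * g b y)" by simp
qed

section \<open>Smooth functions on manifolds\<close>

abbreviation chart_inv :: "'m set \<Rightarrow> ('m \<Rightarrow> 'e) \<Rightarrow> 'e \<Rightarrow> 'm" where
  "chart_inv U x \<equiv> inv_into U x"

locale manifold =
  fixes A :: "('m::t2_space, 'e::{real_inner,heine_borel}) chart set"
  assumes atlas: "smooth_atlas A"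
begin

lemma
  assumes "(U, x) \<in> A"
  shows chart_open: "open U" and chart_image_open: "open (x ` U)"
    and chart_homeo: "homeomorphism U (x ` U) x (chart_inv U x)"
  using atlas assms unfolding smooth_atlas_def by auto

lemma ex_chart: obtains U x where "(U, x) \<in> A" "p \<in> U"
  using atlas unfolding smooth_atlas_def by fast

lemma chart_change:
  "(U, x) \<in> A \<Longrightarrow> (V, y) \<in> A \<Longrightarrow> smooth_on (x ` (U \<inter> V)) (\<lambda>e. y (chart_inv U x e))"
  using atlas unfolding smooth_atlas_def by (auto simp: o_def)

lemma
  assumes "(U, x) \<in> A"
  shows chart_inv_chart: "p \<in> U \<Longrightarrow> chart_inv U x (x p) = p"
    and chart_chart_inv: "e \<in> x ` U \<Longrightarrow> x (chart_inv U x e) = e"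
    and chart_inv_in: "e \<in> x ` U \<Longrightarrow> chart_inv U x e \<in> U"
    and chart_cont: "continuous_on U x"
    and chart_inv_cont: "continuous_on (x ` U) (chart_inv U x)"
  using chart_homeo[OF assms] unfolding homeomorphism_def by auto

lemma chart_image_sub_open:
  assumes "(U, x) \<in> A" "open N" "N \<subseteq> U" shows "open (x ` N)"
proof -
  have "x ` N = x ` U \<inter> chart_inv U x -` N"
    using assms(3) chart_inv_chart[OF assms(1)] chart_chart_inv[OF assms(1)] by (auto simp: image_iff)
  then show ?thesis
    using continuous_open_preimage[OF chart_inv_cont[OF assms(1)] chart_image_open[OF assms(1)] assms(2)]
    by simp
qed

lemma chart_preimage_open:
  assumes "(U, x) \<in> A" "open W" shows "open (U \<inter> x -` W)"
  using continuous_open_preimage[OF chart_cont[OF assms(1)] chart_open[OF assms(1)] assms(2)] .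

lemma smooth_funD: "smooth_fun A f \<Longrightarrow> (U, x) \<in> A \<Longrightarrow> smooth_on (x ` U) (\<lambda>e. f (chart_inv U x e))"
  unfolding smooth_fun_def by (auto simp: o_def)

text \<open>Because chart changes are smooth, smoothness may be tested near each point in one chart.\<close>

lemma smooth_funI:
  assumes "\<And>p. \<exists>U x N. (U, x) \<in> A \<and> open N \<and> p \<in> N \<and> N \<subseteq> U \<and> smooth_on (x ` N) (\<lambda>e. f (chart_inv U x e))"
  shows "smooth_fun A f"
  unfolding smooth_fun_def
proof safe
  fix V y assume V: "(V, y) \<in> A"
  have "smooth_on (y ` V) (\<lambda>e. f (chart_inv V y e))"
  proof (rule smooth_on_local)
    fix e assume "e \<in> y ` V"
    then obtain p where p: "p \<in> V" "e = y p" by blast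
    obtain U x N where U: "(U, x) \<in> A" "open N" "p \<in> N" "N \<subseteq> U"
      and s: "smooth_on (x ` N) (\<lambda>e. f (chart_inv U x e))" using assms by blast
    let ?W = "y ` (N \<inter> V)"
    have W: "open ?W" using chart_image_sub_open[OF V] U(2) chart_open[OF V] by blast
    have "smooth_on ?W (\<lambda>e. x (chart_inv V y e))"
      using chart_change[OF V U(1)] by (rule smooth_on_subset) (use U(4) in auto)
    then have "smooth_on ?W (\<lambda>e. f (chart_inv U x (x (chart_inv V y e))))"
      by (rule smooth_on_compose[OF W chart_image_sub_open[OF U(1,2,4)] _ _ s, rotated])
        (use chart_inv_chart[OF V] in auto)
    then have "smooth_on ?W (\<lambda>e. f (chart_inv V y e))"
      by (subst (asm) smooth_on_cong[OF W, of _ "\<lambda>e. f (chart_inv V y e)"])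
        (use chart_inv_chart[OF V] chart_inv_chart[OF U(1)] U(4) in auto)
    with W p U(3) show "\<exists>W. open W \<and> e \<in> W \<and> smooth_on W (\<lambda>e. f (chart_inv V y e))" by blast
  qed
  then show "smooth_on (y ` V) (f \<circ> chart_inv V y)" by (simp add: o_def)
qed

lemma smooth_fun_const: "smooth_fun A (\<lambda>p. c)"
  unfolding smooth_fun_def by (auto simp: o_def smooth_on_const)

lemma smooth_fun_add: "smooth_fun A f \<Longrightarrow> smooth_fun A g \<Longrightarrow> smooth_fun A (\<lambda>p. f p + g p)"
  unfolding smooth_fun_def by (auto simp: o_def intro!: smooth_on_add chart_image_open)

lemma smooth_fun_mult: "smooth_fun A f \<Longrightarrow> smooth_fun A g \<Longrightarrow> smooth_fun A (\<lambda>p. f p * g p)"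
  unfolding smooth_fun_def by (auto simp: o_def intro!: smooth_on_mult chart_image_open)

lemma smooth_fun_diff: "smooth_fun A f \<Longrightarrow> smooth_fun A g \<Longrightarrow> smooth_fun A (\<lambda>p. f p - g p)"
  unfolding smooth_fun_def by (auto simp: o_def intro!: smooth_on_diff chart_image_open)

lemma smooth_fun_sum:
  "(\<And>i. i \<in> I \<Longrightarrow> smooth_fun A (f i)) \<Longrightarrow> smooth_fun A (\<lambda>p. \<Sum>i\<in>I. f i p)"
  by (induction I rule: infinite_finite_induct) (auto intro: smooth_fun_const smooth_fun_add)

lemma smooth_fun_continuous_on: "smooth_fun A f \<Longrightarrow> continuous_on UNIV f"
proof (rule continuous_at_imp_continuous_on, safe)
  fix p assume f: "smooth_fun A f"
  obtain U x where U: "(U, x) \<in> A" "p \<in> U" by (rule ex_chart)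
  have "continuous_on U (\<lambda>q. f (chart_inv U x (x q)))"
    by (rule continuous_on_compose2[OF smooth_on_continuous[OF smooth_funD[OF f U(1)]] chart_cont[OF U(1)]]) auto
  then have "continuous_on U f"
    by (rule continuous_on_eq) (simp add: chart_inv_chart[OF U(1)])
  then show "isCont f p" using continuous_on_eq_continuous_at[OF chart_open[OF U(1)]] U(2) by blast
qed

text \<open>The extension by 0 is smooth outside \<open>U\<close> because the part of \<open>M\<close> corresponding to \<open>C\<close> is compact,
  hence closed in the Hausdorff space \<open>M\<close>.\<close>

lemma smooth_fun_of_chart:
  assumes U: "(U, x) \<in> A" and h: "smooth_on (x ` U) h" and C: "compact C" "C \<subseteq> x ` U"
    and z: "\<And>e. e \<notin> C \<Longrightarrow> h e = 0"
  shows "smooth_fun A (\<lambda>q. if q \<in> U then h (x q) else 0)"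
proof (rule smooth_funI)
  fix p
  show "\<exists>V y N. (V, y) \<in> A \<and> open N \<and> p \<in> N \<and> N \<subseteq> V \<and>
      smooth_on (y ` N) (\<lambda>e. if chart_inv V y e \<in> U then h (x (chart_inv V y e)) else 0)"
  proof (cases "p \<in> U")
    case True
    have "smooth_on (x ` U) (\<lambda>e. if chart_inv U x e \<in> U then h (x (chart_inv U x e)) else 0)"
      by (subst smooth_on_cong[OF chart_image_open[OF U], of _ h])
        (use h in \<open>auto simp: chart_inv_chart[OF U]\<close>)
    then show ?thesis using U True chart_open[OF U] by blast
  next
    case False
    obtain V y where V: "(V, y) \<in> A" "p \<in> V" by (rule ex_chart)
    have "compact (chart_inv U x ` C)"
      using C chart_inv_cont[OF U] by (intro compact_continuous_image) (auto intro: continuous_on_subset)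
    then have cl: "closed (chart_inv U x ` C)" by (rule compact_imp_closed)
    let ?N = "V - chart_inv U x ` C"
    have p: "p \<in> ?N" using False V(2) C(2) chart_inv_in[OF U] by auto
    have N: "open ?N" using cl chart_open[OF V(1)] by blast
    have o: "open (y ` ?N)" by (rule chart_image_sub_open[OF V(1) N]) auto
    have "h (x q) = 0" if "q \<in> ?N" "q \<in> U" for q
    proof (rule z, rule notI)
      assume "x q \<in> C"
      then have "chart_inv U x (x q) \<in> chart_inv U x ` C" by blast
      then show False using that chart_inv_chart[OF U] by auto
    qed
    then have "smooth_on (y ` ?N) (\<lambda>e. if chart_inv V y e \<in> U then h (x (chart_inv V y e)) else 0)"
      by (subst smooth_on_cong[OF o, of _ "\<lambda>_. 0"]) (auto simp: chart_inv_chart[OF V(1)] smooth_on_const)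
    then show ?thesis using V(1) N p by blast
  qed
qed

text \<open>The coordinate expression \<open>b\<close> of the bump function is part of the conclusion because functions given
  in the chart have to be multiplied by it before they can be extended to \<open>M\<close>.\<close>

lemma ex_bump:
  assumes U: "(U, x) \<in> A" "p \<in> U" and W: "open W" "p \<in> W"
  obtains b C N where "smooth_on UNIV b" "\<forall>e. b e \<ge> 0" "compact C" "C \<subseteq> x ` (U \<inter> W)"
    "\<forall>e. e \<notin> C \<longrightarrow> b e = 0" "open N" "p \<in> N" "N \<subseteq> U \<inter> W" "\<forall>q\<in>N. b (x q) = 1"
    "smooth_fun A (\<lambda>q. if q \<in> U then b (x q) else 0)"
proof -
  have "open (x ` (U \<inter> W))" using chart_image_sub_open[OF U(1)] chart_open[OF U(1)] W by auto
  moreover have "x p \<in> x ` (U \<inter> W)" using U W by auto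
  ultimately obtain r where r: "r > 0" "cball (x p) r \<subseteq> x ` (U \<inter> W)"
    using open_contains_cball by blast
  obtain b :: "'e \<Rightarrow> real" where b: "smooth_on UNIV b" "\<And>y. b y \<ge> 0"
    "\<And>y. dist (x p) y \<le> r / 2 \<Longrightarrow> b y = 1" "\<And>y. dist (x p) y \<ge> r \<Longrightarrow> b y = 0"
    using smooth_bump_ball[OF r(1)] by blast
  let ?N = "U \<inter> x -` ball (x p) (r / 2)"
  have Nsub: "?N \<subseteq> U \<inter> W"
  proof
    fix q assume q: "q \<in> ?N"
    then have "x q \<in> cball (x p) r" using r(1) by auto
    then obtain q' where "q' \<in> U \<inter> W" "x q = x q'" using r(2) by blast
    then show "q \<in> U \<inter> W" using q chart_inv_chart[OF U(1)] by (metis IntD1)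
  qed
  show ?thesis
  proof (rule that[OF b(1) _ compact_cball r(2) _ chart_preimage_open[OF U(1) open_ball] _ Nsub])
    show "\<forall>e. b e \<ge> 0" using b(2) by blast
    show "\<forall>e. e \<notin> cball (x p) r \<longrightarrow> b e = 0" by (auto intro: b(4))
    show "p \<in> ?N" using U r by simp
    show "\<forall>q\<in>?N. b (x q) = 1" by (auto intro: b(3))
    show "smooth_fun A (\<lambda>q. if q \<in> U then b (x q) else 0)"
      by (rule smooth_fun_of_chart[OF U(1) smooth_on_subset[OF b(1)] compact_cball[of "x p" r]])
        (use r(2) in \<open>auto intro: b(4)\<close>)
  qed
qed

lemma ex_bump_fun:
  assumes W: "open W" "p \<in> W"
  obtains \<kappa> N where "smooth_fun A \<kappa>" "\<And>q. \<kappa> q \<ge> 0" "open N" "p \<in> N" "N \<subseteq> W" "\<And>q. q \<in> N \<Longrightarrow> \<kappa> q = 1"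
    "\<And>q. q \<notin> W \<Longrightarrow> \<kappa> q = 0" "\<exists>C. compact C \<and> (\<forall>q. q \<notin> C \<longrightarrow> \<kappa> q = 0)"
proof -
  obtain U x where U: "(U, x) \<in> A" "p \<in> U" by (rule ex_chart)
  obtain b N C where b: "smooth_on UNIV b" "\<forall>e. b e \<ge> 0" "compact C" "C \<subseteq> x ` (U \<inter> W)"
    "\<forall>e. e \<notin> C \<longrightarrow> b e = 0" "open N" "p \<in> N" "N \<subseteq> U \<inter> W" "\<forall>q\<in>N. b (x q) = 1"
    "smooth_fun A (\<lambda>q. if q \<in> U then b (x q) else 0)" by (rule ex_bump[OF U W])
  let ?c = "\<lambda>q. if q \<in> U then b (x q) else 0"
  have out: "?c q = 0" if "q \<notin> chart_inv U x ` C" for q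
  proof (cases "q \<in> U")
    case True
    have "x q \<notin> C" using that chart_inv_chart[OF U(1) True] by (metis image_eqI)
    then show ?thesis using b(5) by simp
  qed simp
  have "compact (chart_inv U x ` C)"
    using b(3,4) chart_inv_cont[OF U(1)] by (intro compact_continuous_image) (auto intro: continuous_on_subset)
  moreover have "?c q = 0" if "q \<notin> W" for q
  proof (rule out, rule notI)
    assume "q \<in> chart_inv U x ` C"
    then obtain e where e: "e \<in> C" "q = chart_inv U x e" by blast
    then obtain q' where "q' \<in> U \<inter> W" "e = x q'" using b(4) by blast
    then show False using that e chart_inv_chart[OF U(1)] by auto
  qed
  moreover have "\<exists>C. compact C \<and> (\<forall>q. q \<notin> C \<longrightarrow> ?c q = 0)" using calculation(1) out by blast
  ultimately show ?thesis
    using b by (intro that[of ?c N]) auto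
qed

section \<open>Tangent vectors in coordinates\<close>

lemma
  assumes "v \<in> tangent A p"
  shows tangent_lin: "smooth_fun A f \<Longrightarrow> smooth_fun A g \<Longrightarrow> v (\<lambda>x. a * f x + b * g x) = a * v f + b * v g"
    and tangent_mult: "smooth_fun A f \<Longrightarrow> smooth_fun A g \<Longrightarrow> v (\<lambda>x. f x * g x) = f p * v g + g p * v f"
    and tangent_nonsmooth: "\<not> smooth_fun A f \<Longrightarrow> v f = 0"
  using assms unfolding tangent_def by auto

lemma tangent_const: assumes "v \<in> tangent A p" shows "v (\<lambda>x. c) = 0"
proof -
  have "v (\<lambda>x. 1 * 1) = 1 * v (\<lambda>x. 1) + 1 * v (\<lambda>x. 1)"
    by (rule tangent_mult[OF assms smooth_fun_const smooth_fun_const])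
  then have "v (\<lambda>x. 1) = 0" by simp
  then show ?thesis using tangent_lin[OF assms smooth_fun_const[of 1] smooth_fun_const[of 1], of c 0] by simp
qed

lemma tangent_add:
  "v \<in> tangent A p \<Longrightarrow> smooth_fun A f \<Longrightarrow> smooth_fun A g \<Longrightarrow> v (\<lambda>x. f x + g x) = v f + v g"
  using tangent_lin[of v p f g 1 1] by simp

lemma tangent_diff:
  "v \<in> tangent A p \<Longrightarrow> smooth_fun A f \<Longrightarrow> smooth_fun A g \<Longrightarrow> v (\<lambda>x. f x - g x) = v f - v g"
  using tangent_lin[of v p f g 1 "-1"] by simp

lemma tangent_sum:
  assumes "v \<in> tangent A p" "\<And>i. i \<in> I \<Longrightarrow> smooth_fun A (f i)"
  shows "v (\<lambda>x. \<Sum>i\<in>I. f i x) = (\<Sum>i\<in>I. v (f i))"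
  using assms(2)
  by (induction I rule: infinite_finite_induct)
    (simp_all add: tangent_const[OF assms(1)] tangent_add[OF assms(1)] smooth_fun_sum)

text \<open>The function \<open>f - g\<close> is not changed by the factor \<open>1 - \<kappa>\<close>, where \<open>\<kappa>\<close> is a bump function supported in
  \<open>N\<close>. Both factors vanish at \<open>p\<close>, so the derivation kills the product.\<close>

lemma tangent_local:
  assumes v: "v \<in> tangent A p" and f: "smooth_fun A f" "smooth_fun A g"
    and N: "open N" "p \<in> N" "\<And>q. q \<in> N \<Longrightarrow> f q = g q"
  shows "v f = v g"
proof -
  obtain \<kappa> N' where c: "smooth_fun A \<kappa>" "p \<in> N'" "\<And>q. q \<in> N' \<Longrightarrow> \<kappa> q = (1::real)" "\<And>q. q \<notin> N \<Longrightarrow> \<kappa> q = 0"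
    using ex_bump_fun[OF N(1,2)] by metis
  have eq: "(\<lambda>q. (f q - g q) * (1 - \<kappa> q)) = (\<lambda>q. f q - g q)"
    using N(3) c(4) by (auto simp: fun_eq_iff)
  have "v (\<lambda>q. (f q - g q) * (1 - \<kappa> q)) = (f p - g p) * v (\<lambda>q. 1 - \<kappa> q) + (1 - \<kappa> p) * v (\<lambda>q. f q - g q)"
    by (intro tangent_mult[OF v] smooth_fun_diff f smooth_fun_const c(1))
  also have "\<dots> = 0" using N(2,3) c(2,3) by simp
  finally show ?thesis using tangent_diff[OF v f] by (simp add: eq)
qed

text \<open>The derivative at \<open>p\<close> in the direction that has the coordinate vector \<open>\<xi>\<close> in the chart.\<close>

definition cvec :: "'m set \<Rightarrow> ('m \<Rightarrow> 'e) \<Rightarrow> 'm \<Rightarrow> 'e \<Rightarrow> 'm tvec" where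
  "cvec U x p \<xi> = (\<lambda>f. if smooth_fun A f then D (\<lambda>e. f (chart_inv U x e)) (x p) \<xi> else 0)"

lemma chart_has_derivative:
  assumes "(U, x) \<in> A" "p \<in> U" "smooth_fun A f"
  shows "((\<lambda>e. f (chart_inv U x e)) has_derivative D (\<lambda>e. f (chart_inv U x e)) (x p)) (at (x p))"
  using smooth_funD[OF assms(3,1)] by (rule smooth_on_has_derivative) (use assms in auto)

lemma cvec_tangent:
  assumes U: "(U, x) \<in> A" "p \<in> U"
  shows "cvec U x p \<xi> \<in> tangent A p"
  unfolding tangent_def
proof (intro CollectI conjI allI impI)
  fix f g a b assume f: "smooth_fun A f" and g: "smooth_fun A g"
  note df = chart_has_derivative[OF U f] and dg = chart_has_derivative[OF U g]
  have s: "smooth_fun A (\<lambda>x. a * f x + b * g x)"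
    by (intro smooth_fun_add smooth_fun_mult smooth_fun_const f g)
  have "D (\<lambda>e. a * f (chart_inv U x e) + b * g (chart_inv U x e)) (x p) =
      (\<lambda>\<xi>. a * D (\<lambda>e. f (chart_inv U x e)) (x p) \<xi> + b * D (\<lambda>e. g (chart_inv U x e)) (x p) \<xi>)"
    by (intro D_eq has_derivative_add has_derivative_mult_right df dg)
  then show "cvec U x p \<xi> (\<lambda>x. a * f x + b * g x) = a * cvec U x p \<xi> f + b * cvec U x p \<xi> g"
    using f g s by (simp add: cvec_def)
next
  fix f g assume f: "smooth_fun A f" and g: "smooth_fun A g"
  note df = chart_has_derivative[OF U f] and dg = chart_has_derivative[OF U g]
  have "D (\<lambda>e. f (chart_inv U x e) * g (chart_inv U x e)) (x p) =
      (\<lambda>\<xi>. f (chart_inv U x (x p)) * D (\<lambda>e. g (chart_inv U x e)) (x p) \<xi> +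
        D (\<lambda>e. f (chart_inv U x e)) (x p) \<xi> * g (chart_inv U x (x p)))"
    by (intro D_eq has_derivative_mult df dg)
  then show "cvec U x p \<xi> (\<lambda>x. f x * g x) = f p * cvec U x p \<xi> g + g p * cvec U x p \<xi> f"
    using f g smooth_fun_mult[OF f g] chart_inv_chart[OF U] by (simp add: cvec_def)
qed (simp add: cvec_def)

lemma cvec_lin:
  assumes U: "(U, x) \<in> A" "p \<in> U"
  shows "cvec U x p (a *\<^sub>R \<xi> + b *\<^sub>R \<eta>) = (\<lambda>f. a * cvec U x p \<xi> f + b * cvec U x p \<eta> f)"
proof
  fix f show "cvec U x p (a *\<^sub>R \<xi> + b *\<^sub>R \<eta>) f = a * cvec U x p \<xi> f + b * cvec U x p \<eta> f"
    using has_derivative_linear[OF chart_has_derivative[OF U]]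
    by (simp add: cvec_def linear_add linear_scale)
qed

text \<open>The function \<open>\<beta> b\<close> is the \<open>b\<close>-th coordinate centred at \<open>p\<close>, cut off away from \<open>p\<close>. Near \<open>p\<close>
  Hadamard's lemma writes \<open>f - f p\<close> as a sum of products \<open>\<beta> b * G b\<close>, so a derivation is determined by
  its values on the \<open>\<beta> b\<close>.\<close>

lemma ex_coordinates:
  assumes U: "(U, x) \<in> A" "p \<in> U"
  obtains \<beta> where "\<And>b. smooth_fun A (\<beta> b)" "\<And>\<xi> b. cvec U x p \<xi> (\<beta> b) = \<xi> \<bullet> b"
    "\<And>v f. v \<in> tangent A p \<Longrightarrow> smooth_fun A f \<Longrightarrow>
       v f = (\<Sum>b\<in>onb. D (\<lambda>e. f (chart_inv U x e)) (x p) b * v (\<beta> b))"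
proof -
  obtain c N C where c: "smooth_on UNIV c" "\<forall>e. c e \<ge> 0" "compact C" "C \<subseteq> x ` (U \<inter> UNIV)"
    "\<forall>e. e \<notin> C \<longrightarrow> c e = 0" "open N" "p \<in> N" "N \<subseteq> U \<inter> UNIV" "\<forall>q\<in>N. c (x q) = 1"
    "smooth_fun A (\<lambda>q. if q \<in> U then c (x q) else 0)"
    by (rule ex_bump[OF U open_UNIV UNIV_I])
  have C: "C \<subseteq> x ` U" using c(4) by simp
  have NU: "N \<subseteq> U" using c(8) by simp
  have oN: "open (x ` N)" by (rule chart_image_sub_open[OF U(1) c(6) NU])
  have cut: "smooth_fun A (\<lambda>q. if q \<in> U then c (x q) * h (x q) else 0)" if "smooth_on (x ` U) h" for h
    using that c(5)
    by (intro smooth_fun_of_chart[OF U(1) _ c(3) C] smooth_on_mult chart_image_open[OF U(1)]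
        smooth_on_subset[OF c(1)]) auto
  define \<beta> where "\<beta> b q = (if q \<in> U then c (x q) * ((x q + - x p) \<bullet> b) else 0)" for b q
  have s: "smooth_on UNIV (\<lambda>e. (e + - x p) \<bullet> b)" for b
    by (intro smooth_on_inner smooth_on_add smooth_on_id smooth_on_const open_UNIV)
  have \<beta>s: "smooth_fun A (\<beta> b)" for b
    unfolding \<beta>_def by (rule cut[of "\<lambda>e. (e + - x p) \<bullet> b"]) (rule smooth_on_subset[OF s], simp)
  have \<beta>p: "\<beta> b p = 0" for b using U(2) by (simp add: \<beta>_def)
  have d\<beta>: "cvec U x p \<xi> (\<beta> b) = \<xi> \<bullet> b" for \<xi> b
  proof -
    have "D (\<lambda>e. \<beta> b (chart_inv U x e)) (x p) = D (\<lambda>e. (e - x p) \<bullet> b) (x p)"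
      by (rule D_cong(1)[OF oN]) (use c(7,9) NU chart_inv_chart[OF U(1)] in \<open>auto simp: \<beta>_def subset_iff\<close>)
    also have "\<dots> = (\<lambda>\<xi>. \<xi> \<bullet> b)"
      by (rule D_eq) (auto intro!: derivative_eq_intros)
    finally show ?thesis by (simp add: cvec_def \<beta>s)
  qed
  have "v f = (\<Sum>b\<in>onb. D (\<lambda>e. f (chart_inv U x e)) (x p) b * v (\<beta> b))"
    if v: "v \<in> tangent A p" and f: "smooth_fun A f" for v f
  proof -
    define h where "h e = (if e \<in> x ` U then c e * f (chart_inv U x e) else 0)" for e
    have h: "smooth_on UNIV h"
    proof (rule smooth_on_local)
      fix e
      show "\<exists>V. open V \<and> e \<in> V \<and> smooth_on V h"
      proof (cases "e \<in> x ` U")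
        case True
        have "smooth_on (x ` U) h"
          by (subst smooth_on_cong[OF chart_image_open[OF U(1)], of _ "\<lambda>e. c e * f (chart_inv U x e)"])
            (auto simp: h_def intro!: smooth_on_mult chart_image_open[OF U(1)] smooth_funD[OF f U(1)]
              smooth_on_subset[OF c(1)])
        then show ?thesis using True chart_image_open[OF U(1)] by blast
      next
        case False
        have o: "open (- C)" using compact_imp_closed[OF c(3)] by blast
        have "smooth_on (- C) h"
          by (subst smooth_on_cong[OF o, of _ "\<lambda>_. 0"]) (auto simp: h_def c(5) smooth_on_const)
        then show ?thesis using False C o by blast
      qed
    qed
    obtain g where g: "\<And>b. smooth_on UNIV (g b)" "\<And>y. h y = h (x p) + (\<Sum>b\<in>onb. ((y - x p) \<bullet> b) * g b y)"
      "\<And>b. g b (x p) = D h (x p) b" using hadamard[OF h, of "x p"] by blast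
    define G where "G b q = (if q \<in> U then c (x q) * g b (x q) else 0)" for b q
    have Gs: "smooth_fun A (G b)" for b
      unfolding G_def by (rule cut) (rule smooth_on_subset[OF g(1)], simp)
    have hN: "h (x q) = f q" if "q \<in> N" for q
    proof -
      have "q \<in> U" using that NU by blast
      then show ?thesis using that c(9) by (simp add: h_def chart_inv_chart[OF U(1)])
    qed
    have "v f = v (\<lambda>q. f p + (\<Sum>b\<in>onb. \<beta> b q * G b q))"
    proof (rule tangent_local[OF v f _ c(6,7)])
      show "smooth_fun A (\<lambda>q. f p + (\<Sum>b\<in>onb. \<beta> b q * G b q))"
        by (intro smooth_fun_add smooth_fun_sum smooth_fun_mult smooth_fun_const \<beta>s Gs)
      fix q assume q: "q \<in> N"
      then show "f q = f p + (\<Sum>b\<in>onb. \<beta> b q * G b q)"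
        using g(2)[of "x q"] hN[OF q] hN[OF c(7)] NU c(9)[rule_format, OF q] by (auto simp: \<beta>_def G_def)
    qed
    also have "\<dots> = (\<Sum>b\<in>onb. \<beta> b p * v (G b) + G b p * v (\<beta> b))"
      by (simp add: tangent_add[OF v] tangent_const[OF v] tangent_sum[OF v] tangent_mult[OF v]
          smooth_fun_const smooth_fun_sum smooth_fun_mult \<beta>s Gs)
    also have "\<dots> = (\<Sum>b\<in>onb. D (\<lambda>e. f (chart_inv U x e)) (x p) b * v (\<beta> b))"
    proof (rule sum.cong[OF refl])
      fix b
      have "D h (x p) = D (\<lambda>e. f (chart_inv U x e)) (x p)"
        by (rule D_cong(1)[OF oN]) (use c(7) hN NU chart_inv_chart[OF U(1)] in \<open>auto simp: subset_iff\<close>)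
      then show "\<beta> b p * v (G b) + G b p * v (\<beta> b) = D (\<lambda>e. f (chart_inv U x e)) (x p) b * v (\<beta> b)"
        using U(2) c(7,9) g(3) by (simp add: \<beta>p G_def)
    qed
    finally show ?thesis .
  qed
  then show ?thesis using that \<beta>s d\<beta> by blast
qed

lemma tangent_eq_cvec:
  assumes U: "(U, x) \<in> A" "p \<in> U" and v: "v \<in> tangent A p"
  obtains \<xi> where "v = cvec U x p \<xi>"
proof -
  obtain \<beta> where \<beta>: "\<And>f. smooth_fun A f \<Longrightarrow> v f = (\<Sum>b\<in>onb. D (\<lambda>e. f (chart_inv U x e)) (x p) b * v (\<beta> b))"
    using ex_coordinates[OF U] v by metis
  have "v = cvec U x p (\<Sum>b\<in>onb. v (\<beta> b) *\<^sub>R b)"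
  proof
    fix f show "v f = cvec U x p (\<Sum>b\<in>onb. v (\<beta> b) *\<^sub>R b) f"
    proof (cases "smooth_fun A f")
      case True
      have "linear (D (\<lambda>e. f (chart_inv U x e)) (x p))"
        by (rule has_derivative_linear[OF chart_has_derivative[OF U True]])
      then show ?thesis using True \<beta>[OF True] by (simp add: cvec_def linear_sum linear_scale mult.commute)
    qed (simp add: cvec_def tangent_nonsmooth[OF v])
  qed
  then show ?thesis using that by blast
qed

lemma cvec_inj:
  assumes U: "(U, x) \<in> A" "p \<in> U" and eq: "cvec U x p \<xi> = cvec U x p \<eta>"
  shows "\<xi> = \<eta>"
proof -
  obtain \<beta> where "\<And>\<xi> b. cvec U x p \<xi> (\<beta> b) = \<xi> \<bullet> b" using ex_coordinates[OF U] by metis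
  then have "\<xi> \<bullet> b = \<eta> \<bullet> b" for b using eq by metis
  then show ?thesis using vector_eq_rdot by blast
qed

lemma cvec_0: "(U, x) \<in> A \<Longrightarrow> p \<in> U \<Longrightarrow> cvec U x p 0 = (\<lambda>f. 0)"
  using cvec_lin[of U x p 0 0 0 0] by simp

lemma zero_tangent: "(\<lambda>f. 0) \<in> tangent A p"
proof -
  obtain U x where "(U, x) \<in> A" "p \<in> U" by (rule ex_chart)
  then show ?thesis using cvec_tangent[of U x p 0] cvec_0[of U x p] by simp
qed

lemma tangent_lincomb:
  assumes "u \<in> tangent A p" "v \<in> tangent A p"
  shows "(\<lambda>f. a * u f + b * v f) \<in> tangent A p"
proof -
  obtain U x where U: "(U, x) \<in> A" "p \<in> U" by (rule ex_chart)
  obtain \<xi> \<eta> where "u = cvec U x p \<xi>" "v = cvec U x p \<eta>"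
    using tangent_eq_cvec[OF U] assms by metis
  then show ?thesis using cvec_lin[OF U, of a \<xi> b \<eta>] cvec_tangent[OF U] by metis
qed

end

section \<open>Products and smooth maps\<close>

lemma smooth_map_comp:
  fixes A :: "('m::t2_space, 'e::{real_inner,heine_borel}) chart set"
    and B :: "('n::t2_space, 'f::{real_inner,heine_borel}) chart set"
  assumes "smooth_atlas A" "smooth_atlas B" and F: "smooth_map A B F" and h: "smooth_fun B h"
  shows "smooth_fun A (\<lambda>p. h (F p))"
proof -
  interpret A: manifold A by unfold_locales fact
  interpret B: manifold B by unfold_locales fact
  show ?thesis
  proof (rule A.smooth_funI)
    fix p
    obtain U x where U: "(U, x) \<in> A" "p \<in> U" by (rule A.ex_chart)
    obtain V y where V: "(V, y) \<in> B" "F p \<in> V" by (rule B.ex_chart)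
    let ?N = "U \<inter> F -` V"
    have c: "continuous_on UNIV F" and s: "smooth_on (x ` ?N) (\<lambda>e. y (F (chart_inv U x e)))"
      using F U(1) V(1) unfolding smooth_map_def by (auto simp: o_def)
    have N: "open ?N"
      using open_vimage[OF B.chart_open[OF V(1)] c] A.chart_open[OF U(1)] by blast
    have o: "open (x ` ?N)" by (rule A.chart_image_sub_open[OF U(1) N]) auto
    have "smooth_on (x ` ?N) (\<lambda>e. h (chart_inv V y (y (F (chart_inv U x e)))))"
      by (rule smooth_on_compose[OF o B.chart_image_open[OF V(1)] _ s B.smooth_funD[OF h V(1)]])
        (auto simp: A.chart_inv_chart[OF U(1)])
    then have "smooth_on (x ` ?N) (\<lambda>e. h (F (chart_inv U x e)))"
      by (subst smooth_on_cong[OF o, of _ "\<lambda>e. h (chart_inv V y (y (F (chart_inv U x e))))"])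
        (auto simp: A.chart_inv_chart[OF U(1)] B.chart_inv_chart[OF V(1)])
    then show "\<exists>U x N. (U, x) \<in> A \<and> open N \<and> p \<in> N \<and> N \<subseteq> U \<and> smooth_on (x ` N) (\<lambda>e. h (F (chart_inv U x e)))"
      using U V N by (intro exI[of _ U] exI[of _ x] exI[of _ ?N]) auto
  qed
qed

locale two_manifolds = A: manifold A + B: manifold B
  for A :: "('m::t2_space, 'e::{real_inner,heine_borel}) chart set"
    and B :: "('n::t2_space, 'f::{real_inner,heine_borel}) chart set"
begin

lemma prod_chart: "(U, x) \<in> A \<Longrightarrow> (V, y) \<in> B \<Longrightarrow> (U \<times> V, map_prod x y) \<in> prod_atlas A B"
  unfolding prod_atlas_def by blast

lemma prod_chart_inv:
  assumes "(U, x) \<in> A" "(V, y) \<in> B" "a \<in> x ` U" "b \<in> y ` V"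
  shows "chart_inv (U \<times> V) (map_prod x y) (a, b) = (chart_inv U x a, chart_inv V y b)"
proof (rule inv_into_f_eq)
  show "inj_on (map_prod x y) (U \<times> V)"
    using A.chart_inv_chart[OF assms(1)] B.chart_inv_chart[OF assms(2)]
    by (auto intro!: inj_onI) (metis, metis)
qed (use assms A.chart_chart_inv[OF assms(1)] B.chart_chart_inv[OF assms(2)]
    A.chart_inv_in[OF assms(1)] B.chart_inv_in[OF assms(2)] in auto)

lemma smooth_on_prod_map:
  assumes "open S" "open T" "smooth_on S f" "smooth_on T g"
  shows "smooth_on (S \<times> T) (\<lambda>e::'e \<times> 'f. (f (fst e), g (snd e)))"
proof -
  have o: "open (S \<times> T)" using assms by (simp add: open_Times)
  have "smooth_on (S \<times> T) (\<lambda>e. f (fst e))"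
    by (rule smooth_on_compose[OF o assms(1) _ _ assms(3)])
      (auto intro!: smooth_on_bounded_linear bounded_linear_fst o)
  moreover have "smooth_on (S \<times> T) (\<lambda>e. g (snd e))"
    by (rule smooth_on_compose[OF o assms(2) _ _ assms(4)])
      (auto intro!: smooth_on_bounded_linear bounded_linear_snd o)
  ultimately show ?thesis by (rule smooth_on_Pair[OF o])
qed

lemma prod_atlas_smooth: "smooth_atlas (prod_atlas A B)"
  unfolding smooth_atlas_def
proof (intro conjI ballI)
  fix c assume "c \<in> prod_atlas A B"
  then obtain U x V y where c: "c = (U \<times> V, map_prod x y)" "(U, x) \<in> A" "(V, y) \<in> B"
    unfolding prod_atlas_def by blast
  note i = prod_chart_inv[OF c(2,3)]
  have im: "map_prod x y ` (U \<times> V) = x ` U \<times> y ` V" by (auto simp: image_iff)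
  have "continuous_on (U \<times> V) (\<lambda>p. (x (fst p), y (snd p)))"
    by (intro continuous_on_Pair continuous_on_compose2[OF A.chart_cont[OF c(2)] continuous_on_fst[OF continuous_on_id]]
        continuous_on_compose2[OF B.chart_cont[OF c(3)] continuous_on_snd[OF continuous_on_id]]) auto
  then have c1: "continuous_on (U \<times> V) (map_prod x y)"
    by (simp add: map_prod_def case_prod_unfold)
  have "continuous_on (x ` U \<times> y ` V) (\<lambda>p. (chart_inv U x (fst p), chart_inv V y (snd p)))"
    by (intro continuous_on_Pair continuous_on_compose2[OF A.chart_inv_cont[OF c(2)] continuous_on_fst[OF continuous_on_id]]
        continuous_on_compose2[OF B.chart_inv_cont[OF c(3)] continuous_on_snd[OF continuous_on_id]]) auto
  then have c2: "continuous_on (x ` U \<times> y ` V) (chart_inv (U \<times> V) (map_prod x y))"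
    by (rule continuous_on_eq) (auto simp: i)
  have "homeomorphism (U \<times> V) (x ` U \<times> y ` V) (map_prod x y) (chart_inv (U \<times> V) (map_prod x y))"
  proof (rule homeomorphismI[OF c1 c2])
    show "map_prod x y ` (U \<times> V) \<subseteq> x ` U \<times> y ` V" using im by simp
    show "chart_inv (U \<times> V) (map_prod x y) ` (x ` U \<times> y ` V) \<subseteq> U \<times> V"
      using im inv_into_into[of _ "map_prod x y" "U \<times> V"] by blast
    show "chart_inv (U \<times> V) (map_prod x y) (map_prod x y p) = p" if "p \<in> U \<times> V" for p
      using that i A.chart_inv_chart[OF c(2)] B.chart_inv_chart[OF c(3)] by auto
    show "map_prod x y (chart_inv (U \<times> V) (map_prod x y) e) = e" if "e \<in> x ` U \<times> y ` V" for e
      using that im f_inv_into_f[of e "map_prod x y" "U \<times> V"] by simp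
  qed
  then show "case c of (W, w) \<Rightarrow> open W \<and> open (w ` W) \<and> homeomorphism W (w ` W) w (chart_inv W w)"
    unfolding c(1) using im A.chart_open[OF c(2)] B.chart_open[OF c(3)]
      A.chart_image_open[OF c(2)] B.chart_image_open[OF c(3)] by (simp add: open_Times)
  have "case c' of (W', w') \<Rightarrow> smooth_on (map_prod x y ` (U \<times> V \<inter> W')) (w' \<circ> chart_inv (U \<times> V) (map_prod x y))"
    if c'A: "c' \<in> prod_atlas A B" for c'
  proof -
  from c'A obtain U' x' V' y' where c': "c' = (U' \<times> V', map_prod x' y')" "(U', x') \<in> A" "(V', y') \<in> B"
    unfolding prod_atlas_def by blast
  let ?S = "x ` (U \<inter> U')" and ?T = "y ` (V \<inter> V')"
  have im': "map_prod x y ` ((U \<times> V) \<inter> (U' \<times> V')) = ?S \<times> ?T" by (auto simp: image_iff)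
  have oS: "open ?S" using A.chart_image_sub_open[OF c(2)] A.chart_open[OF c(2)] A.chart_open[OF c'(2)] by blast
  have oT: "open ?T" using B.chart_image_sub_open[OF c(3)] B.chart_open[OF c(3)] B.chart_open[OF c'(3)] by blast
  have "smooth_on (?S \<times> ?T) (\<lambda>e. (x' (chart_inv U x (fst e)), y' (chart_inv V y (snd e))))"
    by (rule smooth_on_prod_map[OF oS oT A.chart_change[OF c(2) c'(2)] B.chart_change[OF c(3) c'(3)]])
  then have "smooth_on (?S \<times> ?T) (\<lambda>e. map_prod x' y' (chart_inv (U \<times> V) (map_prod x y) e))"
    by (rule iffD1[OF smooth_on_cong[OF open_Times[OF oS oT]], rotated]) (auto simp: i)
  then show ?thesis unfolding c'(1) using im' by (simp add: o_def)
  qed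
  then show "case c of (W, w) \<Rightarrow> \<forall>(W', w')\<in>prod_atlas A B. smooth_on (w ` (W \<inter> W')) (w' \<circ> chart_inv W w)"
    unfolding c(1) by simp
next
  have "(p, q) \<in> (\<Union>(W, w)\<in>prod_atlas A B. W)" for p q
  proof -
    obtain U x where U: "(U, x) \<in> A" "p \<in> U" by (rule A.ex_chart)
    obtain V y where V: "(V, y) \<in> B" "q \<in> V" by (rule B.ex_chart)
    show ?thesis by (rule UN_I[OF prod_chart[OF U(1) V(1)]]) (use U V in simp)
  qed
  then show "(\<Union>(W, w)\<in>prod_atlas A B. W) = UNIV" by auto
qed

sublocale prod: manifold "prod_atlas A B" by unfold_locales (rule prod_atlas_smooth)

lemma smooth_fun_prod_coords:
  assumes f: "smooth_fun (prod_atlas A B) f" and U: "(U, x) \<in> A" and V: "(V, y) \<in> B"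
  shows "smooth_on (x ` U \<times> y ` V) (\<lambda>e. f (chart_inv U x (fst e), chart_inv V y (snd e)))"
proof -
  have o: "open (x ` U \<times> y ` V)" using A.chart_image_open[OF U] B.chart_image_open[OF V] by (rule open_Times)
  have "map_prod x y ` (U \<times> V) = x ` U \<times> y ` V" by (auto simp: image_iff)
  then have "smooth_on (x ` U \<times> y ` V) (\<lambda>e. f (chart_inv (U \<times> V) (map_prod x y) e))"
    using prod.smooth_funD[OF f prod_chart[OF U V]] by simp
  then show ?thesis
    by (rule iffD1[OF smooth_on_cong[OF o], rotated]) (auto simp: prod_chart_inv[OF U V])
qed

lemma smooth_fun_prodI:
  assumes "\<And>p q. \<exists>U x V y S T. (U, x) \<in> A \<and> (V, y) \<in> B \<and> open S \<and> open T \<and> p \<in> S \<and> q \<in> T \<and> S \<subseteq> U \<and> T \<subseteq> V \<and>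
      smooth_on (x ` S \<times> y ` T) (\<lambda>e. f (chart_inv U x (fst e), chart_inv V y (snd e)))"
  shows "smooth_fun (prod_atlas A B) f"
proof (rule prod.smooth_funI)
  fix pq :: "'m \<times> 'n"
  obtain U x V y S T where c: "(U, x) \<in> A" "(V, y) \<in> B" "open S" "open T" "fst pq \<in> S" "snd pq \<in> T" "S \<subseteq> U" "T \<subseteq> V"
    and s: "smooth_on (x ` S \<times> y ` T) (\<lambda>e. f (chart_inv U x (fst e), chart_inv V y (snd e)))"
    using assms[of "fst pq" "snd pq"] by blast
  have o: "open (x ` S \<times> y ` T)"
    by (intro open_Times A.chart_image_sub_open[OF c(1)] B.chart_image_sub_open[OF c(2)] c)
  have im: "map_prod x y ` (S \<times> T) = x ` S \<times> y ` T" by (auto simp: image_iff)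
  have "smooth_on (x ` S \<times> y ` T) (\<lambda>e. f (chart_inv (U \<times> V) (map_prod x y) e))"
  proof (rule iffD1[OF smooth_on_cong[OF o] s])
    fix e assume "e \<in> x ` S \<times> y ` T"
    then have "fst e \<in> x ` U" "snd e \<in> y ` V" using c(7,8) by auto
    from prod_chart_inv[OF c(1,2) this]
    show "f (chart_inv U x (fst e), chart_inv V y (snd e)) = f (chart_inv (U \<times> V) (map_prod x y) e)" by simp
  qed
  then show "\<exists>W w N. (W, w) \<in> prod_atlas A B \<and> open N \<and> pq \<in> N \<and> N \<subseteq> W \<and> smooth_on (w ` N) (\<lambda>e. f (chart_inv W w e))"
    using c prod_chart[OF c(1,2)] im
    by (intro exI[of _ "U \<times> V"] exI[of _ "map_prod x y"] exI[of _ "S \<times> T"]) (auto simp: open_Times mem_Times_iff)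
qed

lemma smooth_fun_fst:
  assumes "smooth_fun A f" shows "smooth_fun (prod_atlas A B) (\<lambda>pq. f (fst pq))"
proof (rule smooth_fun_prodI)
  fix p q
  obtain U x where U: "(U, x) \<in> A" "p \<in> U" by (rule A.ex_chart)
  obtain V y where V: "(V, y) \<in> B" "q \<in> V" by (rule B.ex_chart)
  note o = A.chart_image_open[OF U(1)] B.chart_image_open[OF V(1)]
  have "smooth_on (x ` U \<times> y ` V) (\<lambda>e. f (chart_inv U x (fst e)))"
    by (rule smooth_on_compose[OF open_Times[OF o] o(1) _ _ A.smooth_funD[OF assms U(1)]])
      (auto intro!: smooth_on_bounded_linear bounded_linear_fst open_Times o)
  then show "\<exists>U x V y S T. (U, x) \<in> A \<and> (V, y) \<in> B \<and> open S \<and> open T \<and> p \<in> S \<and> q \<in> T \<and> S \<subseteq> U \<and> T \<subseteq> V \<and>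
      smooth_on (x ` S \<times> y ` T) (\<lambda>e. f (fst (chart_inv U x (fst e), chart_inv V y (snd e))))"
    using U V A.chart_open[OF U(1)] B.chart_open[OF V(1)]
    by (intro exI[of _ U] exI[of _ x] exI[of _ V] exI[of _ y]) auto
qed

lemma smooth_fun_slice1:
  assumes "smooth_fun (prod_atlas A B) f" shows "smooth_fun A (\<lambda>p. f (p, q))"
proof (rule A.smooth_funI)
  fix p
  obtain U x where U: "(U, x) \<in> A" "p \<in> U" by (rule A.ex_chart)
  obtain V y where V: "(V, y) \<in> B" "q \<in> V" by (rule B.ex_chart)
  note o = A.chart_image_open[OF U(1)] B.chart_image_open[OF V(1)]
  have "smooth_on (x ` U) (\<lambda>e. (\<lambda>e. f (chart_inv U x (fst e), chart_inv V y (snd e))) (e, y q))"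
    by (rule smooth_on_compose[OF o(1) open_Times[OF o] _ _ smooth_fun_prod_coords[OF assms U(1) V(1)]])
      (use V in \<open>auto intro!: smooth_on_Pair smooth_on_id smooth_on_const o\<close>)
  then show "\<exists>U x N. (U, x) \<in> A \<and> open N \<and> p \<in> N \<and> N \<subseteq> U \<and> smooth_on (x ` N) (\<lambda>e. f (chart_inv U x e, q))"
    using U A.chart_open[OF U(1)] B.chart_inv_chart[OF V] by auto
qed

lemma smooth_fun_slice2:
  assumes "smooth_fun (prod_atlas A B) f" shows "smooth_fun B (\<lambda>q. f (p, q))"
proof (rule B.smooth_funI)
  fix q
  obtain U x where U: "(U, x) \<in> A" "p \<in> U" by (rule A.ex_chart)
  obtain V y where V: "(V, y) \<in> B" "q \<in> V" by (rule B.ex_chart)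
  note o = A.chart_image_open[OF U(1)] B.chart_image_open[OF V(1)]
  have "smooth_on (y ` V) (\<lambda>e. (\<lambda>e. f (chart_inv U x (fst e), chart_inv V y (snd e))) (x p, e))"
    by (rule smooth_on_compose[OF o(2) open_Times[OF o] _ _ smooth_fun_prod_coords[OF assms U(1) V(1)]])
      (use U in \<open>auto intro!: smooth_on_Pair smooth_on_id smooth_on_const o\<close>)
  then show "\<exists>V y N. (V, y) \<in> B \<and> open N \<and> q \<in> N \<and> N \<subseteq> V \<and> smooth_on (y ` N) (\<lambda>e. f (p, chart_inv V y e))"
    using V B.chart_open[OF V(1)] A.chart_inv_chart[OF U] by auto
qed

lemma prod_chart_has_derivative:
  assumes f: "smooth_fun (prod_atlas A B) f" and U: "(U, x) \<in> A" "p \<in> U" and V: "(V, y) \<in> B" "q \<in> V"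
  shows "((\<lambda>e. f (chart_inv U x (fst e), chart_inv V y (snd e))) has_derivative
    (\<lambda>\<xi>. D (\<lambda>e. f (chart_inv U x e, q)) (x p) (fst \<xi>) + D (\<lambda>e. f (p, chart_inv V y e)) (y q) (snd \<xi>))) (at (x p, y q))"
proof -
  let ?h = "\<lambda>e. f (chart_inv U x (fst e), chart_inv V y (snd e))"
  have d: "(?h has_derivative D ?h (x p, y q)) (at (x p, y q))"
    using U V by (intro smooth_on_has_derivative[OF smooth_fun_prod_coords[OF f U(1) V(1)]]) auto
  have "((\<lambda>e. (e, y q)) has_derivative (\<lambda>\<xi>. (\<xi>, 0))) (at (x p))"
    by (intro has_derivative_Pair has_derivative_ident has_derivative_const)
  from has_derivative_compose[OF this d]
  have 1: "D (\<lambda>e. f (chart_inv U x e, q)) (x p) = (\<lambda>\<xi>. D ?h (x p, y q) (\<xi>, 0))"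
    using B.chart_inv_chart[OF V] by (simp add: D_eq)
  have "((\<lambda>e. (x p, e)) has_derivative (\<lambda>\<xi>. (0, \<xi>))) (at (y q))"
    by (intro has_derivative_Pair has_derivative_ident has_derivative_const)
  from has_derivative_compose[OF this d]
  have 2: "D (\<lambda>e. f (p, chart_inv V y e)) (y q) = (\<lambda>\<xi>. D ?h (x p, y q) (0, \<xi>))"
    using A.chart_inv_chart[OF U] by (simp add: D_eq)
  have "D ?h (x p, y q) \<xi> = D ?h (x p, y q) (fst \<xi>, 0) + D ?h (x p, y q) (0, snd \<xi>)" for \<xi>
    using linear_add[OF has_derivative_linear[OF d], of "(fst \<xi>, 0)" "(0, snd \<xi>)"] by simp
  then have "D ?h (x p, y q) = (\<lambda>\<xi>. D (\<lambda>e. f (chart_inv U x e, q)) (x p) (fst \<xi>) + D (\<lambda>e. f (p, chart_inv V y e)) (y q) (snd \<xi>))"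
    unfolding 1 2 by blast
  then show ?thesis using d by simp
qed

text \<open>A tangent vector of the product is the sum of one along each factor.\<close>

lemma cvec_prod:
  assumes f: "smooth_fun (prod_atlas A B) f" and U: "(U, x) \<in> A" "p \<in> U" and V: "(V, y) \<in> B" "q \<in> V"
  shows "prod.cvec (U \<times> V) (map_prod x y) (p, q) (\<xi>, \<zeta>) f =
    A.cvec U x p \<xi> (\<lambda>p. f (p, q)) + B.cvec V y q \<zeta> (\<lambda>q. f (p, q))"
proof -
  have "open (x ` U \<times> y ` V)" using A.chart_image_open[OF U(1)] B.chart_image_open[OF V(1)] by (rule open_Times)
  then have "D (\<lambda>e. f (chart_inv (U \<times> V) (map_prod x y) e)) (x p, y q) =
      D (\<lambda>e. f (chart_inv U x (fst e), chart_inv V y (snd e))) (x p, y q)"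
    by (rule D_cong(1)) (use U V prod_chart_inv[OF U(1) V(1)] in auto)
  then show ?thesis
    using f smooth_fun_slice1[OF f] smooth_fun_slice2[OF f]
    by (simp add: prod.cvec_def A.cvec_def B.cvec_def D_eq[OF prod_chart_has_derivative[OF f U V]])
qed

text \<open>This makes differentiation under a functional available for functions on a product of manifolds,
  with the first factor as parameter space and coordinates only in the second.\<close>

lemma par_Ck_of_smooth_fun:
  assumes f: "smooth_fun (prod_atlas A B) f" and V: "(V, y) \<in> B"
  shows "par_Ck n UNIV (y ` V) (\<lambda>p e. f (p, chart_inv V y e))"
proof (rule par_Ck_local[OF _ B.chart_image_open[OF V]])
  fix p
  obtain U x where U: "(U, x) \<in> A" "p \<in> U" by (rule A.ex_chart)
  have "par_Ck n U (y ` V) (\<lambda>s e. (\<lambda>e. f (chart_inv U x (fst e), chart_inv V y (snd e))) (x s, e))"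
    by (rule par_Ck_of_joint[OF A.chart_image_open[OF U(1)] B.chart_image_open[OF V] A.chart_cont[OF U(1)]
        subset_refl smooth_fun_prod_coords[OF f U(1) V]])
  then have "par_Ck n U (y ` V) (\<lambda>p e. f (p, chart_inv V y e))"
    by (rule iffD1[OF par_Ck_cong[OF B.chart_image_open[OF V]], rotated]) (simp add: A.chart_inv_chart[OF U(1)])
  then show "\<exists>S. open S \<and> p \<in> S \<and> par_Ck n S (y ` V) (\<lambda>p e. f (p, chart_inv V y e))"
    using U A.chart_open[OF U(1)] by blast
qed

end

lemma manifold_std: "manifold (std_atlas :: ('e::{real_inner,heine_borel}, 'e) chart set)"
  by unfold_locales (auto simp: smooth_atlas_def std_atlas_def o_def homeomorphism_def
      inv_into_def[abs_def] intro!: smooth_on_id)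

lemma smooth_fun_std: "smooth_fun std_atlas f \<longleftrightarrow> smooth_on UNIV f"
  by (simp add: smooth_fun_def std_atlas_def inv_id o_def)

section \<open>Hamiltonian vector fields and Poisson brackets\<close>

text \<open>The limit operator \<open>J0\<close> is bounded below, as it has a linear left inverse. Applying it to \<open>\<xi> - \<xi>0\<close>
  and using the equations for \<open>\<xi>\<close> and \<open>\<xi>0\<close> bounds \<open>|\<xi> - \<xi>0|\<close> by a small multiple of itself plus
  terms tending to 0.\<close>

lemma tendsto_linear_solution:
  fixes J :: "'y \<Rightarrow> 'e::{real_inner,heine_borel} \<Rightarrow> 'e"
  assumes lin: "\<forall>\<^sub>F y in F. linear (J y)" and J: "\<And>b. b \<in> onb \<Longrightarrow> ((\<lambda>y. J y b) \<longlongrightarrow> J0 b) F"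
    and r: "(r \<longlongrightarrow> r0) F" and eq: "\<forall>\<^sub>F y in F. J y (\<xi> y) = r y"
    and lin0: "linear J0" and inj0: "inj J0" and eq0: "J0 \<xi>0 = r0"
  shows "(\<xi> \<longlongrightarrow> \<xi>0) F"
proof -
  obtain g where g: "linear g" "g \<circ> J0 = id"
    using linear_injective_left_inverse[OF lin0 inj0] by blast
  obtain B where B: "B > 0" "\<And>v. norm (g v) \<le> norm v * B"
    using bounded_linear.pos_bounded[OF linear_imp_bounded_linear[OF g(1)]] by blast
  have low: "norm v \<le> norm (J0 v) * B" for v using B(2)[of "J0 v"] g(2) by (metis comp_apply id_apply)
  define d where "d y = (\<Sum>b\<in>onb. norm (J0 b - J y b))" for y
  have d0: "(d \<longlongrightarrow> 0) F"
  proof -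
    have "(d \<longlongrightarrow> (\<Sum>b\<in>onb. norm (J0 b - J0 b))) F"
      unfolding d_def by (intro tendsto_sum tendsto_norm tendsto_diff tendsto_const J)
    then show ?thesis by simp
  qed
  have ev: "\<forall>\<^sub>F y in F. d y < 1 / (2 * B)" using order_tendstoD(2)[OF d0, of "1 / (2 * B)"] B(1) by simp
  have "\<forall>\<^sub>F y in F. norm (\<xi> y - \<xi>0) \<le> 2 * B * (d y * norm \<xi>0 + norm (r y - r0))"
    using lin eq ev
  proof eventually_elim
    case (elim y)
    have "J0 (\<xi> y - \<xi>0) = (J0 (\<xi> y) - J y (\<xi> y)) + (r y - r0)"
      using elim(2) eq0 by (simp add: linear_diff[OF lin0])
    moreover have "norm (J0 (\<xi> y) - J y (\<xi> y)) \<le> norm (\<xi> y) * d y"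
      unfolding d_def using norm_linear_le_onb[OF linear_compose_sub[OF lin0 elim(1)], of "\<xi> y"] by simp
    ultimately have "norm (J0 (\<xi> y - \<xi>0)) \<le> norm (\<xi> y) * d y + norm (r y - r0)"
      using norm_triangle_le by (metis add_right_mono)
    then have 1: "norm (\<xi> y - \<xi>0) \<le> (norm (\<xi> y) * d y + norm (r y - r0)) * B"
      using low[of "\<xi> y - \<xi>0"] B(1) by (meson less_imp_le mult_right_mono order_trans)
    have dn: "d y \<ge> 0" unfolding d_def by (intro sum_nonneg) simp
    have "norm (\<xi> y) * d y \<le> (norm \<xi>0 + norm (\<xi> y - \<xi>0)) * d y"
      using norm_triangle_sub[of "\<xi> y" \<xi>0] dn by (intro mult_right_mono) auto
    then have "(norm (\<xi> y) * d y + norm (r y - r0)) * B \<le>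
        ((norm \<xi>0 + norm (\<xi> y - \<xi>0)) * d y + norm (r y - r0)) * B"
      using B(1) by (intro mult_right_mono) auto
    with 1 have 2: "norm (\<xi> y - \<xi>0) \<le> B * (norm \<xi>0 * d y + norm (r y - r0)) + (d y * B) * norm (\<xi> y - \<xi>0)"
      by (simp add: algebra_simps)
    have "d y * B \<le> 1 / 2" using elim(3) B(1) by (simp add: field_simps)
    then have "(d y * B) * norm (\<xi> y - \<xi>0) \<le> 1 / 2 * norm (\<xi> y - \<xi>0)" by (intro mult_right_mono) auto
    with 2 show ?case by (simp add: algebra_simps)
  qed
  moreover have "((\<lambda>y. 2 * B * (d y * norm \<xi>0 + norm (r y - r0))) \<longlongrightarrow> 0) F"
  proof -
    have "((\<lambda>y. 2 * B * (d y * norm \<xi>0 + norm (r y - r0))) \<longlongrightarrow> 2 * B * (0 * norm \<xi>0 + norm (r0 - r0))) F"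
      by (intro tendsto_intros d0 r)
    then show ?thesis by simp
  qed
  ultimately have "((\<lambda>y. \<xi> y - \<xi>0) \<longlongrightarrow> 0) F" by (rule Lim_null_comparison)
  then show ?thesis by (simp add: LIM_zero_iff)
qed

locale symplectic = manifold A
  for A :: "('m::t2_space, 'e::{real_inner,heine_borel}) chart set" +
  fixes \<omega> :: "'m form2"
  assumes symplectic: "symplectic_manifold A \<omega>"
begin

lemma
  shows form_lin1: "\<And>p u v w a b. u \<in> tangent A p \<Longrightarrow> v \<in> tangent A p \<Longrightarrow> w \<in> tangent A p \<Longrightarrow>
      \<omega> p (\<lambda>f. a * u f + b * v f) w = a * \<omega> p u w + b * \<omega> p v w"
    and form_antisym: "\<And>p u v. u \<in> tangent A p \<Longrightarrow> v \<in> tangent A p \<Longrightarrow> \<omega> p u v = - \<omega> p v u"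
    and form_smooth: "\<And>X Y. vector_field A X \<Longrightarrow> vector_field A Y \<Longrightarrow> smooth_fun A (\<lambda>p. \<omega> p (X p) (Y p))"
    and form_nondeg: "\<And>p u. u \<in> tangent A p \<Longrightarrow> (\<And>v. v \<in> tangent A p \<Longrightarrow> \<omega> p u v = 0) \<Longrightarrow> u = (\<lambda>f. 0)"
proof -
  have tf: "two_form A \<omega>" using symplectic by (simp add: symplectic_manifold_def)
  show "\<omega> p (\<lambda>f. a * u f + b * v f) w = a * \<omega> p u w + b * \<omega> p v w"
    if "u \<in> tangent A p" "v \<in> tangent A p" "w \<in> tangent A p" for p u v w a b
  proof -
    have "\<forall>p. \<forall>u\<in>tangent A p. \<forall>v\<in>tangent A p. \<forall>w\<in>tangent A p. \<forall>a b.
        \<omega> p (\<lambda>f. a * u f + b * v f) w = a * \<omega> p u w + b * \<omega> p v w"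
      using tf unfolding two_form_def by (elim conjE)
    then show ?thesis using that by simp
  qed
  show "\<omega> p u v = - \<omega> p v u" if "u \<in> tangent A p" "v \<in> tangent A p" for p u v
  proof -
    have "\<forall>p. \<forall>u\<in>tangent A p. \<forall>v\<in>tangent A p. \<omega> p u v = - \<omega> p v u"
      using tf unfolding two_form_def by (elim conjE)
    then show ?thesis using that by blast
  qed
  show "smooth_fun A (\<lambda>p. \<omega> p (X p) (Y p))" if "vector_field A X" "vector_field A Y" for X Y
    using tf that unfolding two_form_def by (elim conjE) blast
  show "u = (\<lambda>f. 0)" if "u \<in> tangent A p" "\<And>v. v \<in> tangent A p \<Longrightarrow> \<omega> p u v = 0" for p u
    using symplectic that unfolding symplectic_manifold_def by (elim conjE) blast
qed

lemma form_lin2: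
  assumes "u \<in> tangent A p" "v \<in> tangent A p" "w \<in> tangent A p"
  shows "\<omega> p w (\<lambda>f. a * u f + b * v f) = a * \<omega> p w u + b * \<omega> p w v"
  using form_lin1[OF assms] form_antisym[OF assms(3) tangent_lincomb[OF assms(1,2)]]
    form_antisym[OF assms(3,1)] form_antisym[OF assms(3,2)] by simp

text \<open>The endomorphism of the model space that represents \<open>\<omega>\<close> at \<open>p\<close> with respect to the inner product.
  Existence, uniqueness and continuity of Hamiltonian vector fields become statements about the linear
  equation \<open>Jc U x p \<xi> = \<nabla>f\<close>.\<close>

definition Jc :: "'m set \<Rightarrow> ('m \<Rightarrow> 'e) \<Rightarrow> 'm \<Rightarrow> 'e \<Rightarrow> 'e" where
  "Jc U x p \<xi> = (\<Sum>b\<in>onb. \<omega> p (cvec U x p \<xi>) (cvec U x p b) *\<^sub>R b)"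

lemma Jc_inner:
  assumes "b \<in> onb" shows "Jc U x p \<xi> \<bullet> b = \<omega> p (cvec U x p \<xi>) (cvec U x p b)"
proof -
  have "Jc U x p \<xi> \<bullet> b = (\<Sum>a\<in>onb. if a = b then \<omega> p (cvec U x p \<xi>) (cvec U x p b) else 0)"
    unfolding Jc_def inner_sum_left using assms by (intro sum.cong) (auto simp: inner_onb)
  then show ?thesis using assms by simp
qed

lemma onb_eqI: "(\<And>b. b \<in> onb \<Longrightarrow> u \<bullet> b = v \<bullet> b) \<Longrightarrow> u = v" for u v :: 'e
proof -
  assume "\<And>b. b \<in> onb \<Longrightarrow> u \<bullet> b = v \<bullet> b"
  then have "(\<Sum>b\<in>onb. (u \<bullet> b) *\<^sub>R b) = (\<Sum>b\<in>onb. (v \<bullet> b) *\<^sub>R b)" by (intro sum.cong) auto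
  then show "u = v" by (simp only: onb_expand)
qed

lemma linear_cform:
  assumes U: "(U, x) \<in> A" "p \<in> U"
  shows "linear (\<lambda>\<xi>. \<omega> p (cvec U x p \<xi>) (cvec U x p \<eta>))" "linear (\<lambda>\<eta>. \<omega> p (cvec U x p \<xi>) (cvec U x p \<eta>))"
proof -
  note c = cvec_tangent[OF U]
  have 1: "\<omega> p (cvec U x p (a *\<^sub>R \<xi>1 + b *\<^sub>R \<xi>2)) (cvec U x p \<eta>) =
      a * \<omega> p (cvec U x p \<xi>1) (cvec U x p \<eta>) + b * \<omega> p (cvec U x p \<xi>2) (cvec U x p \<eta>)" for a b \<xi>1 \<xi>2
    unfolding cvec_lin[OF U] by (rule form_lin1[OF c c c])
  have 2: "\<omega> p (cvec U x p \<xi>) (cvec U x p (a *\<^sub>R \<xi>1 + b *\<^sub>R \<xi>2)) =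
      a * \<omega> p (cvec U x p \<xi>) (cvec U x p \<xi>1) + b * \<omega> p (cvec U x p \<xi>) (cvec U x p \<xi>2)" for a b \<xi>1 \<xi>2
    unfolding cvec_lin[OF U] by (rule form_lin2[OF c c c])
  show "linear (\<lambda>\<xi>. \<omega> p (cvec U x p \<xi>) (cvec U x p \<eta>))"
    using 1[of 1 _ 1 _] 1[of _ _ 0 0] by (intro linearI) simp_all
  show "linear (\<lambda>\<eta>. \<omega> p (cvec U x p \<xi>) (cvec U x p \<eta>))"
    using 2[of 1 _ 1 _] 2[of _ _ 0 0] by (intro linearI) simp_all
qed

lemma linear_Jc:
  assumes U: "(U, x) \<in> A" "p \<in> U" shows "linear (Jc U x p)"
  unfolding Jc_def
  by (intro linear_compose_sum ballI linearI)
    (simp_all add: linear_add[OF linear_cform(1)[OF U]] linear_scale[OF linear_cform(1)[OF U]] scaleR_left_distrib)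

lemma inj_Jc:
  assumes U: "(U, x) \<in> A" "p \<in> U" shows "inj (Jc U x p)"
  unfolding linear_injective_0[OF linear_Jc[OF U]]
proof (intro allI impI)
  fix \<xi> assume z: "Jc U x p \<xi> = 0"
  have "\<omega> p (cvec U x p \<xi>) (cvec U x p \<eta>) = 0" for \<eta>
  proof -
    have "\<omega> p (cvec U x p \<xi>) (cvec U x p \<eta>) = (\<Sum>b\<in>onb. (\<eta> \<bullet> b) *\<^sub>R \<omega> p (cvec U x p \<xi>) (cvec U x p b))"
      by (rule linear_onb_expand[OF linear_cform(2)[OF U]])
    also have "\<dots> = 0" using Jc_inner[of _ U x p \<xi>] z by (intro sum.neutral) auto
    finally show ?thesis .
  qed
  then have "cvec U x p \<xi> = (\<lambda>f. 0)"
    using tangent_eq_cvec[OF U] by (intro form_nondeg[OF cvec_tangent[OF U]]) metis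
  then show "\<xi> = 0" using cvec_inj[OF U] cvec_0[OF U] by metis
qed

lemma contracts_to_cvec_iff:
  assumes U: "(U, x) \<in> A" "p \<in> U" and f: "smooth_fun A f"
  shows "contracts_to A \<omega> p (cvec U x p \<xi>) f \<longleftrightarrow>
    Jc U x p \<xi> = (\<Sum>b\<in>onb. D (\<lambda>e. f (chart_inv U x e)) (x p) b *\<^sub>R b)" (is "_ \<longleftrightarrow> _ = ?r")
proof -
  let ?d = "D (\<lambda>e. f (chart_inv U x e)) (x p)"
  have ld: "linear ?d" by (rule has_derivative_linear[OF chart_has_derivative[OF U f]])
  have rb: "?r \<bullet> b = ?d b" if "b \<in> onb" for b
  proof -
    have "?r \<bullet> b = (\<Sum>a\<in>onb. if a = b then ?d b else 0)"
      unfolding inner_sum_left using that by (intro sum.cong) (auto simp: inner_onb)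
    then show ?thesis using that by simp
  qed
  have "contracts_to A \<omega> p (cvec U x p \<xi>) f \<longleftrightarrow> (\<forall>\<eta>. ?d \<eta> = \<omega> p (cvec U x p \<xi>) (cvec U x p \<eta>))"
  proof
    assume "contracts_to A \<omega> p (cvec U x p \<xi>) f"
    then show "\<forall>\<eta>. ?d \<eta> = \<omega> p (cvec U x p \<xi>) (cvec U x p \<eta>)"
      unfolding contracts_to_def using cvec_tangent[OF U] f by (metis cvec_def)
  next
    assume R: "\<forall>\<eta>. ?d \<eta> = \<omega> p (cvec U x p \<xi>) (cvec U x p \<eta>)"
    show "contracts_to A \<omega> p (cvec U x p \<xi>) f"
      unfolding contracts_to_def
    proof
      fix v assume "v \<in> tangent A p"
      then obtain \<eta> where "v = cvec U x p \<eta>" by (rule tangent_eq_cvec[OF U])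
      then show "v f = \<omega> p (cvec U x p \<xi>) v" using R f by (simp add: cvec_def)
    qed
  qed
  also have "\<dots> \<longleftrightarrow> (\<forall>b\<in>onb. ?d b = \<omega> p (cvec U x p \<xi>) (cvec U x p b))"
  proof
    assume "\<forall>b\<in>onb. ?d b = \<omega> p (cvec U x p \<xi>) (cvec U x p b)"
    then have "(\<Sum>b\<in>onb. (\<eta> \<bullet> b) *\<^sub>R ?d b) = (\<Sum>b\<in>onb. (\<eta> \<bullet> b) *\<^sub>R \<omega> p (cvec U x p \<xi>) (cvec U x p b))" for \<eta>
      by (intro sum.cong) auto
    then show "\<forall>\<eta>. ?d \<eta> = \<omega> p (cvec U x p \<xi>) (cvec U x p \<eta>)"
      by (simp only: linear_onb_expand[OF ld, symmetric] linear_onb_expand[OF linear_cform(2)[OF U], symmetric]) simp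
  qed blast
  also have "\<dots> \<longleftrightarrow> (\<forall>b\<in>onb. ?r \<bullet> b = Jc U x p \<xi> \<bullet> b)" by (simp add: rb Jc_inner)
  also have "\<dots> \<longleftrightarrow> Jc U x p \<xi> = ?r" by (auto intro: onb_eqI)
  finally show ?thesis .
qed

text \<open>Nondegeneracy makes \<open>Jc U x p\<close> injective, hence bijective in finite dimension.\<close>

lemma ham_vf_ex1:
  assumes f: "smooth_fun A f"
  shows "\<exists>!\<xi>. \<xi> \<in> tangent A p \<and> contracts_to A \<omega> p \<xi> f"
proof -
  obtain U x where U: "(U, x) \<in> A" "p \<in> U" by (rule ex_chart)
  obtain \<xi> where \<xi>: "Jc U x p \<xi> = (\<Sum>b\<in>onb. D (\<lambda>e. f (chart_inv U x e)) (x p) b *\<^sub>R b)"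
    using linear_inj_imp_surj[OF linear_Jc[OF U] inj_Jc[OF U]] by (metis surjE)
  show ?thesis
  proof (rule ex1I[of _ "cvec U x p \<xi>"])
    show "cvec U x p \<xi> \<in> tangent A p \<and> contracts_to A \<omega> p (cvec U x p \<xi>) f"
      using cvec_tangent[OF U] contracts_to_cvec_iff[OF U f] \<xi> by blast
    fix v assume v: "v \<in> tangent A p \<and> contracts_to A \<omega> p v f"
    then obtain \<eta> where \<eta>: "v = cvec U x p \<eta>" using tangent_eq_cvec[OF U] by blast
    then have "Jc U x p \<eta> = Jc U x p \<xi>" using v contracts_to_cvec_iff[OF U f] \<xi> by simp
    then show "v = cvec U x p \<xi>" using inj_Jc[OF U] \<eta> by (simp add: inj_eq)
  qed
qed

lemma
  assumes f: "smooth_fun A f"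
  shows ham_vf_tangent: "ham_vf A \<omega> f p \<in> tangent A p"
    and ham_vf_contracts: "contracts_to A \<omega> p (ham_vf A \<omega> f p) f"
  using theI'[OF ham_vf_ex1[OF f, of p]] unfolding ham_vf_def by auto

lemma ham_vf_eqI:
  "smooth_fun A f \<Longrightarrow> \<xi> \<in> tangent A p \<Longrightarrow> contracts_to A \<omega> p \<xi> f \<Longrightarrow> ham_vf A \<omega> f p = \<xi>"
  unfolding ham_vf_def by (rule the1_equality[OF ham_vf_ex1]) auto

lemma poisson_eq: "smooth_fun A f \<Longrightarrow> smooth_fun A g \<Longrightarrow> poisson A \<omega> f g p = ham_vf A \<omega> g p f"
  using ham_vf_contracts[of f p] ham_vf_tangent[of g p] unfolding contracts_to_def poisson_def by simp

lemma poisson_antisym: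
  "smooth_fun A f \<Longrightarrow> smooth_fun A g \<Longrightarrow> poisson A \<omega> f g p = - poisson A \<omega> g f p"
  unfolding poisson_def by (intro form_antisym ham_vf_tangent)

lemma poisson_mult1:
  assumes "smooth_fun A f" "smooth_fun A g" "smooth_fun A h"
  shows "poisson A \<omega> (\<lambda>q. f q * g q) h p = f p * poisson A \<omega> g h p + g p * poisson A \<omega> f h p"
  using assms tangent_mult[OF ham_vf_tangent[OF assms(3)] assms(1,2)]
  by (simp add: poisson_eq smooth_fun_mult)

lemma poisson_diff1:
  assumes "smooth_fun A f" "smooth_fun A g" "smooth_fun A h"
  shows "poisson A \<omega> (\<lambda>q. f q - g q) h p = poisson A \<omega> f h p - poisson A \<omega> g h p"
  using assms tangent_diff[OF ham_vf_tangent[OF assms(3)] assms(1,2)]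
  by (simp add: poisson_eq smooth_fun_diff)

lemma poisson_mult2:
  assumes "smooth_fun A f" "smooth_fun A g" "smooth_fun A h"
  shows "poisson A \<omega> h (\<lambda>q. f q * g q) p = f p * poisson A \<omega> h g p + g p * poisson A \<omega> h f p"
  using poisson_mult1[OF assms] poisson_antisym[OF assms(3) smooth_fun_mult[OF assms(1,2)]]
    poisson_antisym[OF assms(3,2)] poisson_antisym[OF assms(3,1)] by simp

subsection \<open>Continuity of Hamiltonian vector fields\<close>

text \<open>Smoothness of \<open>\<omega>\<close> is a statement about vector fields on all of \<open>M\<close>, so the coordinate fields of a chart
  have to be cut off and extended by 0.\<close>

lemma ex_chart_field:
  assumes U: "(U, x) \<in> A" "p \<in> U"
  obtains N X where "open N" "p \<in> N" "N \<subseteq> U" "\<forall>a. vector_field A (X a)" "\<forall>a. \<forall>q\<in>N. X a q = cvec U x q a"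
proof -
  obtain c C N where c: "smooth_on UNIV c" "\<forall>e. c e \<ge> 0" "compact C" "C \<subseteq> x ` (U \<inter> UNIV)"
    "\<forall>e. e \<notin> C \<longrightarrow> c e = 0" "open N" "p \<in> N" "N \<subseteq> U \<inter> UNIV" "\<forall>q\<in>N. c (x q) = 1"
    "smooth_fun A (\<lambda>q. if q \<in> U then c (x q) else 0)"
    by (rule ex_bump[OF U open_UNIV UNIV_I])
  define X where "X a q = (if q \<in> U then cvec U x q (c (x q) *\<^sub>R a) else (\<lambda>f. 0))" for a q
  have "vector_field A (X a)" for a
    unfolding vector_field_def
  proof (intro conjI allI impI)
    show "X a q \<in> tangent A q" for q using cvec_tangent[OF U(1)] zero_tangent by (simp add: X_def)
    fix f assume f: "smooth_fun A f"
    have eq: "X a q f = (if q \<in> U then c (x q) * D (\<lambda>e. f (chart_inv U x e)) (x q) a else 0)" for q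
      using f linear_scale[OF has_derivative_linear[OF chart_has_derivative[OF U(1) _ f]]]
      by (simp add: X_def cvec_def)
    show "smooth_fun A (\<lambda>q. X a q f)"
      unfolding eq
      by (rule smooth_fun_of_chart[OF U(1) _ c(3)])
        (use c in \<open>auto intro!: smooth_on_mult chart_image_open[OF U(1)] smooth_on_D smooth_funD[OF f U(1)]
          smooth_on_subset[OF c(1)]\<close>)
  qed
  moreover have "\<forall>a. \<forall>q\<in>N. X a q = cvec U x q a" using c(8,9) by (auto simp: X_def)
  ultimately show ?thesis using c(6,7,8) by (intro that[of N X]) auto
qed

lemma cform_continuous:
  assumes U: "(U, x) \<in> A"
  shows "continuous_on U (\<lambda>q. \<omega> q (cvec U x q a) (cvec U x q b))"
proof (rule continuous_at_imp_continuous_on, rule ballI)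
  fix p assume p: "p \<in> U"
  obtain N X where N: "open N" "p \<in> N" "N \<subseteq> U" "\<forall>a. vector_field A (X a)" "\<forall>a. \<forall>q\<in>N. X a q = cvec U x q a"
    by (rule ex_chart_field[OF U p])
  have "continuous_on UNIV (\<lambda>q. \<omega> q (X a q) (X b q))"
    using N(4) by (intro smooth_fun_continuous_on form_smooth) auto
  then have "continuous_on N (\<lambda>q. \<omega> q (X a q) (X b q))" by (rule continuous_on_subset) simp
  then have "continuous_on N (\<lambda>q. \<omega> q (cvec U x q a) (cvec U x q b))"
    by (rule continuous_on_eq) (use N(5) in simp)
  then show "isCont (\<lambda>q. \<omega> q (cvec U x q a) (cvec U x q b)) p"
    using N(1,2) continuous_on_eq_continuous_at by blast
qed

text \<open>Coordinates of the Hamiltonian vector field.\<close>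

definition hc :: "'m set \<Rightarrow> ('m \<Rightarrow> 'e) \<Rightarrow> ('m \<Rightarrow> real) \<Rightarrow> 'm \<Rightarrow> 'e" where
  "hc U x f p = (SOME \<xi>. ham_vf A \<omega> f p = cvec U x p \<xi>)"

lemma ham_vf_hc:
  assumes U: "(U, x) \<in> A" "p \<in> U" and f: "smooth_fun A f"
  shows "ham_vf A \<omega> f p = cvec U x p (hc U x f p)"
proof -
  obtain \<xi> where "ham_vf A \<omega> f p = cvec U x p \<xi>" by (rule tangent_eq_cvec[OF U ham_vf_tangent[OF f]])
  then show ?thesis unfolding hc_def by (rule someI)
qed

lemma Jc_hc:
  assumes U: "(U, x) \<in> A" "p \<in> U" and f: "smooth_fun A f"
  shows "Jc U x p (hc U x f p) = (\<Sum>b\<in>onb. D (\<lambda>e. f (chart_inv U x e)) (x p) b *\<^sub>R b)"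
  using contracts_to_cvec_iff[OF U f, of "hc U x f p"] ham_vf_contracts[OF f, of p] ham_vf_hc[OF U f] by simp

lemma poisson_hc:
  assumes U: "(U, x) \<in> A" "p \<in> U" and f: "smooth_fun A f" and g: "smooth_fun A g"
  shows "poisson A \<omega> f g p = D (\<lambda>e. f (chart_inv U x e)) (x p) (hc U x g p)"
  using f by (simp add: poisson_eq[OF f g] ham_vf_hc[OF U g] cvec_def)

lemma hc_tendsto:
  fixes f :: "'s \<Rightarrow> 'm \<Rightarrow> real" and p :: "'s \<Rightarrow> 'm"
  assumes U: "(U, x) \<in> A" "p0 \<in> U" and p: "(p \<longlongrightarrow> p0) F"
    and f: "\<And>s. smooth_fun A (f s)" "smooth_fun A f0"
    and df: "\<And>b. ((\<lambda>s. D (\<lambda>e. f s (chart_inv U x e)) (x (p s)) b) \<longlongrightarrow> D (\<lambda>e. f0 (chart_inv U x e)) (x p0) b) F"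
  shows "((\<lambda>s. hc U x (f s) (p s)) \<longlongrightarrow> hc U x f0 p0) F"
proof (rule tendsto_linear_solution)
  have ev: "\<forall>\<^sub>F s in F. p s \<in> U" using topological_tendstoD[OF p chart_open[OF U(1)] U(2)] .
  show "\<forall>\<^sub>F s in F. linear (Jc U x (p s))"
    using ev by eventually_elim (rule linear_Jc[OF U(1)])
  show "((\<lambda>s. Jc U x (p s) a) \<longlongrightarrow> Jc U x p0 a) F" for a
    unfolding Jc_def
  proof (intro tendsto_sum tendsto_scaleR tendsto_const)
    fix b :: 'e
    have "isCont (\<lambda>q. \<omega> q (cvec U x q a) (cvec U x q b)) p0"
      using cform_continuous[OF U(1)] continuous_on_eq_continuous_at[OF chart_open[OF U(1)]] U(2) by blast
    from isCont_tendsto_compose[OF this p]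
    show "((\<lambda>s. \<omega> (p s) (cvec U x (p s) a) (cvec U x (p s) b)) \<longlongrightarrow> \<omega> p0 (cvec U x p0 a) (cvec U x p0 b)) F" .
  qed
  show "((\<lambda>s. \<Sum>b\<in>onb. D (\<lambda>e. f s (chart_inv U x e)) (x (p s)) b *\<^sub>R b) \<longlongrightarrow>
      (\<Sum>b\<in>onb. D (\<lambda>e. f0 (chart_inv U x e)) (x p0) b *\<^sub>R b)) F"
    by (intro tendsto_sum tendsto_scaleR tendsto_const df)
  show "\<forall>\<^sub>F s in F. Jc U x (p s) (hc U x (f s) (p s)) =
      (\<Sum>b\<in>onb. D (\<lambda>e. f s (chart_inv U x e)) (x (p s)) b *\<^sub>R b)"
    using ev
  proof eventually_elim
    case (elim s)
    show ?case by (rule Jc_hc[OF U(1) elim f(1)])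
  qed
  show "linear (Jc U x p0)" "inj (Jc U x p0)" by (rule linear_Jc[OF U], rule inj_Jc[OF U])
  show "Jc U x p0 (hc U x f0 p0) = (\<Sum>b\<in>onb. D (\<lambda>e. f0 (chart_inv U x e)) (x p0) b *\<^sub>R b)"
    by (rule Jc_hc[OF U f(2)])
qed

lemma poisson_tendsto:
  fixes f g :: "'s \<Rightarrow> 'm \<Rightarrow> real" and p :: "'s \<Rightarrow> 'm"
  assumes U: "(U, x) \<in> A" "p0 \<in> U" and p: "(p \<longlongrightarrow> p0) F"
    and f: "\<And>s. smooth_fun A (f s)" "smooth_fun A f0"
    and g: "\<And>s. smooth_fun A (g s)" "smooth_fun A g0"
    and df: "\<And>b. ((\<lambda>s. D (\<lambda>e. f s (chart_inv U x e)) (x (p s)) b) \<longlongrightarrow> D (\<lambda>e. f0 (chart_inv U x e)) (x p0) b) F"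
    and dg: "\<And>b. ((\<lambda>s. D (\<lambda>e. g s (chart_inv U x e)) (x (p s)) b) \<longlongrightarrow> D (\<lambda>e. g0 (chart_inv U x e)) (x p0) b) F"
  shows "((\<lambda>s. poisson A \<omega> (f s) (g s) (p s)) \<longlongrightarrow> poisson A \<omega> f0 g0 p0) F"
proof -
  have ev: "\<forall>\<^sub>F s in F. p s \<in> U" using topological_tendstoD[OF p chart_open[OF U(1)] U(2)] .
  have P: "poisson A \<omega> f g q = (\<Sum>b\<in>onb. (hc U x g q \<bullet> b) *\<^sub>R D (\<lambda>e. f (chart_inv U x e)) (x q) b)"
    if "q \<in> U" "smooth_fun A f" "smooth_fun A g" for f g q
    unfolding poisson_hc[OF U(1) that]
    by (rule linear_onb_expand[OF has_derivative_linear[OF chart_has_derivative[OF U(1) that(1,2)]]])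
  have "((\<lambda>s. \<Sum>b\<in>onb. (hc U x (g s) (p s) \<bullet> b) *\<^sub>R D (\<lambda>e. f s (chart_inv U x e)) (x (p s)) b) \<longlongrightarrow>
      (\<Sum>b\<in>onb. (hc U x g0 p0 \<bullet> b) *\<^sub>R D (\<lambda>e. f0 (chart_inv U x e)) (x p0) b)) F"
    by (intro tendsto_sum tendsto_scaleR tendsto_inner tendsto_const df hc_tendsto[OF U p g dg])
  then have "((\<lambda>s. poisson A \<omega> (f s) (g s) (p s)) \<longlongrightarrow>
      (\<Sum>b\<in>onb. (hc U x g0 p0 \<bullet> b) *\<^sub>R D (\<lambda>e. f0 (chart_inv U x e)) (x p0) b)) F"
    by (rule Lim_transform_eventually) (use ev in \<open>eventually_elim, simp add: P f g\<close>)
  then show ?thesis using P[OF U(2) f(2) g(2)] by simp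
qed

text \<open>The Hamiltonian vector field of \<open>w\<close> annihilates \<open>\<phi>\<close>, so it is tangent to the level set of \<open>p\<close>, on
  which \<open>u\<close> vanishes. At a critical point of \<open>\<phi>\<close> the level set need not be a manifold, which is why
  the argument is made with Euler polygons.\<close>

lemma poisson_zero_on_level:
  assumes s: "smooth_fun A \<phi>" "smooth_fun A u" "smooth_fun A w"
    and comm: "\<And>q. poisson A \<omega> \<phi> w q = 0" and level: "\<And>q. \<phi> q = \<phi> p \<Longrightarrow> u q = 0"
  shows "poisson A \<omega> u w p = 0"
proof -
  obtain U x where U: "(U, x) \<in> A" "p \<in> U" by (rule ex_chart)
  note inv = chart_inv_chart[OF U(1)]
  let ?X = "\<lambda>e. hc U x w (chart_inv U x e)"
  have "D (\<lambda>e. u (chart_inv U x e)) (x p) (?X (x p)) = 0"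
  proof (rule derivative_zero_along_level_set[OF chart_image_open[OF U(1)], where \<phi> = "\<lambda>e. \<phi> (chart_inv U x e)"])
    show "x p \<in> x ` U" using U by blast
    show "continuous_on (x ` U) ?X"
    proof (rule continuous_at_imp_continuous_on, rule ballI)
      fix e assume e: "e \<in> x ` U"
      have "(chart_inv U x \<longlongrightarrow> chart_inv U x e) (at e)"
        using chart_inv_cont[OF U(1)] continuous_on_eq_continuous_at[OF chart_image_open[OF U(1)]] e
        by (auto simp: isCont_def)
      then have "((\<lambda>e. hc U x ((\<lambda>_. w) e) (chart_inv U x e)) \<longlongrightarrow> hc U x w (chart_inv U x e)) (at e)"
      proof (rule hc_tendsto[OF U(1) chart_inv_in[OF U(1) e] _ s(3) s(3)])
        fix b
        have "isCont (\<lambda>e. D (\<lambda>e. w (chart_inv U x e)) e b) e"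
          using smooth_on_continuous[OF smooth_on_D[OF smooth_funD[OF s(3) U(1)]]]
            continuous_on_eq_continuous_at[OF chart_image_open[OF U(1)]] e by blast
        then have "((\<lambda>e. D (\<lambda>e. w (chart_inv U x e)) e b) \<longlongrightarrow> D (\<lambda>e. w (chart_inv U x e)) e b) (at e)"
          by (simp add: isCont_def)
        then show "((\<lambda>e. D (\<lambda>e. w (chart_inv U x e)) (x (chart_inv U x e)) b) \<longlongrightarrow>
            D (\<lambda>e. w (chart_inv U x e)) (x (chart_inv U x e)) b) (at e)"
          unfolding chart_chart_inv[OF U(1) e]
          by (rule Lim_transform_within_open[OF _ chart_image_open[OF U(1)] e])
            (simp add: chart_chart_inv[OF U(1)])
      qed
      then show "isCont ?X e" by (simp add: isCont_def)
    qed
    show "Ck_on (Suc 0) (x ` U) (\<lambda>e. \<phi> (chart_inv U x e))"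
      using smooth_funD[OF s(1) U(1)] unfolding smooth_on_def by blast
    show "D (\<lambda>e. \<phi> (chart_inv U x e)) e (?X e) = 0" if "e \<in> x ` U" for e
      using poisson_hc[OF U(1) chart_inv_in[OF U(1) that] s(1,3)] comm chart_chart_inv[OF U(1) that] by simp
    show "(\<lambda>e. u (chart_inv U x e)) differentiable at (x p)"
      using chart_has_derivative[OF U s(2)] by (auto simp: differentiable_def)
    show "u (chart_inv U x e) = u (chart_inv U x (x p))"
      if "\<phi> (chart_inv U x e) = \<phi> (chart_inv U x (x p))" for e
      using level[of "chart_inv U x e"] level[of p] that inv U(2) by simp
  qed
  then show ?thesis using poisson_hc[OF U s(2,3)] inv U(2) by simp
qed

end

section \<open>The product with the complex plane\<close>

context two_manifolds begin

lemma smooth_fun_snd: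
  assumes "smooth_fun B f" shows "smooth_fun (prod_atlas A B) (\<lambda>pq. f (snd pq))"
proof (rule smooth_fun_prodI)
  fix p q
  obtain U x where U: "(U, x) \<in> A" "p \<in> U" by (rule A.ex_chart)
  obtain V y where V: "(V, y) \<in> B" "q \<in> V" by (rule B.ex_chart)
  note o = A.chart_image_open[OF U(1)] B.chart_image_open[OF V(1)]
  have "smooth_on (x ` U \<times> y ` V) (\<lambda>e. f (chart_inv V y (snd e)))"
    by (rule smooth_on_compose[OF open_Times[OF o] o(2) _ _ B.smooth_funD[OF assms V(1)]])
      (auto intro!: smooth_on_bounded_linear bounded_linear_snd open_Times o)
  then show "\<exists>U x V y S T. (U, x) \<in> A \<and> (V, y) \<in> B \<and> open S \<and> open T \<and> p \<in> S \<and> q \<in> T \<and> S \<subseteq> U \<and> T \<subseteq> V \<and>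
      smooth_on (x ` S \<times> y ` T) (\<lambda>e. f (snd (chart_inv U x (fst e), chart_inv V y (snd e))))"
    using U V A.chart_open[OF U(1)] B.chart_open[OF V(1)]
    by (intro exI[of _ U] exI[of _ x] exI[of _ V] exI[of _ y]) auto
qed

end

abbreviation std_cvec :: "complex \<Rightarrow> complex \<Rightarrow> complex tvec" where
  "std_cvec z \<zeta> \<equiv> manifold.cvec std_atlas UNIV id z \<zeta>"

lemma std_cvec_eq: "std_cvec z \<zeta> = (\<lambda>h. if smooth_on UNIV h then D h z \<zeta> else 0)"
proof
  fix h show "std_cvec z \<zeta> h = (if smooth_on UNIV h then D h z \<zeta> else 0)"
    by (cases "smooth_on UNIV h") (simp_all add: manifold.cvec_def[OF manifold_std] smooth_fun_std)
qed

lemma dz_std_cvec: "dz (std_cvec z \<zeta>) = \<zeta>"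
proof -
  have "smooth_on UNIV Re" "smooth_on UNIV Im"
    by (intro smooth_on_bounded_linear bounded_linear_Re bounded_linear_Im open_UNIV)+
  moreover have "D Re z = Re" "D Im z = Im"
    by (intro D_eq bounded_linear_imp_has_derivative bounded_linear_Re bounded_linear_Im)+
  ultimately show ?thesis by (simp add: dz_def std_cvec_eq)
qed

lemma complex_form_std_cvec: "complex_form z (std_cvec z \<zeta>) (std_cvec z \<eta>) = Im \<zeta> * Re \<eta> - Re \<zeta> * Im \<eta>"
  proof -
  have "b + (a - b) / 2 = a + (b - a) / 2" for a b :: real by (simp add: field_simps)
  note half = this
  show ?thesis by (simp add: complex_form_def dz_std_cvec algebra_simps) (rule half)
qed

lemma D_complex_linear:
  fixes h :: "complex \<Rightarrow> real"
  assumes "smooth_on UNIV h"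
  shows "D h z \<eta> = Re \<eta> * D h z 1 + Im \<eta> * D h z \<i>"
proof -
  have l: "linear (D h z)" by (rule has_derivative_linear[OF smooth_on_has_derivative[OF assms]]) simp
  have "\<eta> = Re \<eta> *\<^sub>R 1 + Im \<eta> *\<^sub>R \<i>" by (simp add: complex_eq_iff)
  then have "D h z \<eta> = D h z (Re \<eta> *\<^sub>R 1 + Im \<eta> *\<^sub>R \<i>)" by simp
  then show ?thesis by (simp add: linear_add[OF l] linear_scale[OF l])
qed

context symplectic begin

sublocale ext: two_manifolds A "std_atlas :: (complex, complex) chart set"
  using manifold_std by (simp add: two_manifolds_def manifold_axioms)

lemma ext_atlas_eq: "ext_atlas A = prod_atlas A std_atlas" by (simp add: ext_atlas_def)

lemma ext_slice1: "smooth_fun (ext_atlas A) f \<Longrightarrow> smooth_fun A (\<lambda>p. f (p, z))"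
  unfolding ext_atlas_eq by (rule ext.smooth_fun_slice1)

lemma ext_slice2: "smooth_fun (ext_atlas A) f \<Longrightarrow> smooth_on UNIV (\<lambda>w. f (p, w))"
  unfolding ext_atlas_eq smooth_fun_std[symmetric] by (rule ext.smooth_fun_slice2)

lemma std_chart: "(UNIV, id) \<in> (std_atlas :: (complex, complex) chart set)" by (simp add: std_atlas_def)

text \<open>The tangent vector of \<open>M \<times> \<complex>\<close> at \<open>(p, z)\<close> with components \<open>u\<close> and \<open>\<zeta>\<close>.\<close>

definition evec :: "'m \<Rightarrow> complex \<Rightarrow> 'm tvec \<Rightarrow> complex \<Rightarrow> ('m \<times> complex) tvec" where
  "evec p z u \<zeta> = (\<lambda>f. if smooth_fun (ext_atlas A) f then u (\<lambda>q. f (q, z)) + D (\<lambda>w. f (p, w)) z \<zeta> else 0)"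

lemma evec_cvec:
  assumes U: "(U, x) \<in> A" "p \<in> U"
  shows "evec p z (cvec U x p \<xi>) \<zeta> = ext.prod.cvec (U \<times> UNIV) (map_prod x id) (p, z) (\<xi>, \<zeta>)"
proof
  fix f show "evec p z (cvec U x p \<xi>) \<zeta> f = ext.prod.cvec (U \<times> UNIV) (map_prod x id) (p, z) (\<xi>, \<zeta>) f"
  proof (cases "smooth_fun (ext_atlas A) f")
    case True
    then show ?thesis
      using ext.cvec_prod[OF True[unfolded ext_atlas_eq] U std_chart UNIV_I[of z], of \<xi> \<zeta>] ext_slice2[OF True]
      by (simp add: evec_def std_cvec_eq)
  qed (simp add: evec_def ext.prod.cvec_def ext_atlas_eq)
qed

lemma evec_tangent:
  assumes "u \<in> tangent A p" shows "evec p z u \<zeta> \<in> tangent (ext_atlas A) (p, z)"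
proof -
  obtain U x where U: "(U, x) \<in> A" "p \<in> U" by (rule ex_chart)
  obtain \<xi> where \<xi>: "u = cvec U x p \<xi>" by (rule tangent_eq_cvec[OF U assms])
  have "(p, z) \<in> U \<times> UNIV" using U by simp
  from ext.prod.cvec_tangent[OF ext.prod_chart[OF U(1) std_chart] this]
  show ?thesis unfolding \<xi> evec_cvec[OF U] ext_atlas_eq .
qed

lemma ext_tangent:
  assumes "v \<in> tangent (ext_atlas A) (p, z)"
  obtains u \<zeta> where "u \<in> tangent A p" "v = evec p z u \<zeta>"
proof -
  obtain U x where U: "(U, x) \<in> A" "p \<in> U" by (rule ex_chart)
  have pz: "(p, z) \<in> U \<times> UNIV" using U by simp
  obtain e where e: "v = ext.prod.cvec (U \<times> UNIV) (map_prod x id) (p, z) e"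
    by (rule ext.prod.tangent_eq_cvec[OF ext.prod_chart[OF U(1) std_chart] pz assms[unfolded ext_atlas_eq]])
  have "v = evec p z (cvec U x p (fst e)) (snd e)"
    unfolding e evec_cvec[OF U] by simp
  then show ?thesis using that cvec_tangent[OF U] by blast
qed

lemma push_fst_evec:
  assumes u: "u \<in> tangent A p" shows "push A fst (evec p z u \<zeta>) = u"
proof
  fix h show "push A fst (evec p z u \<zeta>) h = u h"
    using ext.smooth_fun_fst[of h] tangent_nonsmooth[OF u, of h]
    by (auto simp: push_def evec_def o_def ext_atlas_eq)
qed

lemma push_snd_evec:
  assumes u: "u \<in> tangent A p" shows "push std_atlas snd (evec p z u \<zeta>) = std_cvec z \<zeta>"
proof
  fix h show "push std_atlas snd (evec p z u \<zeta>) h = std_cvec z \<zeta> h"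
    using ext.smooth_fun_snd[of h] tangent_const[OF u, of "h z"]
    by (auto simp: push_def evec_def o_def ext_atlas_eq std_cvec_eq smooth_fun_std)
qed

lemma ext_form_evec:
  assumes "u \<in> tangent A p" "v \<in> tangent A p"
  shows "ext_form A \<omega> (p, z) (evec p z u \<zeta>) (evec p z v \<eta>) = \<omega> p u v + (Im \<zeta> * Re \<eta> - Re \<zeta> * Im \<eta>)"
  by (simp add: ext_form_def push_fst_evec push_snd_evec assms complex_form_std_cvec)

text \<open>The form on \<open>\<complex>\<close> is \<open>- dx \<and> dy\<close>, so the equation \<open>i\<^sub>\<zeta> (- dx \<and> dy) = df\<close> has the solution
  \<open>\<zeta> = (- \<partial>f/\<partial>y, \<partial>f/\<partial>x)\<close>; the two factors of the product do not interact.\<close>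

lemma ext_ham_vf:
  assumes f: "smooth_fun (ext_atlas A) f"
  shows "ham_vf (ext_atlas A) (ext_form A \<omega>) f (p, z) =
    evec p z (ham_vf A \<omega> (\<lambda>q. f (q, z)) p) (Complex (- D (\<lambda>w. f (p, w)) z \<i>) (D (\<lambda>w. f (p, w)) z 1))"
    (is "_ = evec p z ?X ?\<zeta>")
  unfolding ham_vf_def[of "ext_atlas A"]
proof (rule the_equality)
  let ?fz = "\<lambda>q. f (q, z)" and ?fp = "\<lambda>w. f (p, w)"
  note X = ham_vf_tangent[OF ext_slice1[OF f, of z], of p]
  have ev: "evec p z u \<eta> f = u ?fz + (Re \<eta> * D ?fp z 1 + Im \<eta> * D ?fp z \<i>)" for u \<eta>
    unfolding D_complex_linear[OF ext_slice2[OF f], of p z \<eta>, symmetric] using f by (simp add: evec_def)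
  show "evec p z ?X ?\<zeta> \<in> tangent (ext_atlas A) (p, z) \<and>
      contracts_to (ext_atlas A) (ext_form A \<omega>) (p, z) (evec p z ?X ?\<zeta>) f"
  proof
    show "evec p z ?X ?\<zeta> \<in> tangent (ext_atlas A) (p, z)" by (rule evec_tangent[OF X])
    show "contracts_to (ext_atlas A) (ext_form A \<omega>) (p, z) (evec p z ?X ?\<zeta>) f"
      unfolding contracts_to_def
    proof
      fix v assume "v \<in> tangent (ext_atlas A) (p, z)"
      then obtain u \<eta> where u: "u \<in> tangent A p" "v = evec p z u \<eta>" by (rule ext_tangent)
      have "u ?fz = \<omega> p ?X u"
        using ham_vf_contracts[OF ext_slice1[OF f, of z], of p] u(1) unfolding contracts_to_def by blast
      then show "v f = ext_form A \<omega> (p, z) (evec p z ?X ?\<zeta>) v"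
        unfolding u(2) ext_form_evec[OF X u(1)] ev by simp
    qed
  qed
  fix \<xi> assume \<xi>: "\<xi> \<in> tangent (ext_atlas A) (p, z) \<and> contracts_to (ext_atlas A) (ext_form A \<omega>) (p, z) \<xi> f"
  then obtain u \<zeta> where u: "u \<in> tangent A p" "\<xi> = evec p z u \<zeta>" using ext_tangent by blast
  have c: "v ?fz + (Re \<eta> * D ?fp z 1 + Im \<eta> * D ?fp z \<i>) = \<omega> p u v + (Im \<zeta> * Re \<eta> - Re \<zeta> * Im \<eta>)"
    if v: "v \<in> tangent A p" for v \<eta>
  proof -
    have "evec p z v \<eta> f = ext_form A \<omega> (p, z) \<xi> (evec p z v \<eta>)"
      using \<xi> evec_tangent[OF v] unfolding contracts_to_def by blast
    then show ?thesis unfolding u(2) ext_form_evec[OF u(1) v] ev .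
  qed
  have "contracts_to A \<omega> p u ?fz"
    unfolding contracts_to_def using c[of _ 0] by simp
  then have "?X = u" by (rule ham_vf_eqI[OF ext_slice1[OF f] u(1)])
  moreover have "\<zeta> = ?\<zeta>"
  proof -
    have "u ?fz = \<omega> p u u" using c[OF u(1), of 0] by simp
    then show ?thesis using c[OF u(1), of 1] c[OF u(1), of \<i>] by (simp add: complex_eq_iff)
  qed
  ultimately show "\<xi> = evec p z ?X ?\<zeta>" using u(2) by simp
qed

lemma ext_poisson:
  assumes f: "smooth_fun (ext_atlas A) f" and g: "smooth_fun (ext_atlas A) g"
  shows "poisson (ext_atlas A) (ext_form A \<omega>) f g (p, z) =
    poisson A \<omega> (\<lambda>q. f (q, z)) (\<lambda>q. g (q, z)) p +
    (D (\<lambda>w. f (p, w)) z \<i> * D (\<lambda>w. g (p, w)) z 1 - D (\<lambda>w. f (p, w)) z 1 * D (\<lambda>w. g (p, w)) z \<i>)"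
  unfolding poisson_def ext_ham_vf[OF f] ext_ham_vf[OF g]
  by (subst ext_form_evec) (simp_all add: ham_vf_tangent ext_slice1 f g)

end

section \<open>Invariant integration on a topological group\<close>

text \<open>The bump functions play the role of Urysohn's lemma for locally compact groups; on a Lie group they
  come from charts.\<close>

locale bump_group =
  fixes K :: "'k::t2_space monoid" (structure)
  assumes group_K: "group K" and carrier_K [simp]: "carrier K = UNIV"
    and continuous_mult: "continuous_on UNIV (\<lambda>(g, h). g \<otimes> h)"
    and continuous_inv: "continuous_on UNIV (\<lambda>g. inv g)"
    and bump: "\<And>V s. open V \<Longrightarrow> s \<in> V \<Longrightarrow> \<exists>\<phi>::'k \<Rightarrow> real. continuous_on UNIV \<phi> \<and> (\<forall>t. \<phi> t \<ge> 0) \<and> \<phi> s > 0 \<and>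
        (\<exists>C. compact C \<and> (\<forall>t. t \<notin> C \<longrightarrow> \<phi> t = 0)) \<and> (\<forall>t. t \<notin> V \<longrightarrow> \<phi> t = 0)"
begin

interpretation group K by (rule group_K)

lemma mult_cont [continuous_intros]:
  assumes "continuous_on S f" "continuous_on S g" shows "continuous_on S (\<lambda>s. f s \<otimes> g s)"
proof -
  have "continuous_on S (\<lambda>s. (\<lambda>(g, h). g \<otimes> h) (f s, g s))"
    by (rule continuous_on_compose2[OF continuous_mult]) (auto intro!: continuous_on_Pair assms)
  then show ?thesis by simp
qed

lemma inv_cont [continuous_intros]: "continuous_on S f \<Longrightarrow> continuous_on S (\<lambda>s. inv (f s))"
  by (rule continuous_on_compose2[OF continuous_inv]) auto

lemma inv_mult_cancel [simp]: "inv g \<otimes> (g \<otimes> h) = h" "g \<otimes> (inv g \<otimes> h) = h"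
  by (simp_all add: m_assoc[symmetric])

lemma mult_inv_rev [simp]: "inv (g \<otimes> h) = inv h \<otimes> inv g"
  by (simp add: inv_mult_group)

definition Cc :: "('k \<Rightarrow> real) set" where
  "Cc = {f. continuous_on UNIV f \<and> (\<exists>C. compact C \<and> (\<forall>t. t \<notin> C \<longrightarrow> f t = 0))}"

definition Cp :: "('k \<Rightarrow> real) set" where
  "Cp = {f \<in> Cc. \<forall>t. f t \<ge> 0}"

lemma CcI: "continuous_on UNIV f \<Longrightarrow> compact C \<Longrightarrow> (\<And>t. t \<notin> C \<Longrightarrow> f t = 0) \<Longrightarrow> f \<in> Cc"
  by (auto simp: Cc_def)

lemma CcE:
  assumes "f \<in> Cc"
  obtains C where "continuous_on UNIV f" "compact C" "\<And>t. t \<notin> C \<Longrightarrow> f t = 0"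
  using assms by (auto simp: Cc_def)

lemma Cp_Cc: "f \<in> Cp \<Longrightarrow> f \<in> Cc" and Cp_nonneg: "f \<in> Cp \<Longrightarrow> f t \<ge> 0"
  by (auto simp: Cp_def)

lemma Cc_lincomb: assumes "f \<in> Cc" "g \<in> Cc" shows "(\<lambda>t. a * f t + b * g t) \<in> Cc"
proof -
  obtain C where C: "continuous_on UNIV f" "compact C" "\<And>t. t \<notin> C \<Longrightarrow> f t = 0" using assms(1) by (rule CcE) blast
  obtain C' where C': "continuous_on UNIV g" "compact C'" "\<And>t. t \<notin> C' \<Longrightarrow> g t = 0" using assms(2) by (rule CcE) blast
  show ?thesis
    by (rule CcI[of _ "C \<union> C'"]) (auto intro!: continuous_intros C C' compact_Un simp: C(3) C'(3))
qed

lemma Cp_add: "f \<in> Cp \<Longrightarrow> g \<in> Cp \<Longrightarrow> (\<lambda>t. f t + g t) \<in> Cp"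
  using Cc_lincomb[of f g 1 1] by (auto simp: Cp_def)

lemma Cp_scale: "f \<in> Cp \<Longrightarrow> c \<ge> 0 \<Longrightarrow> (\<lambda>t. c * f t) \<in> Cp"
  using Cc_lincomb[of f f c 0] by (auto simp: Cp_def)

lemma Cc_bounded: assumes "f \<in> Cc" obtains M where "M > 0" "\<And>t. \<bar>f t\<bar> \<le> M"
proof -
  obtain C where C: "continuous_on UNIV f" "compact C" "\<And>t. t \<notin> C \<Longrightarrow> f t = 0" using assms by (rule CcE) blast
  have "bounded (f ` C)"
    using C(1,2) by (intro compact_imp_bounded compact_continuous_image) (auto intro: continuous_on_subset)
  then obtain M where M: "M > 0" "\<And>t. t \<in> C \<Longrightarrow> \<bar>f t\<bar> \<le> M" unfolding bounded_pos by auto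
  have "\<bar>f t\<bar> \<le> M" for t using M C(3)[of t] by (cases "t \<in> C") auto
  then show ?thesis using M(1) that by blast
qed

lemma Cc_translate: assumes "f \<in> Cc" shows "(\<lambda>t. f (g \<otimes> t)) \<in> Cc"
proof -
  obtain C where C: "continuous_on UNIV f" "compact C" "\<And>t. t \<notin> C \<Longrightarrow> f t = 0" using assms by (rule CcE) blast
  show ?thesis
  proof (rule CcI[of _ "(\<lambda>t. inv g \<otimes> t) ` C"])
    show "continuous_on UNIV (\<lambda>t. f (g \<otimes> t))"
      by (rule continuous_on_compose2[OF C(1)]) (auto intro!: continuous_intros)
    show "compact ((\<lambda>t. inv g \<otimes> t) ` C)" by (intro compact_continuous_image C continuous_intros)
    show "f (g \<otimes> t) = 0" if "t \<notin> (\<lambda>t. inv g \<otimes> t) ` C" for t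
    proof (rule C(3), rule notI)
      assume "g \<otimes> t \<in> C"
      then have "inv g \<otimes> (g \<otimes> t) \<in> (\<lambda>t. inv g \<otimes> t) ` C" by blast
      then show False using that by simp
    qed
  qed
qed

lemma Cp_translate: "f \<in> Cp \<Longrightarrow> (\<lambda>t. f (g \<otimes> t)) \<in> Cp"
  using Cc_translate[of f g] by (auto simp: Cp_def)

text \<open>By compactness a finite sum of rescaled bump functions suffices.\<close>

lemma ex_Cp_ge_1:
  assumes "compact C" obtains u where "u \<in> Cp" "\<And>t. t \<in> C \<Longrightarrow> u t \<ge> 1"
proof -
  have "\<exists>\<phi>. \<phi> \<in> Cp \<and> \<phi> s > 0" for s
    using bump[OF open_UNIV UNIV_I, of s] by (auto simp: Cp_def Cc_def)
  then obtain \<phi> where \<phi>: "\<And>s. \<phi> s \<in> Cp" "\<And>s. \<phi> s s > 0" by metis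
  define W where "W s = {t. \<phi> s t > \<phi> s s / 2}" for s
  have W: "open (W s)" "s \<in> W s" for s
  proof -
    have "continuous_on UNIV (\<phi> s)" using \<phi>(1)[of s] by (auto simp: Cp_def Cc_def)
    then show "open (W s)" unfolding W_def by (intro open_Collect_less continuous_intros)
    show "s \<in> W s" using \<phi>(2)[of s] by (simp add: W_def)
  qed
  obtain S where S: "S \<subseteq> C" "finite S" "C \<subseteq> (\<Union>s\<in>S. W s)"
    using compactE_image[OF assms, of C W] W by (metis UN_I subsetI)
  define u where "u t = (\<Sum>s\<in>S. 2 / \<phi> s s * \<phi> s t)" for t
  have "u \<in> Cp" unfolding u_def using S(2)
  proof (induction S)
    case empty
    have "(\<lambda>t. 0 * \<phi> undefined t) \<in> Cp" by (intro Cp_scale \<phi>) simp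
    then show ?case by simp
  next
    case (insert s S)
    then show ?case using Cp_add[OF Cp_scale[OF \<phi>(1), of "2 / \<phi> s s" s] insert.IH] \<phi>(2)[of s] by simp
  qed
  moreover have "u t \<ge> 1" if t: "t \<in> C" for t
  proof -
    obtain s where s: "s \<in> S" "t \<in> W s" using S(3) t by blast
    have "1 \<le> 2 / \<phi> s s * \<phi> s t" using s(2) \<phi>(2)[of s] by (simp add: W_def field_simps)
    also have "\<dots> \<le> u t"
      unfolding u_def using S(2) s(1)
      by (intro member_le_sum[of s S "\<lambda>s. 2 / \<phi> s s * \<phi> s t"]) (use \<phi>(2) Cp_nonneg[OF \<phi>(1)] in \<open>auto intro!: mult_nonneg_nonneg divide_nonneg_pos\<close>)
    finally show ?thesis .
  qed
  ultimately show ?thesis using that by blast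
qed

text \<open>A neighbourhood \<open>V1\<close> of the unit that works for all \<open>y\<close> in the compact support is found by a tube
  argument. Intersecting \<open>V1\<close> with its inverse covers the case that only \<open>x\<close> lies in the support.\<close>

lemma uniformly_continuous:
  assumes "h \<in> Cc" "\<delta> > 0"
  obtains V where "open V" "\<one> \<in> V" "\<And>x y. inv y \<otimes> x \<in> V \<Longrightarrow> \<bar>h x - h y\<bar> < \<delta>"
proof -
  obtain C where C: "continuous_on UNIV h" "compact C" "\<And>t. t \<notin> C \<Longrightarrow> h t = 0" using assms(1) by (rule CcE) blast
  define W where "W = {p :: 'k \<times> 'k. \<bar>h (fst p \<otimes> snd p) - h (fst p)\<bar> < \<delta>}"
  have cf: "continuous_on UNIV (\<lambda>p::'k \<times> 'k. fst p \<otimes> snd p)"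
    by (intro continuous_intros)
  have "continuous_on UNIV (\<lambda>p::'k \<times> 'k. h (fst p \<otimes> snd p))"
    by (rule continuous_on_compose2[OF C(1) cf]) simp
  moreover have "continuous_on UNIV (\<lambda>p::'k \<times> 'k. h (fst p))"
    by (rule continuous_on_compose2[OF C(1) continuous_on_fst[OF continuous_on_id]]) simp
  ultimately have "open W"
    unfolding W_def by (intro open_Collect_less continuous_intros)
  have "\<exists>A B. open A \<and> open B \<and> s \<in> A \<and> \<one> \<in> B \<and> A \<times> B \<subseteq> W" for s
  proof -
    have "(s, \<one>) \<in> W" using assms(2) by (simp add: W_def)
    then show ?thesis using open_prod_elim[OF \<open>open W\<close>] by (metis mem_Sigma_iff)
  qed
  then obtain A B where AB: "\<And>s. open (A s)" "\<And>s. open (B s)" "\<And>s. s \<in> A s" "\<And>s. \<one> \<in> B s"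
    "\<And>s. A s \<times> B s \<subseteq> W" by metis
  have "C \<subseteq> (\<Union>s\<in>C. A s)" using AB(3) by blast
  then obtain S where S: "S \<subseteq> C" "finite S" "C \<subseteq> (\<Union>s\<in>S. A s)"
    using compactE_image[OF C(2), of C A] AB(1) by metis
  define V1 where "V1 = (\<Inter>s\<in>S. B s)"
  have V1: "open V1" "\<one> \<in> V1" using S(2) AB(2,4) by (auto simp: V1_def)
  have 1: "\<bar>h (y \<otimes> v) - h y\<bar> < \<delta>" if "y \<in> C" "v \<in> V1" for y v
  proof -
    obtain s where "s \<in> S" "y \<in> A s" using S(3) \<open>y \<in> C\<close> by blast
    then have "(y, v) \<in> W" using AB(5)[of s] \<open>v \<in> V1\<close> by (auto simp: V1_def)
    then show ?thesis by (simp add: W_def)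
  qed
  define V where "V = V1 \<inter> (\<lambda>v. inv v) -` V1"
  have "open V"
    unfolding V_def using V1(1) by (intro open_Int open_vimage continuous_intros) auto
  moreover have "\<one> \<in> V" using V1(2) by (simp add: V_def)
  moreover have "\<bar>h x - h y\<bar> < \<delta>" if v: "inv y \<otimes> x \<in> V" for x y
  proof (cases "y \<in> C")
    case True
    then show ?thesis using 1[of y "inv y \<otimes> x"] v by (simp add: V_def)
  next
    case False
    show ?thesis
    proof (cases "x \<in> C")
      case True
      have "x \<otimes> inv (inv y \<otimes> x) = y" by simp
      then show ?thesis using 1[OF True, of "inv (inv y \<otimes> x)"] v unfolding V_def by (metis IntD2 abs_minus_commute vimage_eq)
    qed (use C(3) False assms(2) in auto)
  qed
  ultimately show ?thesis using that by blast
qed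

subsection \<open>Covering numbers\<close>

text \<open>The combination \<open>\<Sum> c * \<phi> (s\<inverse> t)\<close> of left translates of \<open>\<phi>\<close>. The infimum of the total coefficients
  of such combinations above \<open>f\<close> is Haar's covering number \<open>(f : \<phi>)\<close>, here \<open>cov f \<phi>\<close>.\<close>

definition lc :: "('k \<Rightarrow> real) \<Rightarrow> (real \<times> 'k) list \<Rightarrow> 'k \<Rightarrow> real" where
  "lc \<phi> xs t = (\<Sum>(c, s)\<leftarrow>xs. c * \<phi> (inv s \<otimes> t))"

definition wt :: "(real \<times> 'k) list \<Rightarrow> real" where
  "wt xs = (\<Sum>(c, s)\<leftarrow>xs. c)"

definition covers :: "('k \<Rightarrow> real) \<Rightarrow> ('k \<Rightarrow> real) \<Rightarrow> (real \<times> 'k) list \<Rightarrow> bool" where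
  "covers f \<phi> xs \<longleftrightarrow> (\<forall>(c, s)\<in>set xs. c \<ge> 0) \<and> (\<forall>t. f t \<le> lc \<phi> xs t)"

definition cov :: "('k \<Rightarrow> real) \<Rightarrow> ('k \<Rightarrow> real) \<Rightarrow> real" where
  "cov f \<phi> = Inf (wt ` {xs. covers f \<phi> xs})"

lemma lc_simps [simp]: "lc \<phi> [] t = 0" "lc \<phi> ((c, s) # xs) t = c * \<phi> (inv s \<otimes> t) + lc \<phi> xs t"
  "lc \<phi> (xs @ ys) t = lc \<phi> xs t + lc \<phi> ys t"
  by (simp_all add: lc_def)

lemma wt_simps [simp]: "wt [] = 0" "wt ((c, s) # xs) = c + wt xs" "wt (xs @ ys) = wt xs + wt ys"
  by (simp_all add: wt_def)

lemma wt_nonneg: "\<forall>(c, s)\<in>set xs. c \<ge> 0 \<Longrightarrow> wt xs \<ge> 0"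
  by (induction xs) auto

lemma bdd_below_wt: "bdd_below (wt ` {xs. covers f \<phi> xs})"
  by (rule bdd_belowI[of _ 0]) (auto simp: covers_def wt_nonneg)

lemma cov_le: "covers f \<phi> xs \<Longrightarrow> cov f \<phi> \<le> wt xs"
  unfolding cov_def by (intro cInf_lower bdd_below_wt) auto

lemma ex_covers:
  assumes f: "f \<in> Cp" and \<phi>: "\<phi> \<in> Cp" "\<phi> s0 > 0"
  shows "\<exists>xs. covers f \<phi> xs"
proof -
  obtain C where C: "continuous_on UNIV f" "compact C" "\<And>t. t \<notin> C \<Longrightarrow> f t = 0" using Cp_Cc[OF f] by (rule CcE) blast
  obtain M where M: "M > 0" "\<And>t. \<bar>f t\<bar> \<le> M" using Cc_bounded[OF Cp_Cc[OF f]] by blast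
  define d where "d = \<phi> s0 / 2"
  have d: "d > 0" using \<phi>(2) by (simp add: d_def)
  define a where "a s = s \<otimes> inv s0" for s
  define W where "W s = {t. \<phi> (inv (a s) \<otimes> t) > d}" for s
  have c\<phi>: "continuous_on UNIV \<phi>" using \<phi>(1) by (auto simp: Cp_def Cc_def)
  have W: "open (W s)" "s \<in> W s" for s
  proof -
    have "continuous_on UNIV (\<lambda>t. \<phi> (inv (a s) \<otimes> t))"
      by (rule continuous_on_compose2[OF c\<phi>]) (auto intro!: continuous_intros)
    then show "open (W s)" unfolding W_def by (intro open_Collect_less continuous_intros)
    have "inv (a s) \<otimes> s = s0" by (simp add: a_def m_assoc)
    then show "s \<in> W s" using \<phi>(2) by (simp add: W_def d_def)
  qed
  obtain S where S: "S \<subseteq> C" "finite S" "C \<subseteq> (\<Union>s\<in>S. W s)"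
    using compactE_image[OF C(2), of C W] W by (metis UN_I subsetI)
  obtain l where l: "set l = S" using finite_list[OF S(2)] by blast
  define xs where "xs = map (\<lambda>s. (M / d, a s)) l"
  have nn: "\<forall>(c, s)\<in>set xs. c \<ge> 0" using M(1) d by (auto simp: xs_def)
  have lcn: "lc \<phi> xs t \<ge> 0" if "\<forall>(c, s)\<in>set xs. c \<ge> 0" for xs t
    using that by (induction xs) (auto intro!: add_nonneg_nonneg mult_nonneg_nonneg Cp_nonneg[OF \<phi>(1)])
  have "f t \<le> lc \<phi> xs t" for t
  proof (cases "t \<in> C")
    case True
    then obtain s where s: "s \<in> set l" "t \<in> W s" using S(3) l by blast
    then obtain l1 l2 where "l = l1 @ s # l2" by (meson split_list)
    then have "lc \<phi> xs t = lc \<phi> (map (\<lambda>s. (M / d, a s)) l1) t + (M / d * \<phi> (inv (a s) \<otimes> t) + lc \<phi> (map (\<lambda>s. (M / d, a s)) l2) t)"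
      by (simp add: xs_def)
    moreover have "lc \<phi> (map (\<lambda>s. (M / d, a s)) l') t \<ge> 0" for l'
      using M(1) d by (intro lcn) auto
    moreover have "M \<le> M / d * \<phi> (inv (a s) \<otimes> t)"
      using s(2) M(1) d by (simp add: W_def field_simps)
    ultimately have "M \<le> lc \<phi> xs t"
      by (metis (no_types) add_increasing add_increasing2)
    then show ?thesis using M(2)[of t] by linarith
  qed (use C(3) lcn[OF nn] in auto)
  then show ?thesis using nn unfolding covers_def by blast
qed

lemma cov_approx:
  assumes "f \<in> Cp" "\<phi> \<in> Cp" "\<phi> s0 > 0" "\<epsilon> > 0"
  obtains xs where "covers f \<phi> xs" "wt xs < cov f \<phi> + \<epsilon>"
proof -
  have "wt ` {xs. covers f \<phi> xs} \<noteq> {}" using ex_covers[OF assms(1-3)] by blast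
  then have "\<exists>w\<in>wt ` {xs. covers f \<phi> xs}. w < cov f \<phi> + \<epsilon>"
    using cInf_lessD[of "wt ` {xs. covers f \<phi> xs}" "cov f \<phi> + \<epsilon>"] assms(4) unfolding cov_def by fastforce
  then show ?thesis using that by auto
qed

lemma cov_nonneg: assumes "f \<in> Cp" "\<phi> \<in> Cp" "\<phi> s0 > 0" shows "cov f \<phi> \<ge> 0"
  unfolding cov_def
  using ex_covers[OF assms] by (intro cInf_greatest) (auto simp: covers_def wt_nonneg)

lemma lc_le:
  assumes "\<forall>(c, s)\<in>set xs. c \<ge> 0" "\<And>t. \<phi> t \<le> M"
  shows "lc \<phi> xs t \<le> M * wt xs"
  using assms(1)
proof (induction xs)
  case (Cons x xs)
  obtain c s where x: "x = (c, s)" by (cases x)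
  have "c * \<phi> (inv s \<otimes> t) \<le> c * M" using Cons.prems assms(2) by (intro mult_left_mono) (auto simp: x)
  then show ?case using Cons by (simp add: x algebra_simps)
qed simp

lemma cov_pos:
  assumes f: "f \<in> Cp" "f t0 > 0" and \<phi>: "\<phi> \<in> Cp" "\<phi> s0 > 0"
  shows "cov f \<phi> > 0"
proof -
  obtain M where M: "M > 0" "\<And>t. \<bar>\<phi> t\<bar> \<le> M" using Cc_bounded[OF Cp_Cc[OF \<phi>(1)]] by blast
  have M': "\<phi> t \<le> M" for t using M(2)[of t] by simp
  have "f t0 / M \<le> cov f \<phi>"
    unfolding cov_def
  proof (rule cInf_greatest)
    show "wt ` {xs. covers f \<phi> xs} \<noteq> {}" using ex_covers[OF f(1) \<phi>] by blast
    fix w assume "w \<in> wt ` {xs. covers f \<phi> xs}"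
    then obtain xs where xs: "w = wt xs" "covers f \<phi> xs" by blast
    have "f t0 \<le> M * wt xs" using xs(2) lc_le[OF _ M', where xs = xs and t = t0] unfolding covers_def by (meson order_trans)
    then show "f t0 / M \<le> w" using M(1) xs(1) by (simp add: field_simps)
  qed
  moreover have "f t0 / M > 0" using f(2) M(1) by simp
  ultimately show ?thesis by linarith
qed

lemma cov_mono:
  assumes "f \<in> Cp" "g \<in> Cp" "\<phi> \<in> Cp" "\<phi> s0 > 0" "\<And>t. f t \<le> g t"
  shows "cov f \<phi> \<le> cov g \<phi>"
proof (rule field_le_epsilon)
  fix e :: real assume "e > 0"
  then obtain xs where xs: "covers g \<phi> xs" "wt xs < cov g \<phi> + e" by (rule cov_approx[OF assms(2-4)])
  have "covers f \<phi> xs" using xs(1) assms(5) unfolding covers_def by (meson order_trans)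
  then show "cov f \<phi> \<le> cov g \<phi> + e" using cov_le xs(2) by force
qed

lemma cov_add:
  assumes "f \<in> Cp" "g \<in> Cp" "\<phi> \<in> Cp" "\<phi> s0 > 0"
  shows "cov (\<lambda>t. f t + g t) \<phi> \<le> cov f \<phi> + cov g \<phi>"
proof (rule field_le_epsilon)
  fix e :: real assume e: "e > 0"
  then have e2: "e / 2 > 0" by simp
  obtain xs where xs: "covers f \<phi> xs" "wt xs < cov f \<phi> + e / 2" by (rule cov_approx[OF assms(1,3,4) e2])
  obtain ys where ys: "covers g \<phi> ys" "wt ys < cov g \<phi> + e / 2" by (rule cov_approx[OF assms(2,3,4) e2])
  have "covers (\<lambda>t. f t + g t) \<phi> (xs @ ys)"
    using xs(1) ys(1) unfolding covers_def by (auto intro: add_mono)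
  from cov_le[OF this] show "cov (\<lambda>t. f t + g t) \<phi> \<le> cov f \<phi> + cov g \<phi> + e"
    using xs(2) ys(2) by simp
qed

lemma cov_scale_le:
  assumes "f \<in> Cp" "\<phi> \<in> Cp" "\<phi> s0 > 0" "c > 0"
  shows "cov (\<lambda>t. c * f t) \<phi> \<le> c * cov f \<phi>"
proof (rule field_le_epsilon)
  fix e :: real assume "e > 0"
  then have "e / c > 0" using assms(4) by simp
  then obtain xs where xs: "covers f \<phi> xs" "wt xs < cov f \<phi> + e / c" by (rule cov_approx[OF assms(1-3)])
  let ?ys = "map (\<lambda>(a, s). (c * a, s)) xs"
  have "lc \<phi> ?ys t = c * lc \<phi> xs t" for t by (induction xs) (auto simp: algebra_simps)
  then have "covers (\<lambda>t. c * f t) \<phi> ?ys"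
    using xs(1) assms(4) unfolding covers_def by (auto intro!: mult_left_mono)
  moreover have "wt ?ys = c * wt xs" by (induction xs) (auto simp: algebra_simps)
  ultimately have "cov (\<lambda>t. c * f t) \<phi> \<le> c * wt xs" using cov_le by metis
  also have "\<dots> \<le> c * (cov f \<phi> + e / c)" using xs(2) assms(4) by (intro mult_left_mono) auto
  finally show "cov (\<lambda>t. c * f t) \<phi> \<le> c * cov f \<phi> + e" using assms(4) by (simp add: algebra_simps)
qed

lemma cov_scale:
  assumes "f \<in> Cp" "\<phi> \<in> Cp" "\<phi> s0 > 0" "c > 0"
  shows "cov (\<lambda>t. c * f t) \<phi> = c * cov f \<phi>"
proof (rule antisym)
  have "cov (\<lambda>t. inverse c * (c * f t)) \<phi> \<le> inverse c * cov (\<lambda>t. c * f t) \<phi>"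
    using assms by (intro cov_scale_le[of _ _ s0] Cp_scale) auto
  then show "c * cov f \<phi> \<le> cov (\<lambda>t. c * f t) \<phi>" using assms(4) by (simp add: field_simps)
qed (rule cov_scale_le[OF assms])

lemma cov_translate_le:
  assumes "f \<in> Cp" "\<phi> \<in> Cp" "\<phi> s0 > 0"
  shows "cov (\<lambda>t. f (g \<otimes> t)) \<phi> \<le> cov f \<phi>"
proof (rule field_le_epsilon)
  fix e :: real assume "e > 0"
  then obtain xs where xs: "covers f \<phi> xs" "wt xs < cov f \<phi> + e" by (rule cov_approx[OF assms(1-3)])
  let ?ys = "map (\<lambda>(a, s). (a, inv g \<otimes> s)) xs"
  have "lc \<phi> ?ys t = lc \<phi> xs (g \<otimes> t)" for t by (induction xs) (auto simp: m_assoc)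
  then have "covers (\<lambda>t. f (g \<otimes> t)) \<phi> ?ys"
    using xs(1) unfolding covers_def by auto
  moreover have "wt ?ys = wt xs" by (induction xs) auto
  ultimately show "cov (\<lambda>t. f (g \<otimes> t)) \<phi> \<le> cov f \<phi> + e" using cov_le xs(2) by fastforce
qed

lemma cov_translate:
  assumes "f \<in> Cp" "\<phi> \<in> Cp" "\<phi> s0 > 0"
  shows "cov (\<lambda>t. f (g \<otimes> t)) \<phi> = cov f \<phi>"
proof (rule antisym)
  show "cov f \<phi> \<le> cov (\<lambda>t. f (g \<otimes> t)) \<phi>"
    using cov_translate_le[OF Cp_translate[OF assms(1)] assms(2,3), of g "inv g"] by simp
qed (rule cov_translate_le[OF assms])

lemma cov_trans:
  assumes f: "f \<in> Cp" and \<psi>: "\<psi> \<in> Cp" "\<psi> s1 > 0" and \<phi>: "\<phi> \<in> Cp" "\<phi> s0 > 0"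
  shows "cov f \<phi> \<le> cov f \<psi> * cov \<psi> \<phi>"
proof -
  have 1: "cov f \<phi> \<le> wt xs * cov \<psi> \<phi>" if xs: "covers f \<psi> xs" for xs
  proof -
    have nn: "\<forall>(c, s)\<in>set xs. c \<ge> 0" using xs unfolding covers_def by blast
    have lcC: "lc \<psi> xs \<in> Cp \<and> cov (lc \<psi> xs) \<phi> \<le> wt xs * cov \<psi> \<phi>" using nn
    proof (induction xs)
      case Nil
      have "(\<lambda>t. 0 * \<psi> t) \<in> Cp" by (intro Cp_scale \<psi>) simp
      then have "lc \<psi> [] \<in> Cp" by (simp add: lc_def[abs_def])
      moreover have "covers (lc \<psi> []) \<phi> []" by (simp add: covers_def)
      then have "cov (lc \<psi> []) \<phi> \<le> 0" using cov_le by fastforce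
      ultimately show ?case by (simp only: wt_simps mult_zero_left simp_thms)
    next
      case (Cons x xs)
      obtain c s where x: "x = (c, s)" by (cases x)
      have c: "c \<ge> 0" using Cons.prems by (simp add: x)
      have IH: "lc \<psi> xs \<in> Cp" "cov (lc \<psi> xs) \<phi> \<le> wt xs * cov \<psi> \<phi>" using Cons by auto
      have t: "(\<lambda>t. \<psi> (inv s \<otimes> t)) \<in> Cp" by (rule Cp_translate[OF \<psi>(1)])
      have eq: "lc \<psi> (x # xs) = (\<lambda>t. c * \<psi> (inv s \<otimes> t) + lc \<psi> xs t)" by (simp add: x fun_eq_iff)
      have "cov (\<lambda>t. c * \<psi> (inv s \<otimes> t)) \<phi> \<le> c * cov \<psi> \<phi>"
      proof (cases "c = 0")
        case True
        have "covers (\<lambda>t. 0) \<phi> []" by (simp add: covers_def)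
        then show ?thesis using True cov_le by fastforce
      next
        case False
        then show ?thesis using cov_scale[OF t \<phi>, of c] c cov_translate[OF \<psi>(1) \<phi>, of "inv s"] by simp
      qed
      moreover have "cov (lc \<psi> (x # xs)) \<phi> \<le> cov (\<lambda>t. c * \<psi> (inv s \<otimes> t)) \<phi> + cov (lc \<psi> xs) \<phi>"
        unfolding eq by (rule cov_add[OF Cp_scale[OF t c] IH(1) \<phi>])
      moreover have "wt (x # xs) * cov \<psi> \<phi> = c * cov \<psi> \<phi> + wt xs * cov \<psi> \<phi>"
        by (simp add: x distrib_right)
      ultimately have "cov (lc \<psi> (x # xs)) \<phi> \<le> wt (x # xs) * cov \<psi> \<phi>" using IH(2) by linarith
      then show ?case using Cp_add[OF Cp_scale[OF t c] IH(1)] by (simp add: eq)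
    qed
    have "cov f \<phi> \<le> cov (lc \<psi> xs) \<phi>"
      using xs lcC by (intro cov_mono[OF f _ \<phi>]) (auto simp: covers_def)
    then show ?thesis using lcC by linarith
  qed
  have p: "cov \<psi> \<phi> > 0" by (rule cov_pos[OF \<psi> \<phi>])
  have "cov f \<phi> / cov \<psi> \<phi> \<le> cov f \<psi>"
    unfolding cov_def[of f \<psi>]
  proof (rule cInf_greatest)
    show "wt ` {xs. covers f \<psi> xs} \<noteq> {}" using ex_covers[OF f \<psi>] by blast
    show "cov f \<phi> / cov \<psi> \<phi> \<le> w" if "w \<in> wt ` {xs. covers f \<psi> xs}" for w
      using that 1 p by (auto simp: field_simps)
  qed
  then show ?thesis using p by (simp add: field_simps)
qed

subsection \<open>The invariant functional\<close>

lemma Cp_quotient: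
  assumes f: "f \<in> Cp" and F: "continuous_on UNIV F" and C: "compact C" "\<And>t. t \<notin> C \<Longrightarrow> f t = 0" "\<And>t. t \<in> C \<Longrightarrow> F t > 0"
    and nn: "\<And>t. F t \<ge> 0"
  shows "(\<lambda>t. f t / F t) \<in> Cp"
proof -
  have cf: "continuous_on UNIV f" using f by (auto simp: Cp_def Cc_def)
  have "isCont (\<lambda>t. f t / F t) t" for t
  proof (cases "t \<in> C")
    case True
    then show ?thesis using C(3)[OF True] cf F
      by (intro isCont_divide) (auto simp: continuous_on_eq_continuous_at)
  next
    case False
    have o: "open (- C)" using compact_imp_closed[OF C(1)] by blast
    have "continuous_on (- C) (\<lambda>t. f t / F t)"
      by (rule continuous_on_eq[OF continuous_on_const[of _ 0]]) (use C(2) in auto)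
    then show ?thesis using o False continuous_on_eq_continuous_at by blast
  qed
  then have "continuous_on UNIV (\<lambda>t. f t / F t)" by (simp add: continuous_at_imp_continuous_on)
  then have "(\<lambda>t. f t / F t) \<in> Cc" by (rule CcI[OF _ C(1)]) (simp add: C(2))
  then show ?thesis using Cp_nonneg[OF f] nn by (simp add: Cp_def)
qed

text \<open>Let \<open>F\<close> be slightly larger than \<open>f1 + f2\<close>, positive on the supports, and \<open>h1 = f1 / F\<close>, \<open>h2 = f2 / F\<close>.
  If the support of \<open>\<phi>\<close> is so small that \<open>h1\<close> and \<open>h2\<close> vary by less than \<open>\<delta>\<close> on its translates, then
  multiplying each coefficient \<open>c\<close> of a cover of \<open>F\<close> at \<open>s\<close> by \<open>h1 s + \<delta>\<close> and \<open>h2 s + \<delta>\<close> gives covers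
  of \<open>f1\<close> and \<open>f2\<close>; their weights add up to almost the weight of the cover of \<open>F\<close>, as
  \<open>h1 + h2 \<le> 1\<close>.\<close>

lemma cov_almost_additive:
  assumes f: "f1 \<in> Cp" "f2 \<in> Cp" and f0: "f0 \<in> Cp" "f0 t0 > 0" and "\<epsilon> > 0"
  obtains V where "open V" "\<one> \<in> V"
    "\<And>\<phi> s0. \<phi> \<in> Cp \<Longrightarrow> \<phi> s0 > 0 \<Longrightarrow> (\<And>t. t \<notin> V \<Longrightarrow> \<phi> t = 0) \<Longrightarrow>
       cov f1 \<phi> + cov f2 \<phi> \<le> cov (\<lambda>t. f1 t + f2 t) \<phi> + \<epsilon> * cov f0 \<phi>"
proof -
  obtain C1 where C1: "continuous_on UNIV f1" "compact C1" "\<And>t. t \<notin> C1 \<Longrightarrow> f1 t = 0" using Cp_Cc[OF f(1)] by (rule CcE) blast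
  obtain C2 where C2: "continuous_on UNIV f2" "compact C2" "\<And>t. t \<notin> C2 \<Longrightarrow> f2 t = 0" using Cp_Cc[OF f(2)] by (rule CcE) blast
  define C where "C = C1 \<union> C2"
  have C: "compact C" using C1(2) C2(2) by (simp add: C_def compact_Un)
  obtain u where u: "u \<in> Cp" "\<And>t. t \<in> C \<Longrightarrow> u t \<ge> 1" using ex_Cp_ge_1[OF C] by blast
  let ?s = "\<lambda>t. f1 t + f2 t"
  have s: "?s \<in> Cp" by (rule Cp_add[OF f])
  define a where "a = cov ?s f0 + cov u f0 + 1"
  have a: "a > 0" "cov ?s f0 \<le> a" "cov u f0 \<le> a"
    using cov_nonneg[OF s f0] cov_nonneg[OF u(1) f0] by (auto simp: a_def)
  \<comment> \<open>The error terms below add up to at most \<open>5 * \<delta> * a * cov f0 \<phi>\<close>.\<close>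
  define \<delta> where "\<delta> = min 1 (\<epsilon> / (5 * a))"
  have \<delta>: "\<delta> > 0" "\<delta> \<le> 1" "5 * \<delta> * a \<le> \<epsilon>"
  proof -
    show "\<delta> > 0" "\<delta> \<le> 1" using a(1) assms(5) by (auto simp: \<delta>_def)
    have "\<delta> * (5 * a) \<le> \<epsilon> / (5 * a) * (5 * a)" using a(1) by (intro mult_right_mono) (auto simp: \<delta>_def)
    then show "5 * \<delta> * a \<le> \<epsilon>" using a(1) by (simp add: mult_ac)
  qed
  define F where "F t = ?s t + \<delta> * u t" for t
  have F: "F \<in> Cp" unfolding F_def[abs_def] using \<delta>(1) by (intro Cp_add s Cp_scale u(1)) auto
  have Fnn: "F t \<ge> 0" for t by (rule Cp_nonneg[OF F])
  have cF: "continuous_on UNIV F" using F by (auto simp: Cp_def Cc_def)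
  have Fpos: "F t > 0" if "t \<in> C" for t
  proof -
    have "\<delta> * u t > 0" using u(2)[OF that] \<delta>(1) by (intro mult_pos_pos) linarith+
    then show ?thesis using Cp_nonneg[OF s, of t] by (simp add: F_def)
  qed
  define h1 where "h1 t = f1 t / F t" for t
  define h2 where "h2 t = f2 t / F t" for t
  have h1: "h1 \<in> Cp" unfolding h1_def[abs_def]
    by (rule Cp_quotient[OF f(1) cF C]) (use C1(3) Fpos Fnn in \<open>auto simp: C_def\<close>)
  have h2: "h2 \<in> Cp" unfolding h2_def[abs_def]
    by (rule Cp_quotient[OF f(2) cF C]) (use C2(3) Fpos Fnn in \<open>auto simp: C_def\<close>)
  have hF: "f1 t = F t * h1 t" "f2 t = F t * h2 t" for t
    using Fpos[of t] C1(3)[of t] C2(3)[of t] by (cases "t \<in> C"; auto simp: h1_def h2_def C_def)+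
  have hsum: "h1 t + h2 t \<le> 1" for t
  proof (cases "t \<in> C")
    case True
    have "f1 t + f2 t \<le> F t" using Cp_nonneg[OF u(1), of t] \<delta>(1) by (simp add: F_def)
    then show ?thesis using Fpos[OF True] by (simp add: h1_def h2_def add_divide_distrib[symmetric])
  next
    case False
    then show ?thesis using C1(3)[of t] C2(3)[of t] by (simp add: h1_def h2_def C_def)
  qed
  obtain V1 where V1: "open V1" "\<one> \<in> V1" "\<And>x y. inv y \<otimes> x \<in> V1 \<Longrightarrow> \<bar>h1 x - h1 y\<bar> < \<delta>"
    using uniformly_continuous[OF Cp_Cc[OF h1] \<delta>(1)] by blast
  obtain V2 where V2: "open V2" "\<one> \<in> V2" "\<And>x y. inv y \<otimes> x \<in> V2 \<Longrightarrow> \<bar>h2 x - h2 y\<bar> < \<delta>"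
    using uniformly_continuous[OF Cp_Cc[OF h2] \<delta>(1)] by blast
  define V where "V = V1 \<inter> V2"
  have main: "cov f1 \<phi> + cov f2 \<phi> \<le> cov ?s \<phi> + \<epsilon> * cov f0 \<phi>"
    if \<phi>: "\<phi> \<in> Cp" "\<phi> s0 > 0" and \<phi>V: "\<And>t. t \<notin> V \<Longrightarrow> \<phi> t = 0" for \<phi> s0
  proof -
    have step: "covers g \<phi> (map (\<lambda>(c, s). (c * (h s + \<delta>), s)) xs)"
      if xs: "covers F \<phi> xs" and g: "\<And>t. g t = F t * h t" and h: "h \<in> Cp"
        and V: "\<And>x y. inv y \<otimes> x \<in> V \<Longrightarrow> \<bar>h x - h y\<bar> < \<delta>" for g h xs
      unfolding covers_def
    proof (intro conjI allI)
      have nn: "\<forall>(c, s)\<in>set xs. c \<ge> 0" using xs unfolding covers_def by blast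
      then show "\<forall>(c, s)\<in>set (map (\<lambda>(c, s). (c * (h s + \<delta>), s)) xs). c \<ge> 0"
        using Cp_nonneg[OF h] \<delta>(1) by (auto intro!: mult_nonneg_nonneg add_nonneg_nonneg)
      fix t
      have tm: "\<phi> (inv s \<otimes> t) * h t \<le> \<phi> (inv s \<otimes> t) * (h s + \<delta>)" for s
      proof (cases "inv s \<otimes> t \<in> V")
        case True
        then show ?thesis using V[OF True] Cp_nonneg[OF \<phi>(1)] by (intro mult_left_mono) auto
      qed (simp add: \<phi>V)
      have "g t = F t * h t" by (rule g)
      also have "\<dots> \<le> lc \<phi> xs t * h t"
        using xs Cp_nonneg[OF h] unfolding covers_def by (intro mult_right_mono) auto
      also have "\<dots> \<le> lc \<phi> (map (\<lambda>(c, s). (c * (h s + \<delta>), s)) xs) t" using nn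
      proof (induction xs)
        case (Cons y ys)
        obtain c s where y: "y = (c, s)" by (cases y)
        have "c * (\<phi> (inv s \<otimes> t) * h t) \<le> c * (\<phi> (inv s \<otimes> t) * (h s + \<delta>))"
          using Cons.prems by (intro mult_left_mono tm) (auto simp: y)
        then show ?case using Cons by (simp add: y algebra_simps)
      qed simp
      finally show "g t \<le> lc \<phi> (map (\<lambda>(c, s). (c * (h s + \<delta>), s)) xs) t" .
    qed
    have 1: "cov f1 \<phi> + cov f2 \<phi> \<le> (1 + 2 * \<delta>) * cov F \<phi>"
    proof (rule field_le_epsilon)
      fix e :: real assume "e > 0"
      then have "e / (1 + 2 * \<delta>) > 0" using \<delta>(1) by simp
      then obtain xs where xs: "covers F \<phi> xs" "wt xs < cov F \<phi> + e / (1 + 2 * \<delta>)"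
        by (rule cov_approx[OF F \<phi>])
      let ?m = "\<lambda>h. map (\<lambda>(c, s). (c * (h s + \<delta>), s)) xs"
      have nn: "\<forall>(c, s)\<in>set xs. c \<ge> 0" using xs(1) unfolding covers_def by blast
      have "cov f1 \<phi> \<le> wt (?m h1)" by (rule cov_le[OF step[OF xs(1) hF(1) h1 V1(3)]]) (simp add: V_def)
      moreover have "cov f2 \<phi> \<le> wt (?m h2)" by (rule cov_le[OF step[OF xs(1) hF(2) h2 V2(3)]]) (simp add: V_def)
      moreover have "wt (?m h1) + wt (?m h2) \<le> (1 + 2 * \<delta>) * wt xs" using nn
      proof (induction xs)
        case (Cons y ys)
        obtain c s where y: "y = (c, s)" by (cases y)
        have "c * (h1 s + h2 s + 2 * \<delta>) \<le> c * (1 + 2 * \<delta>)"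
          using Cons.prems hsum[of s] by (intro mult_left_mono) (auto simp: y)
        then show ?case using Cons by (simp add: y algebra_simps)
      qed simp
      moreover have "(1 + 2 * \<delta>) * wt xs \<le> (1 + 2 * \<delta>) * (cov F \<phi> + e / (1 + 2 * \<delta>))"
        using xs(2) \<delta>(1) by (intro mult_left_mono) auto
      moreover have "(1 + 2 * \<delta>) * (cov F \<phi> + e / (1 + 2 * \<delta>)) = (1 + 2 * \<delta>) * cov F \<phi> + e"
        using \<delta>(1) by (simp add: distrib_left)
      ultimately show "cov f1 \<phi> + cov f2 \<phi> \<le> (1 + 2 * \<delta>) * cov F \<phi> + e" by linarith
    qed
    have p: "cov f0 \<phi> > 0" by (rule cov_pos[OF f0 \<phi>])
    have 2: "cov F \<phi> \<le> cov ?s \<phi> + \<delta> * cov u \<phi>"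
      unfolding F_def[abs_def]
      using cov_add[OF s Cp_scale[OF u(1)] \<phi>, of \<delta>] cov_scale[OF u(1) \<phi> \<delta>(1)] \<delta>(1) by simp
    have 3: "cov ?s \<phi> \<le> a * cov f0 \<phi>"
      using cov_trans[OF s f0 \<phi>] mult_right_mono[OF a(2), of "cov f0 \<phi>"] p by linarith
    have 4: "cov u \<phi> \<le> a * cov f0 \<phi>"
      using cov_trans[OF u(1) f0 \<phi>] mult_right_mono[OF a(3), of "cov f0 \<phi>"] p by linarith
    let ?b = "a * cov f0 \<phi>"
    have b: "?b > 0" using a(1) p by simp
    have "(1 + 2 * \<delta>) * cov F \<phi> \<le> (1 + 2 * \<delta>) * (cov ?s \<phi> + \<delta> * ?b)"
    proof (rule mult_left_mono)
      show "cov F \<phi> \<le> cov ?s \<phi> + \<delta> * ?b"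
        by (rule order_trans[OF 2]) (use 4 \<delta>(1) in \<open>intro add_left_mono mult_left_mono; simp\<close>)
    qed (use \<delta>(1) in simp)
    also have "\<dots> = cov ?s \<phi> + 2 * \<delta> * cov ?s \<phi> + (1 + 2 * \<delta>) * (\<delta> * ?b)" by (simp add: algebra_simps)
    also have "\<dots> \<le> cov ?s \<phi> + 2 * \<delta> * ?b + 3 * (\<delta> * ?b)"
      using mult_left_mono[OF 3, of "2 * \<delta>"] \<delta>(1,2) b by (intro add_mono mult_right_mono) auto
    also have "\<dots> = cov ?s \<phi> + (5 * \<delta> * a) * cov f0 \<phi>" by (simp add: algebra_simps)
    also have "\<dots> \<le> cov ?s \<phi> + \<epsilon> * cov f0 \<phi>" using \<delta>(3) p by (intro add_left_mono mult_right_mono) auto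
    finally show ?thesis using 1 by linarith
  qed
  have "open V" "\<one> \<in> V" using V1 V2 by (auto simp: V_def)
  then show ?thesis using that main by blast
qed

definition cov_ratio :: "('k \<Rightarrow> real) \<Rightarrow> ('k \<Rightarrow> real) \<Rightarrow> ('k \<Rightarrow> real) \<Rightarrow> real" where
  "cov_ratio f0 \<phi> f = (if f \<in> Cp then cov f \<phi> / cov f0 \<phi> else 0)"

text \<open>The normalised covering numbers \<open>cov f \<phi> / cov f0 \<phi>\<close> lie between 0 and \<open>cov f f0\<close>, so as functions
  of \<open>f\<close> they belong to a product of compact intervals. By Tychonoff's theorem the closures \<open>R V\<close> of
  the sets belonging to shrinking supports \<open>V\<close> have a common point \<open>J\<close>. Closed conditions that hold for
  all \<open>\<phi>\<close> supported in some \<open>V\<close> pass to \<open>J\<close>: exact ones such as invariance, and additivity up to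
  every \<open>\<epsilon>\<close>.\<close>

lemma ex_haar_Cp:
  obtains J :: "('k \<Rightarrow> real) \<Rightarrow> real" where
    "\<And>f g. f \<in> Cp \<Longrightarrow> g \<in> Cp \<Longrightarrow> J (\<lambda>t. f t + g t) = J f + J g"
    "\<And>f c. f \<in> Cp \<Longrightarrow> c > 0 \<Longrightarrow> J (\<lambda>t. c * f t) = c * J f"
    "\<And>f g. f \<in> Cp \<Longrightarrow> J (\<lambda>t. f (g \<otimes> t)) = J f"
    "\<And>f. f \<in> Cp \<Longrightarrow> J f \<ge> 0" "\<And>f t. f \<in> Cp \<Longrightarrow> f t > 0 \<Longrightarrow> J f > 0"
proof -
  have "\<exists>\<phi>. \<phi> \<in> Cp \<and> \<phi> \<one> > 0" using bump[OF open_UNIV UNIV_I, of \<one>] by (auto simp: Cp_def Cc_def)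
  then obtain f0 where f0: "f0 \<in> Cp" "f0 \<one> > 0" by blast
  define P where "P V = {\<phi> \<in> Cp. \<phi> \<one> > 0 \<and> (\<forall>t. t \<notin> V \<longrightarrow> \<phi> t = 0)}" for V
  define R where "R V = closure (cov_ratio f0 ` P V)" for V
  define N where "N = {V. open V \<and> \<one> \<in> V}"
  define S where "S f = (if f \<in> Cp then {0..cov f f0} else {0})" for f
  have ratio_S: "cov_ratio f0 \<phi> f \<in> S f" if "\<phi> \<in> P V" for \<phi> f V
  proof (cases "f \<in> Cp")
    case True
    have \<phi>: "\<phi> \<in> Cp" "\<phi> \<one> > 0" using that by (auto simp: P_def)
    have "cov f0 \<phi> > 0" by (rule cov_pos[OF f0 \<phi>])
    then show ?thesis using True cov_nonneg[OF True \<phi>] cov_trans[OF True f0 \<phi>]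
      by (simp add: cov_ratio_def S_def field_simps)
  qed (simp add: cov_ratio_def S_def)
  have cS: "compact (PiE UNIV S)"
  proof -
    have "compactin (product_topology (\<lambda>i. euclidean) UNIV) (PiE UNIV S)"
      by (subst compactin_PiE) (auto simp: S_def)
    then show ?thesis by (simp add: euclidean_product_topology)
  qed
  have clR: "closed (R V)" for V by (simp add: R_def)
  have fip: "PiE UNIV S \<inter> (\<Inter>V\<in>N'. R V) \<noteq> {}" if "finite N'" "N' \<subseteq> N" for N'
  proof -
    have "open (\<Inter>N')" "\<one> \<in> \<Inter>N'" using that by (auto simp: N_def)
    then obtain \<phi> where "\<phi> \<in> P (\<Inter>N')" using bump[of "\<Inter>N'" \<one>] by (auto simp: P_def Cp_def Cc_def)
    moreover have "P (\<Inter>N') \<subseteq> P V" if "V \<in> N'" for V using that by (auto simp: P_def)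
    ultimately have "cov_ratio f0 \<phi> \<in> R V" if "V \<in> N'" for V
      using that closure_subset[of "cov_ratio f0 ` P V"] unfolding R_def by blast
    moreover have "cov_ratio f0 \<phi> \<in> PiE UNIV S" using ratio_S[OF \<open>\<phi> \<in> P (\<Inter>N')\<close>] by auto
    ultimately show ?thesis by blast
  qed
  have "PiE UNIV S \<inter> (\<Inter>V\<in>N. R V) \<noteq> {}" by (rule compact_imp_fip_image[OF cS clR fip])
  then obtain J where J: "\<And>V. open V \<Longrightarrow> \<one> \<in> V \<Longrightarrow> J \<in> R V" by (auto simp: N_def)
  have ev: "continuous_on UNIV (\<lambda>I::('k \<Rightarrow> real) \<Rightarrow> real. I f)" for f by (rule continuous_on_product_coordinates)
  have lim: "Q J" if "open V" "\<one> \<in> V" "closed {I. Q I}" "\<And>\<phi>. \<phi> \<in> P V \<Longrightarrow> Q (cov_ratio f0 \<phi>)" for V Q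
  proof -
    have "R V \<subseteq> {I. Q I}" unfolding R_def using that(3,4) by (intro closure_minimal) auto
    then show ?thesis using J[OF that(1,2)] by blast
  qed
  have PV: "\<phi> \<in> Cp" "\<phi> \<one> > 0" "cov f0 \<phi> > 0" if "\<phi> \<in> P V" for \<phi> V
    using that cov_pos[OF f0, of \<phi> \<one>] by (auto simp: P_def)
  show ?thesis
  proof (rule that)
    fix f g assume f: "f \<in> Cp" and g: "g \<in> Cp"
    note fg = Cp_add[OF f g]
    show "J (\<lambda>t. f t + g t) = J f + J g"
    proof (rule antisym)
      show "J (\<lambda>t. f t + g t) \<le> J f + J g"
      proof (rule lim[OF open_UNIV UNIV_I])
        show "closed {I :: ('k \<Rightarrow> real) \<Rightarrow> real. I (\<lambda>t. f t + g t) \<le> I f + I g}"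
          by (rule closed_Collect_le[OF ev continuous_on_add[OF ev ev]])
        fix \<phi> assume \<phi>: "\<phi> \<in> P UNIV"
        show "cov_ratio f0 \<phi> (\<lambda>t. f t + g t) \<le> cov_ratio f0 \<phi> f + cov_ratio f0 \<phi> g"
          using cov_add[OF f g PV(1,2)[OF \<phi>]] PV(3)[OF \<phi>] f g fg by (simp add: cov_ratio_def field_simps)
      qed
      show "J f + J g \<le> J (\<lambda>t. f t + g t)"
      proof (rule field_le_epsilon)
        fix e :: real assume e: "e > 0"
        obtain V where V: "open V" "\<one> \<in> V" "\<And>\<phi> s0. \<phi> \<in> Cp \<Longrightarrow> \<phi> s0 > 0 \<Longrightarrow> (\<And>t. t \<notin> V \<Longrightarrow> \<phi> t = 0) \<Longrightarrow>
            cov f \<phi> + cov g \<phi> \<le> cov (\<lambda>t. f t + g t) \<phi> + e * cov f0 \<phi>"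
          by (rule cov_almost_additive[OF f g f0 e]) blast
        show "J f + J g \<le> J (\<lambda>t. f t + g t) + e"
        proof (rule lim[OF V(1,2)])
          show "closed {I :: ('k \<Rightarrow> real) \<Rightarrow> real. I f + I g \<le> I (\<lambda>t. f t + g t) + e}"
            by (rule closed_Collect_le[OF continuous_on_add[OF ev ev] continuous_on_add[OF ev continuous_on_const]])
          fix \<phi> assume \<phi>: "\<phi> \<in> P V"
          have "cov f \<phi> + cov g \<phi> \<le> cov (\<lambda>t. f t + g t) \<phi> + e * cov f0 \<phi>"
            by (rule V(3)[OF PV(1,2)[OF \<phi>]]) (use \<phi> in \<open>simp add: P_def\<close>)
          then have "(cov f \<phi> + cov g \<phi>) / cov f0 \<phi> \<le> (cov (\<lambda>t. f t + g t) \<phi> + e * cov f0 \<phi>) / cov f0 \<phi>"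
            using PV(3)[OF \<phi>] by (intro divide_right_mono) auto
          then show "cov_ratio f0 \<phi> f + cov_ratio f0 \<phi> g \<le> cov_ratio f0 \<phi> (\<lambda>t. f t + g t) + e"
            using PV(3)[OF \<phi>] f g fg by (simp add: cov_ratio_def add_divide_distrib)
        qed
      qed
    qed
  next
    fix f :: "'k \<Rightarrow> real" and c :: real assume f: "f \<in> Cp" and c: "c > 0"
    have cf: "(\<lambda>t. c * f t) \<in> Cp" using Cp_scale[OF f] c by simp
    show "J (\<lambda>t. c * f t) = c * J f"
    proof (rule lim[OF open_UNIV UNIV_I])
      show "closed {I :: ('k \<Rightarrow> real) \<Rightarrow> real. I (\<lambda>t. c * f t) = c * I f}"
        by (rule closed_Collect_eq[OF ev continuous_on_mult_left[OF ev]])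
      show "cov_ratio f0 \<phi> (\<lambda>t. c * f t) = c * cov_ratio f0 \<phi> f" if "\<phi> \<in> P UNIV" for \<phi>
        using cov_scale[OF f PV(1,2)[OF that] c] f cf by (simp add: cov_ratio_def)
    qed
  next
    fix f :: "'k \<Rightarrow> real" and g assume f: "f \<in> Cp"
    show "J (\<lambda>t. f (g \<otimes> t)) = J f"
    proof (rule lim[OF open_UNIV UNIV_I])
      show "closed {I :: ('k \<Rightarrow> real) \<Rightarrow> real. I (\<lambda>t. f (g \<otimes> t)) = I f}" by (rule closed_Collect_eq[OF ev ev])
      show "cov_ratio f0 \<phi> (\<lambda>t. f (g \<otimes> t)) = cov_ratio f0 \<phi> f" if "\<phi> \<in> P UNIV" for \<phi>
        using cov_translate[OF f PV(1,2)[OF that]] f Cp_translate[OF f] by (simp add: cov_ratio_def)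
    qed
  next
    fix f assume f: "f \<in> Cp"
    show "J f \<ge> 0"
    proof (rule lim[OF open_UNIV UNIV_I])
      show "closed {I :: ('k \<Rightarrow> real) \<Rightarrow> real. I f \<ge> (0::real)}" by (rule closed_Collect_le[OF continuous_on_const ev])
      show "cov_ratio f0 \<phi> f \<ge> 0" if "\<phi> \<in> P UNIV" for \<phi>
        using ratio_S[OF that, of f] f by (simp add: S_def)
    qed
  next
    fix f t assume f: "f \<in> Cp" "f t > 0"
    have q: "cov f0 f > 0" by (rule cov_pos[OF f0 f])
    have "J f \<ge> 1 / cov f0 f"
    proof (rule lim[OF open_UNIV UNIV_I])
      show "closed {I :: ('k \<Rightarrow> real) \<Rightarrow> real. I f \<ge> 1 / cov f0 f}" by (rule closed_Collect_le[OF continuous_on_const ev])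
      fix \<phi> assume \<phi>: "\<phi> \<in> P UNIV"
      show "cov_ratio f0 \<phi> f \<ge> 1 / cov f0 f"
        using cov_trans[OF f0(1) f PV(1,2)[OF \<phi>]] PV(3)[OF \<phi>] q f(1)
        by (simp add: cov_ratio_def field_simps)
    qed
    moreover have "1 / cov f0 f > 0" using q by simp
    ultimately show "J f > 0" by linarith
  qed
qed

text \<open>A difference of two functions in \<open>Cp\<close> is sent to the difference of the values; by additivity on \<open>Cp\<close>
  this does not depend on the decomposition, so the positive and negative part may be used.\<close>

theorem ex_haar:
  obtains I :: "('k \<Rightarrow> real) \<Rightarrow> real" where
    "\<And>f g a b. f \<in> Cc \<Longrightarrow> g \<in> Cc \<Longrightarrow> I (\<lambda>t. a * f t + b * g t) = a * I f + b * I g"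
    "\<And>f g. f \<in> Cc \<Longrightarrow> I (\<lambda>t. f (g \<otimes> t)) = I f"
    "\<And>f. f \<in> Cp \<Longrightarrow> I f \<ge> 0" "\<And>f t. f \<in> Cp \<Longrightarrow> f t > 0 \<Longrightarrow> I f > 0"
proof -
  obtain J :: "('k \<Rightarrow> real) \<Rightarrow> real" where
    J: "\<And>f g. f \<in> Cp \<Longrightarrow> g \<in> Cp \<Longrightarrow> J (\<lambda>t. f t + g t) = J f + J g"
    "\<And>f c. f \<in> Cp \<Longrightarrow> c > 0 \<Longrightarrow> J (\<lambda>t. c * f t) = c * J f"
    "\<And>f g. f \<in> Cp \<Longrightarrow> J (\<lambda>t. f (g \<otimes> t)) = J f"
    "\<And>f. f \<in> Cp \<Longrightarrow> J f \<ge> 0" "\<And>f t. f \<in> Cp \<Longrightarrow> f t > 0 \<Longrightarrow> J f > 0"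
    by (rule ex_haar_Cp) blast
  define I where "I f = J (\<lambda>t. max (f t) 0) - J (\<lambda>t. max (- f t) 0)" for f
  have pos: "(\<lambda>t. max (f t) 0) \<in> Cp" if f: "f \<in> Cc" for f
  proof -
    obtain C where C: "continuous_on UNIV f" "compact C" "\<And>t. t \<notin> C \<Longrightarrow> f t = 0" using f by (rule CcE) blast
    have "(\<lambda>t. max (f t) 0) \<in> Cc" by (rule CcI[of _ C]) (auto intro!: continuous_intros C simp: C(3))
    then show ?thesis by (simp add: Cp_def)
  qed
  have neg: "(\<lambda>t. max (- f t) 0) \<in> Cp" if f: "f \<in> Cc" for f
    using pos[OF Cc_lincomb[OF f f, of "-1" 0]] by simp
  have I_eq: "I f = J g - J h" if g: "g \<in> Cp" and h: "h \<in> Cp" and f: "\<And>t. f t = g t - h t" for f g h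
  proof -
    have "f = (\<lambda>t. g t - h t)" using f by auto
    then have fC: "f \<in> Cc" using Cc_lincomb[OF Cp_Cc[OF g] Cp_Cc[OF h], of 1 "-1"] by simp
    have "(\<lambda>t. max (f t) 0 + h t) = (\<lambda>t. max (- f t) 0 + g t)" using f by (auto simp: max_def fun_eq_iff)
    then have "J (\<lambda>t. max (f t) 0) + J h = J (\<lambda>t. max (- f t) 0) + J g"
      using J(1)[OF pos[OF fC] h] J(1)[OF neg[OF fC] g] by simp
    then show ?thesis by (simp add: I_def)
  qed
  have split: "f t = max (f t) 0 - max (- f t) 0" for f :: "'k \<Rightarrow> real" and t by (auto simp: max_def)
  have zero: "J (\<lambda>t. 0) = 0" if "f \<in> Cp" for f
    using J(1)[of "\<lambda>t. 0" "\<lambda>t. 0"] Cp_scale[OF that, of 0] by simp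
  have J_scale: "J (\<lambda>t. c * f t) = c * J f" if "f \<in> Cp" "c \<ge> 0" for f c
    using J(2)[OF that(1), of c] that zero[OF that(1)] by (cases "c = 0") auto
  have I_add: "I (\<lambda>t. f t + g t) = I f + I g" if f: "f \<in> Cc" and g: "g \<in> Cc" for f g
  proof -
    have "I (\<lambda>t. f t + g t) = J (\<lambda>t. max (f t) 0 + max (g t) 0) - J (\<lambda>t. max (- f t) 0 + max (- g t) 0)"
      by (rule I_eq) (use split[of f] split[of g] in \<open>auto intro!: Cp_add pos neg f g\<close>)
    then show ?thesis using J(1)[OF pos[OF f] pos[OF g]] J(1)[OF neg[OF f] neg[OF g]] by (simp add: I_def)
  qed
  have I_scale: "I (\<lambda>t. c * f t) = c * I f" if f: "f \<in> Cc" for c f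
  proof (cases "c \<ge> 0")
    case True
    have "I (\<lambda>t. c * f t) = J (\<lambda>t. c * max (f t) 0) - J (\<lambda>t. c * max (- f t) 0)"
    proof (rule I_eq)
      show "c * f t = c * max (f t) 0 - c * max (- f t) 0" for t
        by (subst split[of f t]) (simp only: right_diff_distrib)
    qed (intro Cp_scale pos neg f True)+
    then show ?thesis using J_scale[OF pos[OF f] True] J_scale[OF neg[OF f] True] by (simp add: I_def right_diff_distrib)
  next
    case False
    then have c: "- c \<ge> 0" by simp
    have "I (\<lambda>t. c * f t) = J (\<lambda>t. - c * max (- f t) 0) - J (\<lambda>t. - c * max (f t) 0)"
    proof (rule I_eq)
      show "c * f t = - c * max (- f t) 0 - - c * max (f t) 0" for t
        by (subst split[of f t]) (simp add: algebra_simps)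
    qed (intro Cp_scale pos neg f c)+
    then show ?thesis using J_scale[OF pos[OF f] c] J_scale[OF neg[OF f] c] by (simp add: I_def algebra_simps)
  qed
  have I_Cp: "I f = J f" if "f \<in> Cp" for f
    using I_eq[OF that Cp_scale[OF that, of 0], of f] zero[OF that] by simp
  show ?thesis
  proof (rule that)
    show "I (\<lambda>t. a * f t + b * g t) = a * I f + b * I g" if "f \<in> Cc" "g \<in> Cc" for f g a b
      using I_add[of "\<lambda>t. a * f t" "\<lambda>t. b * g t"] Cc_lincomb[OF that(1,1), of a 0]
        Cc_lincomb[OF that(2,2), of b 0] I_scale[OF that(1)] I_scale[OF that(2)] by simp
    show "I (\<lambda>t. f (g \<otimes> t)) = I f" if "f \<in> Cc" for f g
      using J(3)[OF pos[OF that]] J(3)[OF neg[OF that]] by (simp add: I_def)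
    show "I f \<ge> 0" if "f \<in> Cp" for f using J(4)[OF that] I_Cp[OF that] by simp
    show "I f > 0" if "f \<in> Cp" "f t > 0" for f t using J(5)[OF that] I_Cp[OF that(1)] by simp
  qed
qed

lemma haar_bounded_functional:
  assumes I: "\<And>f g a b. f \<in> Cc \<Longrightarrow> g \<in> Cc \<Longrightarrow> I (\<lambda>t. a * f t + b * g t) = a * I f + b * I g"
    "\<And>f. f \<in> Cp \<Longrightarrow> I f \<ge> 0" and T: "compact T" "T \<noteq> {}"
  obtains M where "bounded_functional I T T M"
proof -
  obtain u where u: "u \<in> Cp" "\<And>t. t \<in> T \<Longrightarrow> u t \<ge> 1" using ex_Cp_ge_1[OF T(1)] by blast
  have "bounded_functional I T T (I u)"
  proof
    show "I (\<lambda>s. a * f s + b * g s) = a * I f + b * I g"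
      if "continuous_on UNIV f" "continuous_on UNIV g" "\<And>s. s \<notin> T \<Longrightarrow> f s = 0" "\<And>s. s \<notin> T \<Longrightarrow> g s = 0" for f g a b
      by (rule I(1)) (use that T(1) in \<open>auto simp: Cc_def\<close>)
    show "\<bar>I f\<bar> \<le> I u * \<epsilon>"
      if f: "continuous_on UNIV f" "\<And>s. s \<notin> T \<Longrightarrow> f s = 0" "\<And>s. s \<in> T \<Longrightarrow> \<bar>f s\<bar> \<le> \<epsilon>" for f \<epsilon>
    proof -
      obtain t0 where "t0 \<in> T" using T(2) by blast
      then have e: "\<epsilon> \<ge> 0" using f(3)[of t0] by linarith
      have fC: "f \<in> Cc" using f T(1) by (auto simp: Cc_def)
      have le: "\<bar>f t\<bar> \<le> \<epsilon> * u t" for t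
      proof (cases "t \<in> T")
        case True
        have "\<epsilon> * 1 \<le> \<epsilon> * u t" using u(2)[OF True] e by (intro mult_left_mono) auto
        then show ?thesis using f(3)[OF True] by simp
      qed (use f(2) e Cp_nonneg[OF u(1)] in simp)
      have uC: "u \<in> Cc" by (rule Cp_Cc[OF u(1)])
      have "(\<lambda>t. \<epsilon> * u t + 1 * f t) \<in> Cp" "(\<lambda>t. \<epsilon> * u t + (-1) * f t) \<in> Cp"
        unfolding Cp_def
      proof (safe intro!: Cc_lincomb uC fC)
        fix t
        show "0 \<le> \<epsilon> * u t + 1 * f t" "0 \<le> \<epsilon> * u t + (-1) * f t" using le[of t] by auto
      qed
      from I(2)[OF this(1)] I(2)[OF this(2)]
      show ?thesis using I(1)[OF uC fC, of \<epsilon> 1] I(1)[OF uC fC, of \<epsilon> "-1"] by (simp add: abs_le_iff mult.commute)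
    qed
    show "compact T" by (rule T(1))
    show "I u \<ge> 0" by (rule I(2)[OF u(1)])
  qed
  then show ?thesis using that by blast
qed

end

section \<open>Differentials and smooth maps\<close>

text \<open>Only smoothness of the pulled back functions enters, so the statement applies to orbit maps and
  translations alike.\<close>

lemma push_tangent:
  fixes A :: "('m::t2_space, 'e::{real_inner,heine_borel}) chart set"
    and B :: "('n::t2_space, 'f::{real_inner,heine_borel}) chart set"
  assumes "manifold A" "manifold B" and F: "\<And>h. smooth_fun B h \<Longrightarrow> smooth_fun A (\<lambda>p. h (F p))"
    and v: "v \<in> tangent A p"
  shows "push B F v \<in> tangent B (F p)"
proof -
  interpret A: manifold A by fact
  interpret B: manifold B by fact
  show ?thesis
    unfolding tangent_def
  proof (intro CollectI conjI allI impI)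
    fix f g a b assume f: "smooth_fun B f" and g: "smooth_fun B g"
    have "smooth_fun B (\<lambda>x. a * f x + b * g x)"
      by (intro B.smooth_fun_add B.smooth_fun_mult B.smooth_fun_const f g)
    then show "push B F v (\<lambda>x. a * f x + b * g x) = a * push B F v f + b * push B F v g"
      using f g A.tangent_lin[OF v F[OF f] F[OF g]] by (simp add: push_def o_def)
  next
    fix f g assume f: "smooth_fun B f" and g: "smooth_fun B g"
    show "push B F v (\<lambda>x. f x * g x) = f (F p) * push B F v g + g (F p) * push B F v f"
      using f g B.smooth_fun_mult[OF f g] A.tangent_mult[OF v F[OF f] F[OF g]] by (simp add: push_def o_def)
  qed (simp add: push_def)
qed

lemma (in manifold) zero_differential_imp_constant:
  assumes "connected (UNIV :: 'm set)" and f: "smooth_fun A f"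
    and z: "\<And>p v. v \<in> tangent A p \<Longrightarrow> v f = 0"
  shows "f p = f q"
proof (rule connected_local_const[OF assms(1) UNIV_I UNIV_I], rule ballI)
  fix a
  obtain U x where U: "(U, x) \<in> A" "a \<in> U" by (rule ex_chart)
  obtain r where r: "r > 0" "ball (x a) r \<subseteq> x ` U"
    using chart_image_open[OF U(1)] U(2) open_contains_ball by blast
  have "f (chart_inv U x e) = f (chart_inv U x (x a))" if "e \<in> ball (x a) r" for e
  proof (rule has_derivative_zero_unique[OF convex_ball _ that centre_in_ball[THEN iffD2, OF r(1)]])
    fix e assume e: "e \<in> ball (x a) r"
    then have eU: "e \<in> x ` U" using r(2) by blast
    have d: "((\<lambda>e. f (chart_inv U x e)) has_derivative D (\<lambda>e. f (chart_inv U x e)) e) (at e)"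
      by (rule smooth_on_has_derivative[OF smooth_funD[OF f U(1)] eU])
    have "D (\<lambda>e. f (chart_inv U x e)) e = (\<lambda>\<xi>. 0)"
    proof
      fix \<xi>
      show "D (\<lambda>e. f (chart_inv U x e)) e \<xi> = 0"
        using z[OF cvec_tangent[OF U(1) chart_inv_in[OF U(1) eU]], of \<xi>] f
        by (simp add: cvec_def chart_chart_inv[OF U(1) eU])
    qed
    then show "((\<lambda>e. f (chart_inv U x e)) has_derivative (\<lambda>\<xi>. 0)) (at e within ball (x a) r)"
      using d has_derivative_at_withinI by metis
  qed
  then have "f b = f a" if "b \<in> U \<inter> x -` ball (x a) r" for b
    using that chart_inv_chart[OF U(1)] U(2) by (metis IntD1 IntD2 vimageD)
  moreover have "open (U \<inter> x -` ball (x a) r)" "a \<in> U \<inter> x -` ball (x a) r"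
    using chart_preimage_open[OF U(1)] U(2) r(1) by auto
  ultimately show "\<forall>\<^sub>F b in at a within UNIV. f a = f b"
    unfolding eventually_at_topological by metis
qed

lemma smooth_on_real_DERIV:
  fixes g :: "real \<Rightarrow> real"
  assumes "smooth_on UNIV g" shows "(g has_real_derivative deriv g t) (at t)"
proof -
  have "g differentiable (at t)"
    using smooth_on_has_derivative[OF assms UNIV_I, of t] by (auto simp: differentiable_def)
  then show ?thesis using DERIV_deriv_iff_real_differentiable by blast
qed

section \<open>The two commuting actions\<close>

locale commuting_actions = symplectic A \<omega>
  for A :: "('m::t2_space, 'e::{real_inner,heine_borel}) chart set" and \<omega> +
  fixes \<tau> :: "complex \<Rightarrow> 'm \<Rightarrow> 'm" and \<phi> :: "'m \<Rightarrow> real"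
    and K :: "'k::t2_space monoid" and B :: "('k, 'f::{real_inner,heine_borel}) chart set"
    and act :: "'k \<Rightarrow> 'm \<Rightarrow> 'm" and \<mu> :: "'m \<Rightarrow> 'k tvec \<Rightarrow> real"
  assumes circle: "hamiltonian_circle_action A \<omega> \<tau> \<phi>"
    and lie: "lie_group K B" and connected_K: "connected (UNIV :: 'k set)"
    and ham: "hamiltonian_action K B A \<omega> act \<mu>" and proper: "proper_action act"
    and commute: "\<And>k u p. u \<in> carrier circle_group \<Longrightarrow> act k (\<tau> u p) = \<tau> u (act k p)"
    and mult_free: "multiplicity_free A \<omega> act"
begin

sublocale Kmf: manifold B using lie by unfold_locales (simp add: lie_group_def)

sublocale KM: two_manifolds B A by (simp add: two_manifolds_def manifold_axioms Kmf.manifold_axioms)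

sublocale KK: two_manifolds B B by (simp add: two_manifolds_def Kmf.manifold_axioms)

sublocale RM: two_manifolds "std_atlas :: (real, real) chart set" A
  using manifold_std by (simp add: two_manifolds_def manifold_axioms)

abbreviation mK (infixl "\<cdot>" 70) where "g \<cdot> h \<equiv> g \<otimes>\<^bsub>K\<^esub> h"
abbreviation iK where "iK g \<equiv> inv\<^bsub>K\<^esub> g"

lemma group_K: "group K" and carrier_K: "carrier K = UNIV"
  using lie by (auto simp: lie_group_def)

lemma K_simps:
  "iK g \<cdot> (g \<cdot> h) = h" "g \<cdot> (iK g \<cdot> h) = h" "(g \<cdot> iK h) \<cdot> h = g" "g \<cdot> iK g = \<one>\<^bsub>K\<^esub>" "iK g \<cdot> g = \<one>\<^bsub>K\<^esub>"
  "iK (iK g \<cdot> h) = iK h \<cdot> g" "iK (iK g) = g"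
proof -
  interpret group K by (rule group_K)
  note c = carrier_K
  show "iK g \<cdot> (g \<cdot> h) = h" "g \<cdot> (iK g \<cdot> h) = h" "g \<cdot> iK g = \<one>\<^bsub>K\<^esub>" "iK g \<cdot> g = \<one>\<^bsub>K\<^esub>" "iK (iK g) = g"
    by (simp_all add: c m_assoc[symmetric])
  show "(g \<cdot> iK h) \<cdot> h = g" by (simp add: c m_assoc)
  show "iK (iK g \<cdot> h) = iK h \<cdot> g" by (simp add: c inv_mult_group)
qed

sublocale bump_group K
proof (rule bump_group.intro)
  show "group K" "carrier K = UNIV" by (rule group_K, rule carrier_K)
  show "continuous_on UNIV (\<lambda>(g, h). g \<cdot> h)" "continuous_on UNIV iK"
    using lie by (auto simp: lie_group_def smooth_map_def)
  fix V :: "'k set" and s assume "open V" "s \<in> V"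
  then obtain \<kappa> N where k: "smooth_fun B \<kappa>" "\<And>q. \<kappa> q \<ge> 0" "open N" "s \<in> N" "N \<subseteq> V" "\<And>q. q \<in> N \<Longrightarrow> \<kappa> q = 1"
    "\<And>q. q \<notin> V \<Longrightarrow> \<kappa> q = 0" "\<exists>C. compact C \<and> (\<forall>q. q \<notin> C \<longrightarrow> \<kappa> q = 0)"
    by (rule Kmf.ex_bump_fun) blast
  show "\<exists>\<phi>::'k \<Rightarrow> real. continuous_on UNIV \<phi> \<and> (\<forall>t. \<phi> t \<ge> 0) \<and> \<phi> s > 0 \<and>
      (\<exists>C. compact C \<and> (\<forall>t. t \<notin> C \<longrightarrow> \<phi> t = 0)) \<and> (\<forall>t. t \<notin> V \<longrightarrow> \<phi> t = 0)"
    using k Kmf.smooth_fun_continuous_on[OF k(1)] by (intro exI[of _ \<kappa>]) auto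
qed

lemma act_group: "group_action K UNIV act"
  using ham by (simp add: hamiltonian_action_def smooth_action_def)

lemma act_mult: "act (g \<cdot> h) p = act g (act h p)"
  using group_action.composition_rule[OF act_group] by (simp add: carrier_K)

lemma act_one: "act \<one>\<^bsub>K\<^esub> p = p"
  using fun_cong[OF group_action.id_eq_one[OF act_group], of p] by simp

lemma \<tau>_group: "group_action circle_group UNIV \<tau>"
  using circle by (simp add: hamiltonian_circle_action_def)

lemma cis_circle: "cis t \<in> carrier circle_group" by (simp add: circle_group_def)

lemma \<tau>_cis_add: "\<tau> (cis (s + t)) p = \<tau> (cis s) (\<tau> (cis t) p)"
proof -
  have "\<tau> (cis s \<otimes>\<^bsub>circle_group\<^esub> cis t) p = \<tau> (cis s) (\<tau> (cis t) p)"
    by (rule group_action.composition_rule[OF \<tau>_group UNIV_I cis_circle cis_circle])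
  then show ?thesis by (simp add: circle_group_def cis_mult)
qed

lemma \<tau>_one: "\<tau> 1 p = p"
  using fun_cong[OF group_action.id_eq_one[OF \<tau>_group], of p] by (simp add: circle_group_def)

lemma smooth_\<phi>: "smooth_fun A \<phi>" and \<phi>_\<tau>: "u \<in> carrier circle_group \<Longrightarrow> \<phi> (\<tau> u p) = \<phi> p"
  using circle by (simp_all add: hamiltonian_circle_action_def)

lemma smooth_act: assumes "smooth_fun A h" shows "smooth_fun (prod_atlas B A) (\<lambda>(k, p). h (act k p))"
proof -
  have "smooth_map (prod_atlas B A) A (\<lambda>(k, p). act k p)"
    using ham by (simp add: hamiltonian_action_def smooth_action_def)
  from smooth_map_comp[OF KM.prod_atlas_smooth atlas this assms] show ?thesis by (simp add: case_prod_unfold)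
qed

lemma smooth_orbit: "smooth_fun A h \<Longrightarrow> smooth_fun B (\<lambda>k. h (act k p))"
  using KM.smooth_fun_slice1[OF smooth_act, of h p] by simp

lemma smooth_circle_orbit: assumes "smooth_fun A h" shows "smooth_on UNIV (\<lambda>t. h (\<tau> (cis t) p))"
proof -
  have s: "smooth_map (prod_atlas std_atlas A) A (\<lambda>(t::real, p). \<tau> (cis t) p)"
    using circle by (simp add: hamiltonian_circle_action_def)
  show ?thesis
    using RM.smooth_fun_slice1[OF smooth_map_comp[OF RM.prod_atlas_smooth atlas s assms], of p]
    by (simp add: smooth_fun_std)
qed

lemma circle_vf_DERIV:
  assumes "smooth_fun A h"
  shows "((\<lambda>t. h (\<tau> (cis t) p)) has_real_derivative circle_vf A \<tau> (\<tau> (cis t) p) h) (at t)"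
proof -
  let ?g = "\<lambda>t. h (\<tau> (cis t) p)"
  have "((\<lambda>s. h (\<tau> (cis s) (\<tau> (cis t) p))) has_real_derivative circle_vf A \<tau> (\<tau> (cis t) p) h) (at 0)"
    using smooth_on_real_DERIV[OF smooth_circle_orbit[OF assms]] assms by (simp add: circle_vf_def)
  then have "((\<lambda>s. ?g (s + t)) has_real_derivative circle_vf A \<tau> (\<tau> (cis t) p) h) (at 0)"
    by (simp add: \<tau>_cis_add)
  then show ?thesis using DERIV_shift[of ?g _ 0 t] by simp
qed

lemma circle_vf_DERIV_0:
  "smooth_fun A h \<Longrightarrow> ((\<lambda>t. h (\<tau> (cis t) p)) has_real_derivative circle_vf A \<tau> p h) (at 0)"
  using circle_vf_DERIV[of h p 0] by (simp add: \<tau>_one)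

lemma circle_vf_tangent: "circle_vf A \<tau> p \<in> tangent A p"
  unfolding tangent_def
proof (intro CollectI conjI allI impI)
  fix f g a b assume f: "smooth_fun A f" and g: "smooth_fun A g"
  have s: "smooth_fun A (\<lambda>x. a * f x + b * g x)"
    by (intro smooth_fun_add smooth_fun_mult smooth_fun_const f g)
  show "circle_vf A \<tau> p (\<lambda>x. a * f x + b * g x) = a * circle_vf A \<tau> p f + b * circle_vf A \<tau> p g"
    by (rule DERIV_unique[OF circle_vf_DERIV_0[OF s]])
      (intro DERIV_add DERIV_cmult circle_vf_DERIV_0 f g)
next
  fix f g assume f: "smooth_fun A f" and g: "smooth_fun A g"
  have "((\<lambda>t. f (\<tau> (cis t) p) * g (\<tau> (cis t) p)) has_real_derivative
      circle_vf A \<tau> p f * g (\<tau> (cis 0) p) + circle_vf A \<tau> p g * f (\<tau> (cis 0) p)) (at 0)"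
    by (rule DERIV_mult[OF circle_vf_DERIV_0[OF f] circle_vf_DERIV_0[OF g]])
  from DERIV_unique[OF circle_vf_DERIV_0[OF smooth_fun_mult[OF f g]] this]
  show "circle_vf A \<tau> p (\<lambda>x. f x * g x) = f p * circle_vf A \<tau> p g + g p * circle_vf A \<tau> p f"
    by (simp add: \<tau>_one)
qed (simp add: circle_vf_def)

lemma circle_vf_contracts: "contracts_to A \<omega> p (circle_vf A \<tau> p) \<phi>"
  using circle by (simp add: hamiltonian_circle_action_def)

lemma poisson_\<phi>: "smooth_fun A f \<Longrightarrow> poisson A \<omega> f \<phi> p = circle_vf A \<tau> p f"
  by (simp add: poisson_eq[OF _ smooth_\<phi>] ham_vf_eqI[OF smooth_\<phi> circle_vf_tangent circle_vf_contracts])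

text \<open>The moment map of the circle is invariant under \<open>K\<close>: along a circle orbit \<open>\<mu>\<^sup>X\<close> is periodic and
  its derivative is the constant \<open>- X\<^sup># \<phi>\<close>.\<close>

lemma fundamental_\<phi>_zero:
  assumes X: "X \<in> lie_algebra K B"
  shows "X (\<lambda>k. \<phi> (act k p)) = 0"
proof -
  define y where "y q = X (\<lambda>k. \<phi> (act k q))" for q
  define m where "m q = \<mu> q X" for q
  have X1: "X \<in> tangent B \<one>\<^bsub>K\<^esub>" using X by (simp add: lie_algebra_def)
  have m: "smooth_fun A m" and mc: "contracts_to A \<omega> q (fundamental_vf A act X q) m" for q
    using ham X by (auto simp: hamiltonian_action_def m_def[abs_def])
  have ft: "fundamental_vf A act X q \<in> tangent A q" for q
  proof -
    have "push A (\<lambda>k. act k q) X \<in> tangent A (act \<one>\<^bsub>K\<^esub> q)"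
      by (rule push_tangent[OF Kmf.manifold_axioms manifold_axioms smooth_orbit X1])
    then show ?thesis by (simp add: fundamental_vf_def act_one)
  qed
  have y: "y q = fundamental_vf A act X q \<phi>" for q
    using smooth_\<phi> by (simp add: fundamental_vf_def push_def y_def o_def)
  have "circle_vf A \<tau> q m = - y q" for q
  proof -
    have "circle_vf A \<tau> q m = \<omega> q (fundamental_vf A act X q) (circle_vf A \<tau> q)"
      using mc circle_vf_tangent unfolding contracts_to_def by blast
    also have "\<dots> = - \<omega> q (circle_vf A \<tau> q) (fundamental_vf A act X q)"
      by (rule form_antisym[OF ft circle_vf_tangent])
    also have "\<omega> q (circle_vf A \<tau> q) (fundamental_vf A act X q) = y q"
      using circle_vf_contracts[of q] ft[of q] unfolding contracts_to_def y by simp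
    finally show ?thesis .
  qed
  moreover have "y (\<tau> (cis t) p) = y p" for t
    by (simp add: y_def commute[OF cis_circle] \<phi>_\<tau>[OF cis_circle])
  ultimately have d: "((\<lambda>t. m (\<tau> (cis t) p)) has_real_derivative - y p) (at t)" for t
    using circle_vf_DERIV[OF m, of p t] by simp
  obtain z where "m (\<tau> (cis (2 * pi)) p) - m (\<tau> (cis 0) p) = (2 * pi - 0) * - y p"
    using MVT2[of 0 "2 * pi" "\<lambda>t. m (\<tau> (cis t) p)" "\<lambda>_. - y p"] d by auto
  then show ?thesis by (simp add: y_def)
qed

lemma \<phi>_act: "\<phi> (act k p) = \<phi> p"
proof -
  have "\<phi> (act k p) = \<phi> (act \<one>\<^bsub>K\<^esub> p)"
  proof (rule Kmf.zero_differential_imp_constant[OF connected_K smooth_orbit[OF smooth_\<phi>]])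
    fix k0 v assume v: "v \<in> tangent B k0"
    have sm: "smooth_map (prod_atlas B B) B (\<lambda>(g, h). g \<cdot> h)" using lie by (simp add: lie_group_def)
    have R: "smooth_fun B (\<lambda>k. h (k \<cdot> iK k0))" if "smooth_fun B h" for h
      using KK.smooth_fun_slice1[OF smooth_map_comp[OF KK.prod_atlas_smooth Kmf.atlas sm that], of "iK k0"] by simp
    \<comment> \<open>Right translation moves the tangent vector to the unit, where \<open>fundamental_\<phi>_zero\<close> applies at the point \<open>act k0 p\<close>.\<close>
    have "push B (\<lambda>k. k \<cdot> iK k0) v \<in> lie_algebra K B"
      using push_tangent[OF Kmf.manifold_axioms Kmf.manifold_axioms R v]
      by (simp add: lie_algebra_def K_simps)
    from fundamental_\<phi>_zero[OF this, of "act k0 p"]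
    show "v (\<lambda>k. \<phi> (act k p)) = 0"
      using smooth_orbit[OF smooth_\<phi>, of "act k0 p"] by (simp add: push_def o_def) (simp add: act_mult[symmetric] K_simps)
  qed
  then show ?thesis by (simp add: act_one)
qed

lemma poisson_invariant:
  assumes "smooth_fun A f" "smooth_fun A g" "\<And>k p. f (act k p) = f p" "\<And>k p. g (act k p) = g p"
  shows "poisson A \<omega> f g p = 0"
proof -
  have "\<forall>f g. smooth_fun A f \<longrightarrow> smooth_fun A g \<longrightarrow> (\<forall>k p. f (act k p) = f p) \<longrightarrow>
      (\<forall>k p. g (act k p) = g p) \<longrightarrow> (\<forall>p. poisson A \<omega> f g p = 0)"
    using mult_free by (simp only: multiplicity_free_def)
  from this[THEN spec, THEN spec, THEN mp, THEN mp, THEN mp, THEN mp, THEN spec, OF assms(1,2)]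
  show ?thesis using assms(3,4) by blast
qed

section \<open>Averaging over the group\<close>

text \<open>The pairs \<open>(k, y)\<close> with \<open>(act k y, y) \<in> Q \<times> C\<close> form a compact set by properness; \<open>L\<close> is its projection
  to \<open>K\<close>, with the unit added to make it nonempty.\<close>

lemma act_compact:
  assumes "compact Q" "compact C"
  obtains L where "compact L" "L \<noteq> {}" "\<And>k x. x \<in> Q \<Longrightarrow> act (iK k) x \<in> C \<Longrightarrow> k \<in> L"
proof -
  have "compactin euclidean (Q \<times> C)" using compact_Times[OF assms] by simp
  from compactin_proper_map_preimage[OF proper[unfolded proper_action_def] this]
  have S: "compact {kp. (case kp of (k, p) \<Rightarrow> (act k p, p)) \<in> Q \<times> C}" by simp
  show ?thesis
  proof (rule that[of "insert \<one>\<^bsub>K\<^esub> (fst ` {kp. (case kp of (k, p) \<Rightarrow> (act k p, p)) \<in> Q \<times> C})"])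
    show "compact (insert \<one>\<^bsub>K\<^esub> (fst ` {kp. (case kp of (k, p) \<Rightarrow> (act k p, p)) \<in> Q \<times> C}))"
      by (intro compact_insert compact_continuous_image S continuous_on_fst continuous_on_id)
    fix k x assume "x \<in> Q" "act (iK k) x \<in> C"
    then have "(k, act (iK k) x) \<in> {kp. (case kp of (k, p) \<Rightarrow> (act k p, p)) \<in> Q \<times> C}"
      by (simp add: act_mult[symmetric] K_simps act_one)
    then show "k \<in> insert \<one>\<^bsub>K\<^esub> (fst ` {kp. (case kp of (k, p) \<Rightarrow> (act k p, p)) \<in> Q \<times> C})"
      by (intro insertI2 image_eqI[where x = "(k, act (iK k) x)"]) simp_all
  qed simp
qed

lemma orbit_fun_Cc:
  assumes F: "smooth_fun A F" and C: "compact C" "\<And>q. q \<notin> C \<Longrightarrow> F q = 0"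
  shows "(\<lambda>k. F (act (iK k) x)) \<in> Cc"
proof -
  obtain L where L: "compact L" "\<And>k x'. x' \<in> {x} \<Longrightarrow> act (iK k) x' \<in> C \<Longrightarrow> k \<in> L"
    using act_compact[OF compact_insert[OF compact_empty] C(1)] by metis
  show ?thesis
  proof (rule CcI[OF _ L(1)])
    show "continuous_on UNIV (\<lambda>k. F (act (iK k) x))"
      by (rule continuous_on_compose2[OF Kmf.smooth_fun_continuous_on[OF smooth_orbit[OF F]] continuous_inv]) simp
    show "F (act (iK k) x) = 0" if "k \<notin> L" for k using L(2)[of x k] C(2) that by blast
  qed
qed

text \<open>By properness the integrands belonging to points \<open>x\<close> near \<open>p\<close> are supported in one compact subset of
  \<open>K\<close>, so that differentiation under the functional applies.\<close>

lemma average_smooth: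
  assumes I: "\<And>f g a b. f \<in> Cc \<Longrightarrow> g \<in> Cc \<Longrightarrow> I (\<lambda>t. a * f t + b * g t) = a * I f + b * I g"
    "\<And>f. f \<in> Cp \<Longrightarrow> I f \<ge> 0"
    and F: "smooth_fun A F" and C: "compact C" "\<And>q. q \<notin> C \<Longrightarrow> F q = 0"
  shows "smooth_fun A (\<lambda>x. I (\<lambda>k. F (act (iK k) x)))"
proof (rule smooth_funI)
  fix p
  obtain U x where U: "(U, x) \<in> A" "p \<in> U" by (rule ex_chart)
  obtain r where r: "r > 0" "cball (x p) r \<subseteq> x ` U"
    using chart_image_open[OF U(1)] U(2) open_contains_cball by blast
  let ?N = "U \<inter> x -` ball (x p) r"
  have N: "open ?N" "p \<in> ?N" using chart_preimage_open[OF U(1)] U(2) r(1) by auto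
  have xN: "x ` ?N \<subseteq> x ` U" by blast
  have oN: "open (x ` ?N)" by (rule chart_image_sub_open[OF U(1) N(1)]) blast
  have "compact (chart_inv U x ` cball (x p) r)"
    using chart_inv_cont[OF U(1)] r(2) by (intro compact_continuous_image) (auto intro: continuous_on_subset)
  then obtain L where L: "compact L" "L \<noteq> {}"
    "\<And>k q. q \<in> chart_inv U x ` cball (x p) r \<Longrightarrow> act (iK k) q \<in> C \<Longrightarrow> k \<in> L"
    using act_compact[OF _ C(1)] by metis
  obtain M where "bounded_functional I L L M" 
    by (rule haar_bounded_functional[where I = I and T = L, OF I(1) I(2) L(1,2)])
  then interpret bf: bounded_functional I L L M .
  have "Ck_on n (x ` ?N) (\<lambda>e. I (\<lambda>k. F (act (iK k) (chart_inv U x e))))" for n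
  proof (rule bf.Ck_on_functional[OF oN])
    have "par_Ck n UNIV (x ` U) (\<lambda>k e. F (act k (chart_inv U x e)))"
      using KM.par_Ck_of_smooth_fun[OF smooth_act[OF F] U(1), of n] by simp
    from par_Ck_reparam[OF par_Ck_subset[OF this xN] continuous_inv]
    show "par_Ck n UNIV (x ` ?N) (\<lambda>k e. F (act (iK k) (chart_inv U x e)))" .
    fix k e assume e: "e \<in> x ` ?N" and k: "k \<notin> L"
    have "e \<in> cball (x p) r" using e by auto
    then show "F (act (iK k) (chart_inv U x e)) = 0" using L(3)[of "chart_inv U x e" k] k C(2) by blast
  qed
  then have "smooth_on (x ` ?N) (\<lambda>e. I (\<lambda>k. F (act (iK k) (chart_inv U x e))))" by (simp add: smooth_on_def)
  then show "\<exists>U x N. (U, x) \<in> A \<and> open N \<and> p \<in> N \<and> N \<subseteq> U \<and>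
      smooth_on (x ` N) (\<lambda>e. I (\<lambda>k. F (act (iK k) (chart_inv U x e))))"
    using U N by blast
qed

text \<open>The operator \<open>E\<close> multiplies by a bump function \<open>\<kappa>\<close> at \<open>p\<close> and averages over \<open>K\<close>; \<open>w\<close> is the average of
  \<open>\<kappa>\<close>. On an orbit where \<open>f\<close> is constant, \<open>f\<close> can be taken out of the integral.\<close>

lemma ex_invariant_extension:
  obtains w E where "smooth_fun A w" "w p > 0" "\<forall>k q. w (act k q) = w q"
    "\<forall>f. smooth_fun A f \<longrightarrow> smooth_fun A (E f) \<and> (\<forall>k q. E f (act k q) = E f q) \<and>
      (\<forall>q. (\<forall>k. f (act k q) = f q) \<longrightarrow> E f q = f q * w q)"
proof -
  obtain I :: "('k \<Rightarrow> real) \<Rightarrow> real" where I: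
    "\<And>f g a b. f \<in> Cc \<Longrightarrow> g \<in> Cc \<Longrightarrow> I (\<lambda>t. a * f t + b * g t) = a * I f + b * I g"
    "\<And>f g. f \<in> Cc \<Longrightarrow> I (\<lambda>t. f (g \<cdot> t)) = I f"
    "\<And>f. f \<in> Cp \<Longrightarrow> I f \<ge> 0" "\<And>f t. f \<in> Cp \<Longrightarrow> f t > 0 \<Longrightarrow> I f > 0"
    by (rule ex_haar) blast
  obtain \<kappa> N where k: "smooth_fun A \<kappa>" "\<And>q. \<kappa> q \<ge> 0" "open N" "p \<in> N" "N \<subseteq> UNIV" "\<And>q. q \<in> N \<Longrightarrow> \<kappa> q = 1"
    "\<And>q. q \<notin> UNIV \<Longrightarrow> \<kappa> q = 0" "\<exists>C. compact C \<and> (\<forall>q. q \<notin> C \<longrightarrow> \<kappa> q = 0)"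
    by (rule ex_bump_fun[OF open_UNIV UNIV_I]) blast
  obtain C where C: "compact C" "\<And>q. q \<notin> C \<Longrightarrow> \<kappa> q = 0" using k(8) by blast
  define Av where "Av F x = I (\<lambda>k. F (act (iK k) x))" for F x
  have Av_smooth: "smooth_fun A (Av F)" if "smooth_fun A F" "\<And>q. q \<notin> C \<Longrightarrow> F q = 0" for F
    unfolding Av_def[abs_def] by (rule average_smooth[OF I(1) I(3) that(1) C(1) that(2)])
  have Av_inv: "Av F (act g x) = Av F x" if "smooth_fun A F" "\<And>q. q \<notin> C \<Longrightarrow> F q = 0" for F g x
  proof -
    have "Av F (act g x) = I (\<lambda>k. F (act (iK (iK g \<cdot> k)) x))" by (simp only: Av_def K_simps act_mult)
    also have "\<dots> = Av F x"
      unfolding Av_def by (rule I(2)[OF orbit_fun_Cc[OF that(1) C(1) that(2)]])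
    finally show ?thesis .
  qed
  have s: "smooth_fun A (\<lambda>q. \<kappa> q * f q)" "\<And>q. q \<notin> C \<Longrightarrow> \<kappa> q * f q = 0" if "smooth_fun A f" for f
    using smooth_fun_mult[OF k(1) that] C(2) by auto
  show ?thesis
  proof (rule that)
    show "smooth_fun A (Av \<kappa>)" by (rule Av_smooth[OF k(1) C(2)])
    show "\<forall>g q. Av \<kappa> (act g q) = Av \<kappa> q" using Av_inv[OF k(1) C(2)] by blast
    have "(\<lambda>k. \<kappa> (act (iK k) p)) \<in> Cp" using orbit_fun_Cc[OF k(1) C] k(2) by (simp add: Cp_def)
    moreover have "\<kappa> (act (iK \<one>\<^bsub>K\<^esub>) p) > 0" using k(6)[OF k(4)] by (metis K_simps(1,4) act_mult act_one zero_less_one)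
    ultimately show "Av \<kappa> p > 0" unfolding Av_def by (rule I(4))
    show "\<forall>f. smooth_fun A f \<longrightarrow> smooth_fun A (Av (\<lambda>q. \<kappa> q * f q)) \<and>
        (\<forall>g q. Av (\<lambda>q. \<kappa> q * f q) (act g q) = Av (\<lambda>q. \<kappa> q * f q) q) \<and>
        (\<forall>q. (\<forall>k. f (act k q) = f q) \<longrightarrow> Av (\<lambda>q. \<kappa> q * f q) q = f q * Av \<kappa> q)"
    proof (intro allI impI conjI)
      fix f assume f: "smooth_fun A f"
      show "smooth_fun A (Av (\<lambda>q. \<kappa> q * f q))" by (rule Av_smooth[OF s[OF f]])
      show "Av (\<lambda>q. \<kappa> q * f q) (act g q) = Av (\<lambda>q. \<kappa> q * f q) q" for g q by (rule Av_inv[OF s[OF f]])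
      fix q assume fq: "\<forall>k. f (act k q) = f q"
      have "Av (\<lambda>q. \<kappa> q * f q) q = I (\<lambda>k. f q * \<kappa> (act (iK k) q) + 0 * \<kappa> (act (iK k) q))"
        by (simp add: Av_def fq mult.commute)
      also have "\<dots> = f q * Av \<kappa> q"
        using I(1)[OF orbit_fun_Cc[OF k(1) C, of q] orbit_fun_Cc[OF k(1) C, of q], of "f q" 0] by (simp add: Av_def)
      finally show "Av (\<lambda>q. \<kappa> q * f q) q = f q * Av \<kappa> q" .
    qed
  qed
qed

text \<open>The averages \<open>E f\<close>, \<open>E g\<close> and \<open>w\<close> commute with each other and with \<open>\<phi>\<close>. By fact \<open>swap\<close> each average may
  be replaced, one argument at a time, by the product with \<open>w\<close> that it equals on the level set of \<open>p\<close>.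
  The resulting relations \<open>{f w, w} = 0\<close>, \<open>{g w, w} = 0\<close> and \<open>{g w, f w} = 0\<close> give \<open>w\<^sup>2 {g, f} = 0\<close>
  at \<open>p\<close>.\<close>

lemma poisson_level_invariant:
  assumes f: "smooth_fun A f" "\<And>q. poisson A \<omega> \<phi> f q = 0" "\<And>k q. \<phi> q = \<phi> p \<Longrightarrow> f (act k q) = f q"
    and g: "smooth_fun A g" "\<And>q. poisson A \<omega> \<phi> g q = 0" "\<And>k q. \<phi> q = \<phi> p \<Longrightarrow> g (act k q) = g q"
  shows "poisson A \<omega> f g p = 0"
proof -
  obtain w E where w0: "smooth_fun A w" "w p > 0" "\<forall>k q. w (act k q) = w q"
    and E0: "\<forall>f. smooth_fun A f \<longrightarrow> smooth_fun A (E f) \<and> (\<forall>k q. E f (act k q) = E f q) \<and>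
      (\<forall>q. (\<forall>k. f (act k q) = f q) \<longrightarrow> E f q = f q * w q)"
    by (rule ex_invariant_extension[of p])
  have w: "smooth_fun A w" "w p > 0" "w (act k q) = w q" for k q using w0 by auto
  have E: "smooth_fun A (E f)" "E f (act k q) = E f q" "(\<And>k. f (act k q) = f q) \<Longrightarrow> E f q = f q * w q"
    if "smooth_fun A f" for f k q using E0 that by auto
  have \<phi>w: "poisson A \<omega> \<phi> w q = 0" for q by (rule poisson_invariant[OF smooth_\<phi> w(1) \<phi>_act w(3)])
  have \<phi>E: "poisson A \<omega> \<phi> (E h) q = 0" if "smooth_fun A h" for h q
    by (rule poisson_invariant[OF smooth_\<phi> E(1)[OF that] \<phi>_act E(2)[OF that]])
  have ww: "poisson A \<omega> w w p = 0" by (rule poisson_invariant[OF w(1,1,3,3)])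
  have fw: "smooth_fun A (\<lambda>q. f q * w q)" by (intro smooth_fun_mult f w)
  have swap: "poisson A \<omega> (\<lambda>q. h q * w q) v p = poisson A \<omega> (E h) v p"
    if h: "smooth_fun A h" "\<And>k q. \<phi> q = \<phi> p \<Longrightarrow> h (act k q) = h q"
      and v: "smooth_fun A v" "\<And>q. poisson A \<omega> \<phi> v q = 0" for h v
  proof -
    have hw: "smooth_fun A (\<lambda>q. h q * w q)" by (intro smooth_fun_mult h w)
    have "poisson A \<omega> (\<lambda>q. E h q - h q * w q) v p = 0"
      by (rule poisson_zero_on_level[OF smooth_\<phi> smooth_fun_diff[OF E(1)[OF h(1)] hw] v]) (simp add: E(3)[OF h(1)] h(2))
    then show ?thesis using poisson_diff1[OF E(1)[OF h(1)] hw v(1)] by simp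
  qed
  have zero: "poisson A \<omega> h w p = 0" if h: "smooth_fun A h" "\<And>k q. \<phi> q = \<phi> p \<Longrightarrow> h (act k q) = h q" for h
  proof -
    have "poisson A \<omega> (\<lambda>q. h q * w q) w p = poisson A \<omega> (E h) w p" by (rule swap[OF h w(1) \<phi>w])
    also have "\<dots> = 0" by (rule poisson_invariant[OF E(1)[OF h(1)] w(1) E(2)[OF h(1)] w(3)])
    finally show ?thesis using poisson_mult1[OF h(1) w(1,1), of p] ww w(2) by simp
  qed
  have \<phi>fw: "poisson A \<omega> \<phi> (\<lambda>q. f q * w q) q = 0" for q
    using poisson_mult2[OF f(1) w(1) smooth_\<phi>] f(2) \<phi>w by simp
  have "poisson A \<omega> (\<lambda>q. g q * w q) (\<lambda>q. f q * w q) p = poisson A \<omega> (E g) (\<lambda>q. f q * w q) p"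
    by (rule swap[OF g(1,3) fw \<phi>fw])
  also have "\<dots> = - poisson A \<omega> (\<lambda>q. f q * w q) (E g) p" by (rule poisson_antisym[OF E(1)[OF g(1)] fw])
  also have "poisson A \<omega> (\<lambda>q. f q * w q) (E g) p = poisson A \<omega> (E f) (E g) p"
    by (rule swap[OF f(1,3) E(1)[OF g(1)] \<phi>E[OF g(1)]])
  also have "\<dots> = 0" by (rule poisson_invariant[OF E(1)[OF f(1)] E(1)[OF g(1)] E(2)[OF f(1)] E(2)[OF g(1)]])
  finally have "poisson A \<omega> (\<lambda>q. g q * w q) (\<lambda>q. f q * w q) p = 0" by simp
  moreover have "poisson A \<omega> w f p = 0" using poisson_antisym[OF w(1) f(1)] zero[OF f(1,3)] by simp
  ultimately have "w p * (w p * poisson A \<omega> g f p) = 0"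
    using poisson_mult1[OF g(1) w(1) fw, of p] poisson_mult2[OF f(1) w(1,1), of p] poisson_mult2[OF f(1) w(1) g(1), of p]
      zero[OF g(1,3)] ww by simp
  then have "poisson A \<omega> g f p = 0" using w(2) by simp
  then show ?thesis using poisson_antisym[OF f(1) g(1)] by simp
qed

end

section \<open>The bracket on the level set\<close>

context symplectic begin

lemma poisson_lincomb1:
  assumes f: "smooth_fun A f" "smooth_fun A f1" "smooth_fun A f2" and h: "smooth_fun A h"
    and d: "\<And>v. v \<in> tangent A p \<Longrightarrow> v f = v f1 + a * v f2"
  shows "poisson A \<omega> f h p = poisson A \<omega> f1 h p + a * poisson A \<omega> f2 h p"
  using d[OF ham_vf_tangent[OF h]] by (simp add: poisson_eq f h)

lemma ext_coords:
  assumes f: "smooth_fun (ext_atlas A) f" and U: "(U, x) \<in> A"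
  shows "smooth_on (x ` U \<times> UNIV) (\<lambda>e. f (chart_inv U x (fst e), snd e))"
  using ext.smooth_fun_prod_coords[OF f[unfolded ext_atlas_eq] U std_chart] by simp

lemma ext_partial_derivatives:
  assumes f: "smooth_fun (ext_atlas A) f" and U: "(U, x) \<in> A" and e: "e \<in> x ` U"
  defines "H \<equiv> \<lambda>e. f (chart_inv U x (fst e), snd e)"
  shows "D (\<lambda>e. f (chart_inv U x e, w)) e = (\<lambda>\<xi>. D H (e, w) (\<xi>, 0))"
    and "D (\<lambda>w. f (chart_inv U x e, w)) w = (\<lambda>\<eta>. D H (e, w) (0, \<eta>))"
    and "(H has_derivative D H (e, w)) (at (e, w))"
proof -
  have "(e, w) \<in> x ` U \<times> UNIV" using e by simp
  from smooth_on_has_derivative[OF ext_coords[OF f U] this]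
  show d: "(H has_derivative D H (e, w)) (at (e, w))" unfolding H_def .
  have "((\<lambda>e. (e, w)) has_derivative (\<lambda>\<xi>. (\<xi>, 0))) (at e)"
    by (intro has_derivative_Pair has_derivative_ident has_derivative_const)
  from D_eq[OF has_derivative_compose[OF this d]]
  show "D (\<lambda>e. f (chart_inv U x e, w)) e = (\<lambda>\<xi>. D H (e, w) (\<xi>, 0))" by (simp add: H_def)
  have "((\<lambda>w. (e, w)) has_derivative (\<lambda>\<eta>. (0, \<eta>))) (at w)"
    by (intro has_derivative_Pair has_derivative_ident has_derivative_const)
  from D_eq[OF has_derivative_compose[OF this d]]
  show "D (\<lambda>w. f (chart_inv U x e, w)) w = (\<lambda>\<eta>. D H (e, w) (0, \<eta>))" by (simp add: H_def)
qed

text \<open>The partial derivatives of \<open>f\<close> and \<open>g\<close> depend continuously on the point, and by \<open>poisson_tendsto\<close> the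
  bracket on \<open>M\<close> is continuous even if the functions \<open>f(\<cdot>, z)\<close> and \<open>g(\<cdot>, z)\<close> vary.\<close>

lemma ext_poisson_tendsto:
  assumes f: "smooth_fun (ext_atlas A) f" and g: "smooth_fun (ext_atlas A) g"
    and q: "(q \<longlongrightarrow> p) F" and z: "(z \<longlongrightarrow> w) F"
  shows "((\<lambda>s. poisson (ext_atlas A) (ext_form A \<omega>) f g (q s, z s)) \<longlongrightarrow>
    poisson (ext_atlas A) (ext_form A \<omega>) f g (p, w)) F"
proof -
  obtain U x where U: "(U, x) \<in> A" "p \<in> U" by (rule ex_chart)
  have ev: "\<forall>\<^sub>F s in F. q s \<in> U" using topological_tendstoD[OF q chart_open[OF U(1)] U(2)] .
  have "isCont x p" using chart_cont[OF U(1)] continuous_on_eq_continuous_at[OF chart_open[OF U(1)]] U(2) by blast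
  from isCont_tendsto_compose[OF this q] have xq: "((\<lambda>s. x (q s)) \<longlongrightarrow> x p) F" .
  have xp: "x p \<in> x ` U" using U(2) by blast
  have lim: "((\<lambda>s. D (\<lambda>e. h (chart_inv U x (fst e), snd e)) (x (q s), z s) v) \<longlongrightarrow>
      D (\<lambda>e. h (chart_inv U x (fst e), snd e)) (x p, w) v) F" if h: "smooth_fun (ext_atlas A) h" for h v
  proof -
    have o: "open (x ` U \<times> (UNIV :: complex set))" using chart_image_open[OF U(1)] by (simp add: open_Times)
    have "continuous_on (x ` U \<times> UNIV) (\<lambda>a. D (\<lambda>e. h (chart_inv U x (fst e), snd e)) a v)"
      by (rule smooth_on_continuous[OF smooth_on_D[OF ext_coords[OF h U(1)]]])
    then have "isCont (\<lambda>a. D (\<lambda>e. h (chart_inv U x (fst e), snd e)) a v) (x p, w)"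
      using continuous_on_eq_continuous_at[OF o] xp by blast
    from isCont_tendsto_compose[OF this tendsto_Pair[OF xq z]] show ?thesis .
  qed
  have lim1: "((\<lambda>s. D (\<lambda>e. h (chart_inv U x e, z s)) (x (q s)) b) \<longlongrightarrow> D (\<lambda>e. h (chart_inv U x e, w)) (x p) b) F"
    if h: "smooth_fun (ext_atlas A) h" for h b
  proof -
    have "\<forall>\<^sub>F s in F. D (\<lambda>e. h (chart_inv U x (fst e), snd e)) (x (q s), z s) (b, 0) = D (\<lambda>e. h (chart_inv U x e, z s)) (x (q s)) b"
      using ev by eventually_elim (simp add: ext_partial_derivatives(1)[OF h U(1)])
    from Lim_transform_eventually[OF lim[OF h] this]
    show ?thesis by (simp add: ext_partial_derivatives(1)[OF h U(1) xp])
  qed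
  have lim2: "((\<lambda>s. D (\<lambda>w. h (q s, w)) (z s) \<eta>) \<longlongrightarrow> D (\<lambda>w. h (p, w)) w \<eta>) F"
    if h: "smooth_fun (ext_atlas A) h" for h \<eta>
  proof -
    have "\<forall>\<^sub>F s in F. D (\<lambda>e. h (chart_inv U x (fst e), snd e)) (x (q s), z s) (0, \<eta>) = D (\<lambda>w. h (q s, w)) (z s) \<eta>"
      using ev
    proof eventually_elim
      case (elim s)
      then show ?case using ext_partial_derivatives(2)[OF h U(1), of "x (q s)" "z s"] by (simp add: chart_inv_chart[OF U(1)])
    qed
    from Lim_transform_eventually[OF lim[OF h] this]
    show ?thesis using ext_partial_derivatives(2)[OF h U(1) xp, of w] by (simp add: chart_inv_chart[OF U])
  qed
  show ?thesis
    unfolding ext_poisson[OF f g]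
    by (intro tendsto_add tendsto_diff tendsto_mult lim2 f g
        poisson_tendsto[OF U q ext_slice1[OF f] ext_slice1[OF f] ext_slice1[OF g] ext_slice1[OF g]] lim1)
qed

end

context commuting_actions begin

text \<open>The modulus of \<open>z\<close> at the points of the level set over \<open>\<phi> = y\<close>.\<close>

definition level_radius :: "real \<Rightarrow> real \<Rightarrow> real" where
  "level_radius c y = (2 * (c - y)) powr (1 / 2)"

lemma level_radius_pos: "y < c \<Longrightarrow> level_radius c y > 0"
  and level_radius_sq: "y < c \<Longrightarrow> y + (level_radius c y)\<^sup>2 / 2 = c"
  by (simp_all add: level_radius_def powr_half_sqrt field_simps)

lemma smooth_on_level_radius: "smooth_on {..<c} (level_radius c)"
  unfolding level_radius_def
  by (rule smooth_on_compose[OF open_lessThan open_greaterThan _ _ smooth_on_powr])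
    (auto intro!: smooth_on_mult smooth_on_diff smooth_on_const smooth_on_id)

lemma level_radius_derivative:
  assumes "y < c" shows "(level_radius c has_real_derivative - (1 / level_radius c y)) (at y)"
proof -
  have "((\<lambda>y. sqrt (2 * (c - y))) has_real_derivative - (1 / sqrt (2 * (c - y)))) (at y)"
    using assms by (auto intro!: derivative_eq_intros simp: field_simps)
  then have "((\<lambda>y. sqrt (2 * (c - y))) has_real_derivative - (1 / level_radius c y)) (at y)"
    using assms by (simp add: level_radius_def powr_half_sqrt)
  then show ?thesis
    by (rule has_field_derivative_transform_within_open[where S = "{..<c}"])
      (use assms in \<open>auto simp: level_radius_def powr_half_sqrt\<close>)
qed

text \<open>The function \<open>f'\<close> is \<open>f\<close> on the part of the level set with phase \<open>\<epsilon>\<close>, seen as a function on \<open>M\<close> and cut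
  off by a function of \<open>\<phi>\<close> before \<open>\<phi>\<close> reaches \<open>c\<close>, where the radius fails to be smooth. Its
  differential at \<open>p\<close> follows from the chain rule, as the radius \<open>r\<close> has the derivative \<open>- 1 / r\<close>.\<close>

lemma section_function:
  fixes \<epsilon> :: complex
  assumes f: "smooth_fun (ext_atlas A) f" and p: "\<phi> p < c"
    and b: "smooth_on UNIV b" "\<And>y. \<bar>y - \<phi> p\<bar> \<le> \<rho> / 2 \<Longrightarrow> b y = 1" "\<And>y. \<bar>y - \<phi> p\<bar> \<ge> \<rho> \<Longrightarrow> b y = 0"
    and \<rho>: "0 < \<rho>" "\<phi> p + \<rho> < c"
  defines "f' \<equiv> \<lambda>q. b (\<phi> q) * f (q, level_radius c (\<phi> q) *\<^sub>R \<epsilon>)"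
  defines "r \<equiv> level_radius c (\<phi> p)"
  shows "smooth_fun A f'"
    and "\<And>v. v \<in> tangent A p \<Longrightarrow>
      v f' = v (\<lambda>q. f (q, r *\<^sub>R \<epsilon>)) + (- (D (\<lambda>w. f (p, w)) (r *\<^sub>R \<epsilon>) \<epsilon> / r)) * v \<phi>"
proof -
  have S: "smooth_on (x ` N) (\<lambda>e. level_radius c (\<phi> (chart_inv U x e)) *\<^sub>R \<epsilon>)"
    if "(U, x) \<in> A" "open N" "N \<subseteq> U" "\<And>q. q \<in> N \<Longrightarrow> \<phi> q < c" for U x N
  proof -
    have o: "open (x ` N)" by (rule chart_image_sub_open[OF that(1-3)])
    have "smooth_on (x ` N) (\<lambda>e. \<phi> (chart_inv U x e))"
      using smooth_funD[OF smooth_\<phi> that(1)] by (rule smooth_on_subset) (use that(3) in auto)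
    then have "smooth_on (x ` N) (\<lambda>e. level_radius c (\<phi> (chart_inv U x e)))"
      by (rule smooth_on_compose[OF o open_lessThan _ _ smooth_on_level_radius, rotated])
        (use that(3,4) in \<open>auto simp: chart_inv_chart[OF that(1)] subset_iff\<close>)
    then show ?thesis by (intro smooth_on_scaleR o smooth_on_const)
  qed
  have smooth_sec: "smooth_on (x ` N) (\<lambda>e. f (chart_inv U x e, level_radius c (\<phi> (chart_inv U x e)) *\<^sub>R \<epsilon>))"
    if N: "(U, x) \<in> A" "open N" "N \<subseteq> U" "\<And>q. q \<in> N \<Longrightarrow> \<phi> q < c" for U x N
  proof -
    have o: "open (x ` N)" by (rule chart_image_sub_open[OF N(1-3)])
    have oU: "open (x ` U \<times> (UNIV :: complex set))" using chart_image_open[OF N(1)] by (simp add: open_Times)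
    have "smooth_on (x ` N) (\<lambda>e. (\<lambda>e. f (chart_inv U x (fst e), snd e)) (e, level_radius c (\<phi> (chart_inv U x e)) *\<^sub>R \<epsilon>))"
      by (rule smooth_on_compose[OF o oU _ smooth_on_Pair[OF o smooth_on_id[OF o] S[OF N]] ext_coords[OF f N(1)]])
        (use N(3) in auto)
    then show ?thesis by simp
  qed
  show smooth: "smooth_fun A f'"
  proof (rule smooth_funI)
    fix q
    obtain U x where U: "(U, x) \<in> A" "q \<in> U" by (rule ex_chart)
    have c\<phi>: "continuous_on UNIV \<phi>" by (rule smooth_fun_continuous_on[OF smooth_\<phi>])
    show "\<exists>U x N. (U, x) \<in> A \<and> open N \<and> q \<in> N \<and> N \<subseteq> U \<and> smooth_on (x ` N) (\<lambda>e. f' (chart_inv U x e))"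
    proof (cases "\<phi> q < c")
      case True
      let ?N = "U \<inter> \<phi> -` {..<c}"
      have N: "open ?N" using open_vimage[OF open_lessThan c\<phi>] chart_open[OF U(1)] by blast
      have o: "open (x ` ?N)" by (rule chart_image_sub_open[OF U(1) N]) blast
      have "smooth_on (x ` ?N) (\<lambda>e. \<phi> (chart_inv U x e))"
        using smooth_funD[OF smooth_\<phi> U(1)] by (rule smooth_on_subset) auto
      then have "smooth_on (x ` ?N) (\<lambda>e. b (\<phi> (chart_inv U x e)))"
        by (rule smooth_on_compose[OF o open_UNIV UNIV_I _ b(1)])
      then have "smooth_on (x ` ?N) (\<lambda>e. f' (chart_inv U x e))"
        unfolding f'_def by (intro smooth_on_mult o smooth_sec[OF U(1) N]) auto
      then show ?thesis using U N True by (intro exI[of _ U] exI[of _ x] exI[of _ ?N]) auto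
    next
      case False
      let ?N = "U \<inter> \<phi> -` {\<phi> p + \<rho><..}"
      have N: "open ?N" using open_vimage[OF open_greaterThan c\<phi>] chart_open[OF U(1)] by blast
      have o: "open (x ` ?N)" by (rule chart_image_sub_open[OF U(1) N]) blast
      have z: "f' q' = 0" if "q' \<in> ?N" for q' 
      proof -
        have "\<bar>\<phi> q' - \<phi> p\<bar> \<ge> \<rho>" using that by auto
        then show ?thesis by (simp add: f'_def b(3))
      qed
      have "smooth_on (x ` ?N) (\<lambda>e. f' (chart_inv U x e))"
        by (subst smooth_on_cong[OF o, of _ "\<lambda>_. 0"]) (auto simp: chart_inv_chart[OF U(1)] z smooth_on_const)
      then show ?thesis using U N False \<rho>(2) by (intro exI[of _ U] exI[of _ x] exI[of _ ?N]) auto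
    qed
  qed
  fix v assume v: "v \<in> tangent A p"
  obtain U x where U: "(U, x) \<in> A" "p \<in> U" by (rule ex_chart)
  obtain \<xi> where \<xi>: "v = cvec U x p \<xi>" by (rule tangent_eq_cvec[OF U v])
  have xp: "x p \<in> x ` U" using U(2) by blast
  note ip = chart_inv_chart[OF U]
  let ?H = "\<lambda>e. f (chart_inv U x (fst e), snd e)"
  let ?\<phi> = "\<lambda>e. \<phi> (chart_inv U x e)"
  have d\<phi>: "(?\<phi> has_derivative D ?\<phi> (x p)) (at (x p))" by (rule chart_has_derivative[OF U smooth_\<phi>])
  have "(level_radius c has_derivative (\<lambda>h. h * (- (1 / r)))) (at (\<phi> (chart_inv U x (x p))))"
    using level_radius_derivative[OF p] unfolding ip r_def has_field_derivative_def
    by (rule has_derivative_eq_rhs) (simp add: fun_eq_iff)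
  from has_derivative_scaleR_left[OF has_derivative_compose[OF d\<phi> this]]
  have dS: "((\<lambda>e. level_radius c (?\<phi> e) *\<^sub>R \<epsilon>) has_derivative (\<lambda>\<xi>. (D ?\<phi> (x p) \<xi> * (- (1 / r))) *\<^sub>R \<epsilon>)) (at (x p))" .
  have dP: "((\<lambda>e. (e, level_radius c (?\<phi> e) *\<^sub>R \<epsilon>)) has_derivative (\<lambda>\<xi>. (\<xi>, (D ?\<phi> (x p) \<xi> * (- (1 / r))) *\<^sub>R \<epsilon>))) (at (x p))"
    by (intro has_derivative_Pair has_derivative_ident dS)
  have dH: "(?H has_derivative D ?H (x p, r *\<^sub>R \<epsilon>)) (at (x p, level_radius c (?\<phi> (x p)) *\<^sub>R \<epsilon>))"
    using ext_partial_derivatives(3)[OF f U(1) xp] by (simp add: ip r_def)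
  note lin = has_derivative_linear[OF dH]
  have dsec: "D (\<lambda>e. f (chart_inv U x e, level_radius c (?\<phi> e) *\<^sub>R \<epsilon>)) (x p) =
      (\<lambda>\<xi>. D ?H (x p, r *\<^sub>R \<epsilon>) (\<xi>, (D ?\<phi> (x p) \<xi> * (- (1 / r))) *\<^sub>R \<epsilon>))"
    using D_eq[OF has_derivative_compose[OF dP dH]] by simp
  let ?W = "U \<inter> \<phi> -` {\<phi> p - \<rho> / 2 <..< \<phi> p + \<rho> / 2}"
  have W: "open ?W" using open_vimage[OF open_greaterThanLessThan smooth_fun_continuous_on[OF smooth_\<phi>]] chart_open[OF U(1)] by blast
  have oW: "open (x ` ?W)" by (rule chart_image_sub_open[OF U(1) W]) blast
  have Df': "D (\<lambda>e. f' (chart_inv U x e)) (x p) = D (\<lambda>e. f (chart_inv U x e, level_radius c (?\<phi> e) *\<^sub>R \<epsilon>)) (x p)"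
  proof (rule D_cong(1)[OF oW])
    show "x p \<in> x ` ?W" using U(2) \<rho>(1) by auto
    fix e assume "e \<in> x ` ?W"
    then obtain q where q: "q \<in> ?W" "e = x q" by blast
    have "\<phi> p - \<rho> / 2 < \<phi> q" "\<phi> q < \<phi> p + \<rho> / 2" using q(1) by auto
    then have "\<bar>\<phi> q - \<phi> p\<bar> \<le> \<rho> / 2" by linarith
    then have "b (\<phi> q) = 1" by (rule b(2))
    then show "f' (chart_inv U x e) = f (chart_inv U x e, level_radius c (?\<phi> e) *\<^sub>R \<epsilon>)"
      using q by (simp add: f'_def chart_inv_chart[OF U(1)])
  qed
  have "D (\<lambda>e. f' (chart_inv U x e)) (x p) \<xi> = D ?H (x p, r *\<^sub>R \<epsilon>) ((\<xi>, 0) + (D ?\<phi> (x p) \<xi> * (- (1 / r))) *\<^sub>R (0, \<epsilon>))"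
    unfolding Df' dsec by simp
  also have "\<dots> = D ?H (x p, r *\<^sub>R \<epsilon>) (\<xi>, 0) + (D ?\<phi> (x p) \<xi> * (- (1 / r))) * D ?H (x p, r *\<^sub>R \<epsilon>) (0, \<epsilon>)"
    by (simp only: linear_add[OF lin] linear_scale[OF lin] real_scaleR_def)
  also have "D ?H (x p, r *\<^sub>R \<epsilon>) (\<xi>, 0) = v (\<lambda>q. f (q, r *\<^sub>R \<epsilon>))"
    using ext_partial_derivatives(1)[OF f U(1) xp, of "r *\<^sub>R \<epsilon>"] ext_slice1[OF f] by (simp add: \<xi> cvec_def)
  also have "D ?H (x p, r *\<^sub>R \<epsilon>) (0, \<epsilon>) = D (\<lambda>w. f (p, w)) (r *\<^sub>R \<epsilon>) \<epsilon>"
    using ext_partial_derivatives(2)[OF f U(1) xp, of "r *\<^sub>R \<epsilon>"] by (simp add: ip)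
  also have "D ?\<phi> (x p) \<xi> = v \<phi>" using smooth_\<phi> by (simp add: \<xi> cvec_def)
  finally show "v f' = v (\<lambda>q. f (q, r *\<^sub>R \<epsilon>)) + (- (D (\<lambda>w. f (p, w)) (r *\<^sub>R \<epsilon>) \<epsilon> / r)) * v \<phi>"
    using smooth by (simp add: \<xi> cvec_def)
qed

text \<open>Invariance lets the circle act on \<open>z\<close> by the inverse rotation instead of acting on \<open>p\<close>.\<close>

lemma circle_vf_slice:
  assumes f: "smooth_fun (ext_atlas A) f" and inv: "\<And>u x. u \<in> carrier circle_group \<Longrightarrow> f (ext_circle \<tau> u x) = f x"
  shows "f (\<tau> (cis t) p, z) = f (p, cis (- t) * z)"
    and "circle_vf A \<tau> p (\<lambda>q. f (q, z)) = - D (\<lambda>w. f (p, w)) z (\<i> * z)"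
proof -
  have eq: "f (\<tau> (cis t) p, z) = f (p, cis (- t) * z)" for t
    using inv[OF cis_circle[of t], of "(p, cis (- t) * z)"] by (simp add: ext_circle_def mult.assoc[symmetric] cis_mult)
  then show "f (\<tau> (cis t) p, z) = f (p, cis (- t) * z)" .
  let ?g = "\<lambda>w. f (p, w)"
  have d: "(?g has_derivative D ?g z) (at (cis (- 0) * z))"
    using smooth_on_has_derivative[OF ext_slice2[OF f] UNIV_I] by simp
  have "((\<lambda>t. cis (- t)) has_derivative (\<lambda>t. (- t) *\<^sub>R (\<i> * cis (- 0)))) (at 0)"
    by (intro has_derivative_cis has_derivative_minus has_derivative_ident)
  from has_derivative_mult_left[OF this, of z]
  have "((\<lambda>t. cis (- t) * z) has_derivative (\<lambda>h. h *\<^sub>R - (\<i> * z))) (at 0)" by simp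
  from has_derivative_compose[OF this d]
  have "((\<lambda>t. f (p, cis (- t) * z)) has_derivative (\<lambda>h. D ?g z (h *\<^sub>R - (\<i> * z)))) (at 0)" .
  then have "((\<lambda>t. f (\<tau> (cis t) p, z)) has_real_derivative D ?g z (- (\<i> * z))) (at 0)"
    unfolding eq has_field_derivative_def
    by (rule has_derivative_eq_rhs)
      (simp add: fun_eq_iff linear_scale[OF has_derivative_linear[OF d]] linear_neg[OF has_derivative_linear[OF d]] mult.commute)
  from DERIV_unique[OF circle_vf_DERIV_0[OF ext_slice1[OF f]] this]
  show "circle_vf A \<tau> p (\<lambda>q. f (q, z)) = - D ?g z (\<i> * z)"
    using linear_neg[OF has_derivative_linear[OF d], of "\<i> * z"] by simp
qed

text \<open>The functions \<open>s f\<close> and \<open>s g\<close> on \<open>M\<close> are the cut-off restrictions of \<open>f\<close> and \<open>g\<close> to the part of the level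
  set with phase \<open>\<epsilon>\<close>. They are \<open>K\<close>-invariant, so they commute. Expanding their bracket produces
  brackets with \<open>\<phi>\<close>, which are angular derivatives by \<open>circle_vf_slice\<close>; together with the radial
  derivatives they form the bracket of the \<open>\<complex>\<close>-directions, written in the orthonormal frame \<open>\<epsilon>\<close>,
  \<open>\<i> \<epsilon>\<close>.\<close>

lemma ext_poisson_zero_off_fixed:
  assumes f: "smooth_fun (ext_atlas A) f" "\<And>u x. u \<in> carrier circle_group \<Longrightarrow> f (ext_circle \<tau> u x) = f x"
      "\<And>k q w. ext_moment \<phi> (q, w) = c \<Longrightarrow> f (act k q, w) = f (q, w)"
    and g: "smooth_fun (ext_atlas A) g" "\<And>u x. u \<in> carrier circle_group \<Longrightarrow> g (ext_circle \<tau> u x) = g x"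
      "\<And>k q w. ext_moment \<phi> (q, w) = c \<Longrightarrow> g (act k q, w) = g (q, w)"
    and p: "ext_moment \<phi> (p, z) = c" "z \<noteq> 0"
  shows "poisson (ext_atlas A) (ext_form A \<omega>) f g (p, z) = 0"
proof -
  define r where "r = level_radius c (\<phi> p)"
  define \<epsilon> where "\<epsilon> = sgn z"
  have pz: "\<phi> p + (cmod z)\<^sup>2 / 2 = c" using p(1) by (simp add: ext_moment_def)
  have \<phi>p: "\<phi> p < c"
  proof -
    have "(cmod z)\<^sup>2 > 0" using p(2) by simp
    then show ?thesis using pz by linarith
  qed
  have r: "r > 0" unfolding r_def by (rule level_radius_pos[OF \<phi>p])
  have "r\<^sup>2 = (cmod z)\<^sup>2" using pz level_radius_sq[OF \<phi>p] by (simp add: r_def)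
  then have rz: "r = cmod z" using r by (simp add: power2_eq_iff_nonneg)
  have z: "z = r *\<^sub>R \<epsilon>" using p(2) by (simp add: rz \<epsilon>_def sgn_div_norm)
  have n\<epsilon>: "cmod \<epsilon> = 1" using p(2) by (simp add: \<epsilon>_def norm_sgn)
  then have sq: "(Re \<epsilon>)\<^sup>2 + (Im \<epsilon>)\<^sup>2 = 1" using cmod_power2[of \<epsilon>] by simp
  define \<rho> where "\<rho> = (c - \<phi> p) / 2"
  have \<rho>: "0 < \<rho>" "\<phi> p + \<rho> < c" using \<phi>p by (auto simp: \<rho>_def field_simps)
  obtain b :: "real \<Rightarrow> real" where b: "smooth_on UNIV b" "\<And>y. b y \<ge> 0"
    "\<And>y. dist (\<phi> p) y \<le> \<rho> / 2 \<Longrightarrow> b y = 1" "\<And>y. dist (\<phi> p) y \<ge> \<rho> \<Longrightarrow> b y = 0"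
    using smooth_bump_ball[OF \<rho>(1)] by metis
  have b': "\<bar>y - \<phi> p\<bar> \<le> \<rho> / 2 \<Longrightarrow> b y = 1" "\<bar>y - \<phi> p\<bar> \<ge> \<rho> \<Longrightarrow> b y = 0" for y
    using b(3,4)[of y] by (simp_all add: dist_real_def abs_minus_commute)
  define s where "s h q = b (\<phi> q) * h (q, level_radius c (\<phi> q) *\<^sub>R \<epsilon>)" for h :: "'m \<times> complex \<Rightarrow> real" and q
  have s_smooth: "smooth_fun A (s h)" and s_diff: "\<And>v. v \<in> tangent A p \<Longrightarrow>
      v (s h) = v (\<lambda>q. h (q, z)) + (- (D (\<lambda>w. h (p, w)) z \<epsilon> / r)) * v \<phi>"
    if "smooth_fun (ext_atlas A) h" for h
    using section_function[where f = h and p = p and c = c and b = b and \<rho> = \<rho> and \<epsilon> = \<epsilon>, OF that \<phi>p b(1) b' \<rho>]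
    unfolding s_def[abs_def] z r_def by auto
  have s_inv: "s h (act k q) = s h q" if h: "\<And>k q w. ext_moment \<phi> (q, w) = c \<Longrightarrow> h (act k q, w) = h (q, w)" for h k q
  proof (cases "\<phi> q < c")
    case True
    have "cmod (level_radius c (\<phi> q) *\<^sub>R \<epsilon>) = level_radius c (\<phi> q)"
      using level_radius_pos[OF True] n\<epsilon> by simp
    then have "ext_moment \<phi> (q, level_radius c (\<phi> q) *\<^sub>R \<epsilon>) = c"
      using level_radius_sq[OF True] unfolding ext_moment_def by (simp del: norm_scaleR)
    from h[OF this] show ?thesis by (simp add: s_def \<phi>_act)
  next
    case False
    then have "b (\<phi> q) = 0" using \<rho> by (intro b'(2)) auto
    then show ?thesis by (simp add: s_def \<phi>_act)
  qed
  let ?fz = "\<lambda>q. f (q, z)" and ?gz = "\<lambda>q. g (q, z)"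
  let ?fp = "\<lambda>w. f (p, w)" and ?gp = "\<lambda>w. g (p, w)"
  note sf = ext_slice1[OF f(1), of z] and sg = ext_slice1[OF g(1), of z]
  have zero: "poisson A \<omega> (s f) (s g) p = 0"
  proof (rule poisson_invariant[OF s_smooth[OF f(1)] s_smooth[OF g(1)]])
    show "s f (act k q) = s f q" for k q by (rule s_inv[of f]) (rule f(3))
    show "s g (act k q) = s g q" for k q by (rule s_inv[of g]) (rule g(3))
  qed
  have 1: "poisson A \<omega> (s f) (s g) p = poisson A \<omega> ?fz (s g) p + (- (D ?fp z \<epsilon> / r)) * poisson A \<omega> \<phi> (s g) p"
    by (rule poisson_lincomb1[OF s_smooth[OF f(1)] sf smooth_\<phi> s_smooth[OF g(1)] s_diff[OF f(1)]])
  have 2: "poisson A \<omega> h (s g) p = poisson A \<omega> h ?gz p + (- (D ?gp z \<epsilon> / r)) * poisson A \<omega> h \<phi> p" if h: "smooth_fun A h" for h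
    using poisson_lincomb1[OF s_smooth[OF g(1)] sg smooth_\<phi> h s_diff[OF g(1)]]
      poisson_antisym[OF h s_smooth[OF g(1)]] poisson_antisym[OF h sg] poisson_antisym[OF h smooth_\<phi>]
    by (simp add: algebra_simps)
  have \<phi>\<phi>: "poisson A \<omega> \<phi> \<phi> p = 0" using poisson_antisym[OF smooth_\<phi> smooth_\<phi>, of p] by simp
  have D_phase: "D (\<lambda>w. h (p, w)) z \<eta> = Re \<eta> * D (\<lambda>w. h (p, w)) z 1 + Im \<eta> * D (\<lambda>w. h (p, w)) z \<i>"
    if "smooth_fun (ext_atlas A) h" for h \<eta> by (rule D_complex_linear[OF ext_slice2[OF that]])
  have theta: "poisson A \<omega> (\<lambda>q. h (q, z)) \<phi> p = - (r * D (\<lambda>w. h (p, w)) z (\<i> * \<epsilon>))"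
    if h: "smooth_fun (ext_atlas A) h" "\<And>u x. u \<in> carrier circle_group \<Longrightarrow> h (ext_circle \<tau> u x) = h x" for h
  proof -
    have "linear (D (\<lambda>w. h (p, w)) z)"
      by (rule has_derivative_linear[OF smooth_on_has_derivative[OF ext_slice2[OF h(1)] UNIV_I]])
    then have "D (\<lambda>w. h (p, w)) z (r *\<^sub>R (\<i> * \<epsilon>)) = r * D (\<lambda>w. h (p, w)) z (\<i> * \<epsilon>)" by (simp add: linear_scale)
    moreover have "\<i> * z = r *\<^sub>R (\<i> * \<epsilon>)" by (simp add: z)
    moreover have "circle_vf A \<tau> p (\<lambda>q. h (q, z)) = - D (\<lambda>w. h (p, w)) z (\<i> * z)"
      by (rule circle_vf_slice(2)[where f = h, OF h])
    ultimately show ?thesis by (simp add: poisson_\<phi>[OF ext_slice1[OF h(1)]])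
  qed
  have tf: "poisson A \<omega> ?fz \<phi> p = - (r * D ?fp z (\<i> * \<epsilon>))" by (rule theta[of f, OF f(1,2)])
  have tg: "poisson A \<omega> ?gz \<phi> p = - (r * D ?gp z (\<i> * \<epsilon>))" by (rule theta[of g, OF g(1,2)])
  have "poisson A \<omega> ?fz ?gz p + D ?gp z \<epsilon> * D ?fp z (\<i> * \<epsilon>) - D ?fp z \<epsilon> * D ?gp z (\<i> * \<epsilon>) = 0"
    using zero unfolding 1 2[OF sf] 2[OF smooth_\<phi>] \<phi>\<phi> poisson_antisym[OF smooth_\<phi> sg] tf tg
    using r by simp
  moreover have "D ?gp z \<epsilon> * D ?fp z (\<i> * \<epsilon>) - D ?fp z \<epsilon> * D ?gp z (\<i> * \<epsilon>) =
      ((Re \<epsilon>)\<^sup>2 + (Im \<epsilon>)\<^sup>2) * (D ?fp z \<i> * D ?gp z 1 - D ?fp z 1 * D ?gp z \<i>)"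
    unfolding D_phase[OF f(1), of \<epsilon>] D_phase[OF f(1), of "\<i> * \<epsilon>"] D_phase[OF g(1), of \<epsilon>] D_phase[OF g(1), of "\<i> * \<epsilon>"]
    by (simp add: algebra_simps power2_eq_square)
  ultimately show ?thesis unfolding ext_poisson[OF f(1) g(1)] sq by simp
qed

lemma ext_poisson_zero:
  assumes f: "smooth_fun (ext_atlas A) f" "\<And>u x. u \<in> carrier circle_group \<Longrightarrow> f (ext_circle \<tau> u x) = f x"
      "\<And>k q w. ext_moment \<phi> (q, w) = c \<Longrightarrow> f (act k q, w) = f (q, w)"
    and g: "smooth_fun (ext_atlas A) g" "\<And>u x. u \<in> carrier circle_group \<Longrightarrow> g (ext_circle \<tau> u x) = g x"
      "\<And>k q w. ext_moment \<phi> (q, w) = c \<Longrightarrow> g (act k q, w) = g (q, w)"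
    and p: "ext_moment \<phi> (p, z) = c"
  shows "poisson (ext_atlas A) (ext_form A \<omega>) f g (p, z) = 0"
proof (cases "z = 0")
  case False
  then show ?thesis using ext_poisson_zero_off_fixed[where f = f and g = g and c = c, OF f g p] by blast
next
  case z: True
  have pc: "\<phi> p = c" using p by (simp add: z ext_moment_def)
  show ?thesis
  proof (cases "\<forall>v\<in>tangent A p. v \<phi> = 0")
    case False
    obtain U x where U: "(U, x) \<in> A" "p \<in> U" by (rule ex_chart)
    let ?\<phi> = "\<lambda>e. \<phi> (chart_inv U x e)"
    obtain v where v: "v \<in> tangent A p" "v \<phi> \<noteq> 0" using False by blast
    obtain \<eta> where "v = cvec U x p \<eta>" by (rule tangent_eq_cvec[OF U v(1)])
    then have \<eta>: "D ?\<phi> (x p) \<eta> \<noteq> 0" using v(2) smooth_\<phi> by (simp add: cvec_def)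
    have d: "(?\<phi> has_derivative D ?\<phi> (x p)) (at (x p))" by (rule chart_has_derivative[OF U smooth_\<phi>])
    note lin = has_derivative_linear[OF d]
    \<comment> \<open>Moving along \<open>\<xi>\<close> decreases \<open>\<phi>\<close> and leads to points of the level set with \<open>z \<noteq> 0\<close>.\<close>
    obtain \<xi> where \<xi>: "D ?\<phi> (x p) \<xi> < 0"
    proof (cases "D ?\<phi> (x p) \<eta> < 0")
      case False
      then show ?thesis using \<eta> linear_neg[OF lin, of \<eta>] that[of "- \<eta>"] by simp
    qed (rule that)
    define q where "q t = chart_inv U x (x p + t *\<^sub>R \<xi>)" for t
    have "((\<lambda>t. x p + t *\<^sub>R \<xi>) has_derivative (\<lambda>h. h *\<^sub>R \<xi>)) (at 0)" by (auto intro!: derivative_eq_intros)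
    moreover have "(?\<phi> has_derivative D ?\<phi> (x p)) (at (x p + 0 *\<^sub>R \<xi>))" using d by simp
    ultimately have "((\<lambda>t. \<phi> (q t)) has_derivative (\<lambda>h. D ?\<phi> (x p) (h *\<^sub>R \<xi>))) (at 0)"
      unfolding q_def by (rule has_derivative_compose)
    then have "((\<lambda>t. \<phi> (q t)) has_real_derivative D ?\<phi> (x p) \<xi>) (at 0)"
      unfolding has_field_derivative_def
      by (rule has_derivative_eq_rhs) (simp add: fun_eq_iff linear_scale[OF lin] mult.commute)
    from DERIV_neg_dec_right[OF this \<xi>] obtain d where d: "d > 0" "\<And>h. 0 < h \<Longrightarrow> h < d \<Longrightarrow> \<phi> (q h) < \<phi> (q 0)"
      by auto
    have q0: "q 0 = p" by (simp add: q_def chart_inv_chart[OF U])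
    have "isCont (chart_inv U x) (x p)"
      using chart_inv_cont[OF U(1)] continuous_on_eq_continuous_at[OF chart_image_open[OF U(1)]] U(2) by blast
    moreover have "((\<lambda>t. x p + t *\<^sub>R \<xi>) \<longlongrightarrow> x p) (at_right 0)"
      by (auto intro!: tendsto_eq_intros)
    ultimately have "(q \<longlongrightarrow> chart_inv U x (x p)) (at_right 0)"
      unfolding q_def by (rule isCont_tendsto_compose)
    then have qp: "(q \<longlongrightarrow> p) (at_right 0)" by (simp add: chart_inv_chart[OF U])
    define w where "w t = complex_of_real (sqrt (2 * (c - \<phi> (q t))))" for t
    have "isCont \<phi> p" using smooth_fun_continuous_on[OF smooth_\<phi>] continuous_on_eq_continuous_at[OF open_UNIV] by blast
    from isCont_tendsto_compose[OF this qp]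
    have "((\<lambda>t. \<phi> (q t)) \<longlongrightarrow> \<phi> p) (at_right 0)" .
    then have "(w \<longlongrightarrow> complex_of_real (sqrt (2 * (c - \<phi> p)))) (at_right 0)"
      unfolding w_def by (intro tendsto_intros)
    then have w0: "(w \<longlongrightarrow> z) (at_right 0)" by (simp add: pc z)
    have "\<forall>\<^sub>F t in at_right 0. poisson (ext_atlas A) (ext_form A \<omega>) f g (q t, w t) = 0"
      unfolding eventually_at_right_field
    proof (intro exI[of _ d] conjI d(1) allI impI)
      fix t assume t: "0 < t" "t < d"
      then have "\<phi> (q t) < c" using d(2)[of t] by (simp add: q0 pc)
      then have "ext_moment \<phi> (q t, w t) = c" "w t \<noteq> 0" by (simp_all add: ext_moment_def w_def field_simps)
      then show "poisson (ext_atlas A) (ext_form A \<omega>) f g (q t, w t) = 0"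
        using ext_poisson_zero_off_fixed[where f = f and g = g and c = c, OF f g] by blast
    qed
    then have "((\<lambda>t. poisson (ext_atlas A) (ext_form A \<omega>) f g (q t, w t)) \<longlongrightarrow> 0) (at_right 0)"
      by (rule tendsto_eventually)
    with ext_poisson_tendsto[OF f(1) g(1) qp w0] show ?thesis
      using tendsto_unique[OF trivial_limit_at_right_real] by blast
  next
    case True
    have level: "\<And>h. (\<And>k q w. ext_moment \<phi> (q, w) = c \<Longrightarrow> h (act k q, w) = h (q, w)) \<Longrightarrow>
        \<phi> q = \<phi> p \<Longrightarrow> h (act k q, z) = h (q, z)" for k q
      by (simp add: ext_moment_def pc z)
    have comm: "poisson A \<omega> \<phi> (\<lambda>q. h (q, z)) q = 0"
      if h: "smooth_fun (ext_atlas A) h" "\<And>u x. u \<in> carrier circle_group \<Longrightarrow> h (ext_circle \<tau> u x) = h x" for h q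
    proof -
      have "linear (D (\<lambda>w. h (q, w)) z)"
        by (rule has_derivative_linear[OF smooth_on_has_derivative[OF ext_slice2[OF h(1)] UNIV_I]])
      then have "circle_vf A \<tau> q (\<lambda>q. h (q, z)) = 0"
        using circle_vf_slice(2)[where f = h, OF h, of q z] by (simp add: z linear_0)
      then show ?thesis
        using poisson_antisym[OF smooth_\<phi> ext_slice1[OF h(1), of z], of q] poisson_\<phi>[OF ext_slice1[OF h(1), of z], of q] by simp
    qed
    have PM: "poisson A \<omega> (\<lambda>q. f (q, z)) (\<lambda>q. g (q, z)) p = 0"
      by (rule poisson_level_invariant[OF ext_slice1[OF f(1)] comm[of f, OF f(1,2)] level[of f, OF f(3)]
          ext_slice1[OF g(1)] comm[of g, OF g(1,2)] level[of g, OF g(3)]])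
    \<comment> \<open>At a critical point of \<open>\<phi>\<close> the circle acts trivially, so the functions are even in \<open>z\<close>.\<close>
    have fixed: "circle_vf A \<tau> p = (\<lambda>f. 0)"
    proof (rule form_nondeg[OF circle_vf_tangent])
      fix v assume "v \<in> tangent A p"
      then show "\<omega> p (circle_vf A \<tau> p) v = 0"
        using True circle_vf_contracts[of p] unfolding contracts_to_def by metis
    qed
    have D0: "D (\<lambda>w. h (p, w)) z \<eta> = 0"
      if h: "smooth_fun (ext_atlas A) h" "\<And>u x. u \<in> carrier circle_group \<Longrightarrow> h (ext_circle \<tau> u x) = h x" for h \<eta>
    proof -
      have orbit: "m (\<tau> (cis t) p) = m p" if m: "smooth_fun A m" for m t
      proof -
        have "((\<lambda>t. m (\<tau> (cis t) p)) has_real_derivative 0) (at s)" for s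
        proof -
          have sm: "smooth_map (prod_atlas std_atlas A) A (\<lambda>(t::real, p). \<tau> (cis t) p)"
            using circle by (simp add: hamiltonian_circle_action_def)
          have ms: "smooth_fun A (\<lambda>q. m (\<tau> (cis s) q))"
            using RM.smooth_fun_slice2[OF smooth_map_comp[OF RM.prod_atlas_smooth atlas sm m], of s] by simp
          have "((\<lambda>t. m (\<tau> (cis s) (\<tau> (cis t) p))) has_real_derivative 0) (at 0)"
            using circle_vf_DERIV_0[OF ms, of p] by (simp add: fixed)
          then have "((\<lambda>t. (\<lambda>t. m (\<tau> (cis t) p)) (t + s)) has_real_derivative 0) (at 0)"
            by (simp add: \<tau>_cis_add[symmetric] add.commute)
          then show ?thesis using DERIV_shift[of "\<lambda>t. m (\<tau> (cis t) p)" 0 0 s] by simp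
        qed
        from DERIV_isconst_all[OF allI, OF this, of t 0] show ?thesis by (simp add: \<tau>_one)
      qed
      let ?g = "\<lambda>w. h (p, w)"
      have cis_mpi: "cis (- pi) = - 1" by (simp add: complex_eq_iff)
      have "h (p, - w) = h (p, w)" for w
        using circle_vf_slice(1)[where f = h, OF h, of pi p w] orbit[OF ext_slice1[OF h(1), of w], of pi] cis_mpi by simp
      then have even: "(\<lambda>w. ?g (- w)) = ?g" by simp
      have d: "(?g has_derivative D ?g 0) (at 0)"
        by (rule smooth_on_has_derivative[OF ext_slice2[OF h(1)] UNIV_I])
      have "((\<lambda>w. - w) has_derivative (\<lambda>w. - w)) (at (0::complex))"
        by (intro has_derivative_minus has_derivative_ident)
      from has_derivative_compose[OF this, of ?g "D ?g 0"] d
      have "((\<lambda>w. ?g (- w)) has_derivative (\<lambda>w. D ?g 0 (- w))) (at 0)" by simp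
      then have "D ?g 0 = (\<lambda>w. D ?g 0 (- w))" unfolding even by (rule D_eq)
      then have "D ?g 0 \<eta> = D ?g 0 (- \<eta>)" by (rule fun_cong)
      then show ?thesis using linear_neg[OF has_derivative_linear[OF d], of \<eta>] by (simp add: z)
    qed
    show ?thesis unfolding ext_poisson[OF f(1) g(1)] PM by (simp add: D0[of f, OF f(1,2)] D0[of g, OF g(1,2)])
  qed
qed

section \<open>The cut is multiplicity-free\<close>

lemma ext_moment_circle: "u \<in> carrier circle_group \<Longrightarrow> ext_moment \<phi> (ext_circle \<tau> u x) = ext_moment \<phi> x"
  by (cases x) (simp add: ext_moment_def ext_circle_def \<phi>_\<tau>, simp add: circle_group_def norm_mult)

lemma ext_orbit_self: "x \<in> orbit circle_group (ext_circle \<tau>) x"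
proof -
  have "x = ext_circle \<tau> 1 x" by (cases x) (simp add: ext_circle_def \<tau>_one)
  moreover have "1 \<in> carrier circle_group" by (simp add: circle_group_def)
  ultimately show ?thesis unfolding orbit_def by blast
qed

lemma ext_act_orbit:
  "ext_act act k ` orbit circle_group (ext_circle \<tau>) (p, z) = orbit circle_group (ext_circle \<tau>) (act k p, z)"
proof -
  have "ext_act act k (ext_circle \<tau> u (p, z)) = ext_circle \<tau> u (act k p, z)" if "u \<in> carrier circle_group" for u
    using commute[OF that] by (simp add: ext_act_def ext_circle_def)
  then show ?thesis unfolding orbit_def Setcompr_eq_image image_image by (rule image_cong[OF refl])
qed

text \<open>Since \<open>\<phi>\<close> is \<open>K\<close>-invariant, \<open>act k\<close> preserves the level set and maps circle orbits to circle orbits, so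
  invariance of \<open>F\<close> is invariance of \<open>f\<close> on the level set.\<close>

lemma cut_represents_invariant:
  assumes rep: "cut_represents A \<tau> \<phi> c f F" and inv: "cut_invariant \<tau> \<phi> c act F" and q: "ext_moment \<phi> (q, w) = c"
  shows "f (act k q, w) = f (q, w)"
proof -
  let ?o = "orbit circle_group (ext_circle \<tau>)"
  have q': "ext_moment \<phi> (act k q, w) = c" using q by (simp add: ext_moment_def \<phi>_act)
  have "?o (q, w) \<in> cut \<tau> \<phi> c" using q by (auto simp: cut_def)
  then have "F (ext_act act k ` ?o (q, w)) = F (?o (q, w))" using inv by (simp add: cut_invariant_def)
  then have "F (?o (act k q, w)) = F (?o (q, w))" by (simp only: ext_act_orbit)
  moreover have "F (?o (act k q, w)) = f (act k q, w)" "F (?o (q, w)) = f (q, w)"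
    using rep q q' unfolding cut_represents_def by blast+
  ultimately show ?thesis by simp
qed

theorem cut_is_multiplicity_free: "cut_multiplicity_free A \<omega> \<tau> \<phi> c act"
  unfolding cut_multiplicity_free_def
proof (intro allI impI ballI)
  fix F G S
  assume F: "cut_smooth_fun A \<tau> \<phi> c F" "cut_invariant \<tau> \<phi> c act F"
    and G: "cut_smooth_fun A \<tau> \<phi> c G" "cut_invariant \<tau> \<phi> c act G" and S: "S \<in> cut \<tau> \<phi> c"
  obtain x0 where x0: "ext_moment \<phi> x0 = c" "S = orbit circle_group (ext_circle \<tau>) x0" using S by (auto simp: cut_def)
  have zero: "poisson (ext_atlas A) (ext_form A \<omega>) f g x = 0"
    if f: "cut_represents A \<tau> \<phi> c f F" and g: "cut_represents A \<tau> \<phi> c g G" and x: "x \<in> S" for f g x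
  proof -
    obtain p z where pz: "x = (p, z)" by (cases x)
    obtain u where "u \<in> carrier circle_group" "x = ext_circle \<tau> u x0" using x x0(2) unfolding orbit_def by blast
    then have "ext_moment \<phi> (p, z) = c" using ext_moment_circle x0(1) pz by metis
    with f g show ?thesis unfolding pz
      by (intro ext_poisson_zero[where c = c] cut_represents_invariant[OF f F(2)] cut_represents_invariant[OF g G(2)])
        (auto simp: cut_represents_def)
  qed
  obtain f g where "cut_represents A \<tau> \<phi> c f F" "cut_represents A \<tau> \<phi> c g G"
    using F(1) G(1) unfolding cut_smooth_fun_def by blast
  moreover have "x0 \<in> S" using ext_orbit_self x0(2) by simp
  ultimately show "cut_poisson A \<omega> \<tau> \<phi> c F G S = 0"
    unfolding cut_poisson_def using zero by (intro the_equality) metis+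
qed

end

theorem proposition4p5:
  fixes A :: "('m::{t2_space,second_countable_topology}, 'e::{real_inner,heine_borel}) chart set"
    and \<omega> :: "'m form2"
    and \<tau> :: "complex \<Rightarrow> 'm \<Rightarrow> 'm" and \<phi> :: "'m \<Rightarrow> real"
    and K :: "'k::{t2_space,second_countable_topology} monoid"
    and B :: "('k, 'f::{real_inner,heine_borel}) chart set"
    and act :: "'k \<Rightarrow> 'm \<Rightarrow> 'm" and \<mu> :: "'m \<Rightarrow> 'k tvec \<Rightarrow> real"
    and c :: real
  assumes "symplectic_manifold A \<omega>" and "connected (UNIV :: 'm set)"
    and "hamiltonian_circle_action A \<omega> \<tau> \<phi>"
    and "lie_group K B" and "connected (UNIV :: 'k set)"
    and "\<forall>\<alpha>\<in>lie_dual K B. locally_closed_in (top_of_set (lie_dual K B)) (coadjoint_orbit K B \<alpha>)"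
    and "hamiltonian_action K B A \<omega> act \<mu>" and "proper_action act"
    and "\<forall>k. \<forall>u\<in>carrier circle_group. \<forall>p. act k (\<tau> u p) = \<tau> u (act k p)"
    and "multiplicity_free A \<omega> act"
  shows "cut_multiplicity_free A \<omega> \<tau> \<phi> c act"
proof -
  have "commuting_actions A \<omega> \<tau> \<phi> K B act \<mu>"
    using assms by unfold_locales (simp_all add: symplectic_manifold_def)
  then show ?thesis by (rule commuting_actions.cut_is_multiplicity_free)
qed

end
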